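(* Let $\mathbb{M}$ be either $\mathbb{M}_{\rm LOCC}$ or $\mathbb{M}_{\rm SEP}$ and let $P$ be either $\mathcal{D}_{\rm SEP}$ or $\mathcal{D}_{\rm PPT}$. Then the function $\mathbb{M}E^P_R$, defined on states of finite-dimensional $n$-partite systems, satisfies: (a) faithfulness: $\mathbb{M}E^P_R(\rho)=0$ if and only if $\rho\in P$; (b) convexity: $\mathbb{M}E^P_R(\sum_ip_i\rho_i)\leq\sum_ip_i\mathbb{M}E^P_R(\rho_i)$ for every probability distribution $(p_i)$ and states $\rho_i$; (c) strong LOCC monotonicity: if an LOCC operation applied to $\rho^{in}$ yields outcome $i$ with probability $p^{out}_i$ and post-measurement state $\rho^{out}_i$, then $\mathbb{M}E^P_R(\rho^{in})\geq\sum_ip^{out}_i\mathbb{M}E^P_R(\rho^{out}_i)$; (d) strong superadditivity: for any state $\rho_{XY}$ on $X=A_1\cdots A_n$ and $Y=A'_1\cdots A'_n$, where $\rho_{XY}$ is regarded as an $n$-partite state with parties $A_1A'_1,\ldots,A_nA'_n$, one has $\mathbb{M}E^P_R(\rho_{XY})\geq\mathbb{M}E^P_R(\rho_X)+\mathbb{M}E^P_R(\rho_Y)$, with $\rho_X,\rho_Y$ the reduced states.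
   Context: Systems are $n$-partite with finite-dimensional local spaces $\mathcal{H}_1,\ldots,\mathcal{H}_n$ (local dimensions arbitrary). $S(\rho\|\sigma)={\rm Tr}\rho\log\rho-{\rm Tr}\rho\log\sigma$ ($+\infty$ if ${\rm supp}\,\rho\not\subset{\rm supp}\,\sigma$); for distributions $S((p_i)\|(q_i))=\sum_ip_i\log(p_i/q_i)$. A measurement operation associated with a POVM $(M_i)_i$ is $\mathcal{M}(Z)=\sum_i{\rm Tr}(M_iZ)|i\rangle\langle i|$. $\mathbb{M}_{\rm LOCC}$: POVMs implementable by local operations and classical communication among the $n$ parties. $\mathbb{M}_{\rm SEP}$: POVMs with $M_i=\sum_kM^{(1)}_{i,k}\otimes\cdots\otimes M^{(n)}_{i,k}$, $M^{(j)}_{i,k}\geq0$. $\mathcal{D}_{\rm SEP}$: fully separable states $\sum_ip_i\sigma_i^{(1)}\otimes\cdots\otimes\sigma_i^{(n)}$; $\mathcal{D}_{\rm PPT}$: states whose partial transpose with respect to every bipartition of the parties is positive semidefinite. $\mathbb{M}E^P_R(\rho)=\inf_{\sigma\in P}\sup_{\mathcal{M}\in\mathbb{M}}S(\mathcal{M}(\rho)\|\mathcal{M}(\sigma))$. *)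

theory Defs
  imports "HOL-Library.Extended_Real" "Jordan_Normal_Form.Matrix" "Jordan_Normal_Form.Schur_Decomposition"
begin

text \<open>A finite-dimensional n-partite system is described by the list ds of local
dimensions (n = length ds).  Global basis indices a < dimp ds are mixed-radix
numbers whose j-th digit is the index of party j (party 0 most significant, the
usual Kronecker ordering).\<close>

definition dimp :: "nat list \<Rightarrow> nat" where
  "dimp ds = prod_list ds"

definition valid_dims :: "nat list \<Rightarrow> bool" where
  "valid_dims ds \<longleftrightarrow> (\<forall>j<length ds. 0 < ds ! j)"

definition wt :: "nat list \<Rightarrow> nat \<Rightarrow> nat" where
  "wt ds j = (\<Prod>k\<in>{Suc j..<length ds}. ds ! k)"

definition digit :: "nat list \<Rightarrow> nat \<Rightarrow> nat \<Rightarrow> nat" where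
  "digit ds j a = (a div wt ds j) mod (ds ! j)"

definition compose :: "nat list \<Rightarrow> (nat \<Rightarrow> nat) \<Rightarrow> nat" where
  "compose ds f = (\<Sum>j<length ds. f j * wt ds j)"

definition ctrace :: "complex mat \<Rightarrow> complex" where
  "ctrace A = (\<Sum>a<dim_row A. A $$ (a, a))"

definition psd :: "nat \<Rightarrow> complex mat \<Rightarrow> bool" where
  "psd N A \<longleftrightarrow> A \<in> carrier_mat N N \<and>
     (\<forall>v :: nat \<Rightarrow> complex.
        Im (\<Sum>a<N. \<Sum>b<N. cnj (v a) * A $$ (a, b) * v b) = 0 \<and>
        0 \<le> Re (\<Sum>a<N. \<Sum>b<N. cnj (v a) * A $$ (a, b) * v b))"

definition is_state :: "nat \<Rightarrow> complex mat \<Rightarrow> bool" where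
  "is_state N \<rho> \<longleftrightarrow> psd N \<rho> \<and> ctrace \<rho> = 1"

definition tensor_list :: "nat list \<Rightarrow> complex mat list \<Rightarrow> complex mat" where
  "tensor_list ds As = mat (dimp ds) (dimp ds)
     (\<lambda>(a, b). \<Prod>j<length ds. (As ! j) $$ (digit ds j a, digit ds j b))"

definition sep_state :: "nat list \<Rightarrow> complex mat \<Rightarrow> bool" where
  "sep_state ds \<rho> \<longleftrightarrow> is_state (dimp ds) \<rho> \<and>
     (\<exists>(m::nat) (p :: nat \<Rightarrow> real) (\<sigma> :: nat \<Rightarrow> nat \<Rightarrow> complex mat).
        (\<forall>i<m. 0 \<le> p i) \<and> (\<Sum>i<m. p i) = 1 \<and>
        (\<forall>i<m. \<forall>j<length ds. is_state (ds ! j) (\<sigma> i j)) \<and>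
        \<rho> = mat (dimp ds) (dimp ds)
              (\<lambda>ab. \<Sum>i<m. complex_of_real (p i) *
                        tensor_list ds (map (\<sigma> i) [0..<length ds]) $$ ab))"

definition mixidx :: "nat list \<Rightarrow> nat set \<Rightarrow> nat \<Rightarrow> nat \<Rightarrow> nat" where
  "mixidx ds S a b = compose ds (\<lambda>j. if j \<in> S then digit ds j b else digit ds j a)"

definition ptrans :: "nat list \<Rightarrow> nat set \<Rightarrow> complex mat \<Rightarrow> complex mat" where
  "ptrans ds S A = mat (dimp ds) (dimp ds)
     (\<lambda>(a, b). A $$ (mixidx ds S a b, mixidx ds S b a))"

definition ppt_state :: "nat list \<Rightarrow> complex mat \<Rightarrow> bool" where
  "ppt_state ds \<rho> \<longleftrightarrow> is_state (dimp ds) \<rho> \<and>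
     (\<forall>S. S \<subseteq> {..<length ds} \<longrightarrow> psd (dimp ds) (ptrans ds S \<rho>))"

definition povm :: "nat \<Rightarrow> complex mat list \<Rightarrow> bool" where
  "povm N Ms \<longleftrightarrow> (\<forall>M\<in>set Ms. psd N M) \<and>
     mat N N (\<lambda>ab. \<Sum>M\<leftarrow>Ms. M $$ ab) = 1\<^sub>m N"

definition sep_povm :: "nat list \<Rightarrow> complex mat list \<Rightarrow> bool" where
  "sep_povm ds Ms \<longleftrightarrow> povm (dimp ds) Ms \<and>
     (\<forall>M\<in>set Ms. \<exists>(m::nat) (F :: nat \<Rightarrow> nat \<Rightarrow> complex mat).
        (\<forall>k<m. \<forall>j<length ds. psd (ds ! j) (F k j)) \<and>
        M = mat (dimp ds) (dimp ds)
              (\<lambda>ab. \<Sum>k<m. tensor_list ds (map (F k) [0..<length ds]) $$ ab))"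

definition embed :: "nat list \<Rightarrow> nat list \<Rightarrow> nat \<Rightarrow> complex mat \<Rightarrow> complex mat" where
  "embed ds ds' j K = mat (dimp ds') (dimp ds)
     (\<lambda>(a, b). K $$ (digit ds' j a, digit ds j b) *
        (\<Prod>k\<in>{..<length ds} - {j}. if digit ds' k a = digit ds k b then 1 else 0))"

text \<open>A local instrument on a d-dimensional space: outcomes x with output
dimension fst (I!x) and Kraus operators snd (I!x).\<close>
definition local_instrument :: "nat \<Rightarrow> (nat \<times> complex mat list) list \<Rightarrow> bool" where
  "local_instrument d I \<longleftrightarrow> I \<noteq> [] \<and>
     (\<forall>x\<in>set I. 0 < fst x \<and> (\<forall>K\<in>set (snd x). K \<in> carrier_mat (fst x) d)) \<and>
     mat d d (\<lambda>ab. \<Sum>x\<leftarrow>I. \<Sum>K\<leftarrow>snd x. (mat_adjoint K * K) $$ ab) = 1\<^sub>m d"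

text \<open>LOCC instruments (finitely many rounds, finitely many outcomes).  An
instrument is a list of outcomes; each outcome is a pair (output local dimensions,
Kraus operators).  Rounds: some party applies a local instrument, broadcasts the
outcome, and the protocol continues depending on it.  Outcomes with equal output
dimensions may be coarse-grained.\<close>
inductive locc_instr :: "nat list \<Rightarrow> (nat list \<times> complex mat list) list \<Rightarrow> bool" where
  idI: "valid_dims ds \<Longrightarrow> locc_instr ds [(ds, [1\<^sub>m (dimp ds)])]"
| stepI: "valid_dims ds \<Longrightarrow> j < length ds \<Longrightarrow> local_instrument (ds ! j) I \<Longrightarrow>
    (\<forall>x<length I. locc_instr (ds[j := fst (I ! x)]) (L x)) \<Longrightarrow>
    locc_instr ds (concat (map (\<lambda>x. map (\<lambda>q. (fst q,
        [K * embed ds (ds[j := fst (I ! x)]) j Kl. K \<leftarrow> snd q, Kl \<leftarrow> snd (I ! x)])) (L x))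
      [0..<length I]))"
| mergeI: "locc_instr ds (L1 @ [(ds', K1)] @ L2 @ [(ds', K2)] @ L3) \<Longrightarrow>
    locc_instr ds (L1 @ [(ds', K1 @ K2)] @ L2 @ L3)"

definition povm_of_instr :: "nat list \<Rightarrow> (nat list \<times> complex mat list) list \<Rightarrow> complex mat list" where
  "povm_of_instr ds L = map (\<lambda>q. mat (dimp ds) (dimp ds)
      (\<lambda>ab. \<Sum>K\<leftarrow>snd q. (mat_adjoint K * K) $$ ab)) L"

definition locc_povm :: "nat list \<Rightarrow> complex mat list \<Rightarrow> bool" where
  "locc_povm ds Ms \<longleftrightarrow> (\<exists>L. locc_instr ds L \<and> Ms = povm_of_instr ds L)"

definition meas :: "complex mat list \<Rightarrow> complex mat \<Rightarrow> real list" where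
  "meas Ms \<rho> = map (\<lambda>M. Re (ctrace (M * \<rho>))) Ms"

definition rel_ent :: "real list \<Rightarrow> real list \<Rightarrow> ereal" where
  "rel_ent p q = (if \<exists>i<length p. 0 < p ! i \<and> q ! i = 0 then \<infinity>
     else ereal (\<Sum>i<length p. if p ! i = 0 then 0 else p ! i * ln (p ! i / q ! i)))"

definition ME :: "(nat list \<Rightarrow> complex mat list \<Rightarrow> bool) \<Rightarrow> (nat list \<Rightarrow> complex mat \<Rightarrow> bool)
                   \<Rightarrow> nat list \<Rightarrow> complex mat \<Rightarrow> ereal" where
  "ME MM P ds \<rho> = (INF \<sigma>\<in>{\<sigma>. P ds \<sigma>}. SUP Ms\<in>{Ms. MM ds Ms}. rel_ent (meas Ms \<rho>) (meas Ms \<sigma>))"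

definition out_unnorm :: "(nat list \<times> complex mat list) list \<Rightarrow> nat \<Rightarrow> complex mat \<Rightarrow> complex mat" where
  "out_unnorm L i \<rho> = mat (dimp (fst (L ! i))) (dimp (fst (L ! i)))
     (\<lambda>ab. \<Sum>K\<leftarrow>snd (L ! i). (K * \<rho> * mat_adjoint K) $$ ab)"

definition out_prob :: "(nat list \<times> complex mat list) list \<Rightarrow> nat \<Rightarrow> complex mat \<Rightarrow> real" where
  "out_prob L i \<rho> = Re (ctrace (out_unnorm L i \<rho>))"

definition out_state :: "(nat list \<times> complex mat list) list \<Rightarrow> nat \<Rightarrow> complex mat \<Rightarrow> complex mat" where
  "out_state L i \<rho> = complex_of_real (1 / out_prob L i \<rho>) \<cdot>\<^sub>m out_unnorm L i \<rho>"

definition mixture :: "nat \<Rightarrow> nat \<Rightarrow> (nat \<Rightarrow> real) \<Rightarrow> (nat \<Rightarrow> complex mat) \<Rightarrow> complex mat" where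
  "mixture N m p \<rho>s = mat N N (\<lambda>ab. \<Sum>i<m. complex_of_real (p i) * \<rho>s i $$ ab)"

text \<open>Parties A_j A'_j have local dimension ds!j * ds'!j; the local index of
A_j A'_j is (index of A_j) * ds'!j + (index of A'_j).\<close>
definition joint_dims :: "nat list \<Rightarrow> nat list \<Rightarrow> nat list" where
  "joint_dims ds ds' = map2 (*) ds ds'"

definition joinidx :: "nat list \<Rightarrow> nat list \<Rightarrow> nat \<Rightarrow> nat \<Rightarrow> nat" where
  "joinidx ds ds' a c = compose (joint_dims ds ds') (\<lambda>j. digit ds j a * ds' ! j + digit ds' j c)"

definition red_X :: "nat list \<Rightarrow> nat list \<Rightarrow> complex mat \<Rightarrow> complex mat" where
  "red_X ds ds' \<rho> = mat (dimp ds) (dimp ds)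
     (\<lambda>(a, b). \<Sum>c<dimp ds'. \<rho> $$ (joinidx ds ds' a c, joinidx ds ds' b c))"

definition red_Y :: "nat list \<Rightarrow> nat list \<Rightarrow> complex mat \<Rightarrow> complex mat" where
  "red_Y ds ds' \<rho> = mat (dimp ds') (dimp ds')
     (\<lambda>(a, b). \<Sum>c<dimp ds. \<rho> $$ (joinidx ds ds' c a, joinidx ds ds' c b))"

end

theory Submission
  imports "HOL-Analysis.Topology_Euclidean_Space" Defs
begin

text \<open>
  Tensor products of rectangular matrices turn every LOCC protocol into a sum of conjugations by
  product operators, so both cones of free states and the class of separable effects are stable
  under LOCC.  For a free state \<open>\<sigma>\<close>, a measurement that first applies an LOCC
  instrument (or measures the first half of a joint system) and then, depending on the outcome
  \<open>i\<close>, a further measurement, is again in the class.  The chain rule for the relative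
  entropy splits its value into the relative entropy of the outcome distributions and the average
  over \<open>i\<close> of the relative entropies of the conditional states; the conditional states of
  \<open>\<sigma>\<close> are again free.  Suprema over the second measurements give
  strong monotonicity, and together with convexity (the log-sum inequality) strong
  superadditivity.  Faithfulness holds because product effects determine the entries of a matrix and
  the sets of free states are closed; for separable states this is Caratheodory's theorem combined with
  compactness.
\<close>

subsection \<open>Mixed-radix indices\<close>

text \<open>For a fixed free state the value is a supremum over measurements, so lower bounds come
  from exhibiting composite measurements, and the infimum over \<sigma> can wait until the end. The
  work lies in keeping adaptive composites inside the class: LOCC is given by trees of Kraus
  operators with merging of outcomes, and the trees are rewritten in terms of effects, where merging
  is addition. The infimum is not known to be attained, so faithfulness runs along a minimising
  sequence; a Hellinger-type lower bound on the relative entropy turns small values into convergence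
  of the statistics. Positivity is handled by Gram vectors, obtained by elimination. Products of
  Gram vectors are Gram vectors of tensor products, and the product vectors of a separable effect
  act as product operators onto the system that is left over; this is why contraction with such an
  effect respects every cone involved. Entropies live in \<open>ereal\<close>; outcomes of
  probability zero and infinite terms cause the case distinctions in the chain rule.\<close>

lemma dimp_Cons: "dimp (d # ds) = d * dimp ds"
  by (simp add: dimp_def)

lemma valid_dims_Cons: "valid_dims (d # ds) \<longleftrightarrow> 0 < d \<and> valid_dims ds"
  unfolding valid_dims_def by (auto simp: nth_Cons' All_less_Suc2)

lemma dimp_pos: "valid_dims ds \<Longrightarrow> 0 < dimp ds"
  by (induction ds) (auto simp: dimp_Cons valid_dims_Cons, simp add: dimp_def)

lemma dimp_eq_wt: "dimp ds = (\<Prod>k<length ds. ds ! k)"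
  by (simp add: dimp_def prod.list_conv_set_nth atLeast0LessThan)

lemma wt_Cons_0: "wt (d # ds) 0 = dimp ds"
proof -
  have "wt (d # ds) 0 = (\<Prod>k\<in>{Suc 0..<Suc (length ds)}. (d # ds) ! k)"
    by (simp add: wt_def)
  also have "\<dots> = (\<Prod>k<length ds. ds ! k)"
    unfolding prod.shift_bounds_Suc_ivl by (simp add: atLeast0LessThan)
  finally show ?thesis by (simp add: dimp_eq_wt)
qed

lemma wt_Cons_Suc: "wt (d # ds) (Suc j) = wt ds j"
proof -
  have "wt (d # ds) (Suc j) = (\<Prod>k\<in>{Suc (Suc j)..<Suc (length ds)}. (d # ds) ! k)"
    by (simp add: wt_def)
  also have "\<dots> = (\<Prod>k\<in>{Suc j..<length ds}. ds ! k)"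
    unfolding prod.shift_bounds_Suc_ivl by simp
  finally show ?thesis by (simp add: wt_def)
qed

lemma digit_Cons_0: "digit (d # ds) 0 a = (a div dimp ds) mod d"
  by (simp add: digit_def wt_Cons_0)

lemma digit_Cons_Suc: "digit (d # ds) (Suc j) a = digit ds j a"
  by (simp add: digit_def wt_Cons_Suc)

lemma compose_Cons: "compose (d # ds) f = f 0 * dimp ds + compose ds (\<lambda>j. f (Suc j))"
  by (simp add: compose_def sum.lessThan_Suc_shift wt_Cons_0 wt_Cons_Suc del: sum.lessThan_Suc)

lemma compose_cong: "(\<And>j. j < length ds \<Longrightarrow> f j = g j) \<Longrightarrow> compose ds f = compose ds g"
  by (simp add: compose_def)

lemma compose_less:
  "\<forall>j<length ds. f j < ds ! j \<Longrightarrow> compose ds f < dimp ds"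
proof (induction ds arbitrary: f)
  case Nil
  then show ?case by (simp add: compose_def dimp_def)
next
  case (Cons d ds)
  have f0: "f 0 < d" using Cons.prems by auto
  have "compose ds (\<lambda>j. f (Suc j)) < dimp ds" using Cons.prems by (intro Cons.IH) force
  then have "compose (d # ds) f < Suc (f 0) * dimp ds" by (simp add: compose_Cons)
  also have "\<dots> \<le> d * dimp ds" using f0 by (intro mult_le_mono1) simp
  finally show ?case by (simp add: dimp_Cons)
qed

lemma wt_mult_dvd_dimp: "j < length ds \<Longrightarrow> wt ds j * ds ! j dvd dimp ds"
proof (induction ds arbitrary: j)
  case (Cons d ds)
  then show ?case
    by (cases j) (auto simp: wt_Cons_0 wt_Cons_Suc dimp_Cons mult.commute)
qed simp

text \<open>Dropping the leading digit of an index is reduction modulo \<open>dimp\<close> of the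
  tail. Since \<open>wt ds j * ds ! j\<close> divides \<open>dimp ds\<close>, that reduction is
  invisible to the remaining digits, which is what the inductions over the list of dimensions
  use.\<close>

lemma digit_mod_dimp: "j < length ds \<Longrightarrow> digit ds j (a mod dimp ds) = digit ds j a"
proof -
  assume "j < length ds"
  then obtain r where r: "dimp ds = wt ds j * (ds ! j * r)"
    using wt_mult_dvd_dimp[of j ds] by (auto simp: dvd_def mult.assoc)
  show ?thesis
  proof (cases "wt ds j = 0")
    case False
    then show ?thesis
      unfolding digit_def r by (simp add: mod_mult2_eq)
  qed (simp add: digit_def)
qed

lemma digit_less: "valid_dims ds \<Longrightarrow> j < length ds \<Longrightarrow> digit ds j a < ds ! j"
  by (simp add: digit_def valid_dims_def)

lemma digit_compose:
  "\<forall>j<length ds. f j < ds ! j \<Longrightarrow> j < length ds \<Longrightarrow> digit ds j (compose ds f) = f j"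
proof (induction ds arbitrary: f j)
  case (Cons d ds)
  have l: "compose ds (\<lambda>j. f (Suc j)) < dimp ds"
    using Cons.prems by (intro compose_less) auto
  show ?case
  proof (cases j)
    case 0
    have "f 0 < d" using Cons.prems(1) by force
    then show ?thesis using l 0 by (simp add: digit_Cons_0 compose_Cons)
  next
    case (Suc i)
    have "digit (d # ds) j (compose (d # ds) f) = digit ds i (compose (d # ds) f mod dimp ds)"
      using Suc Cons.prems by (simp add: digit_Cons_Suc digit_mod_dimp)
    also have "compose (d # ds) f mod dimp ds = compose ds (\<lambda>j. f (Suc j))"
      using l by (simp add: compose_Cons)
    also have "digit ds i (compose ds (\<lambda>j. f (Suc j))) = f (Suc i)"
      using Cons.prems Suc by (intro Cons.IH) force+
    finally show ?thesis using Suc by simp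
  qed
qed simp

lemma compose_digit: "a < dimp ds \<Longrightarrow> compose ds (\<lambda>j. digit ds j a) = a"
proof (induction ds arbitrary: a)
  case Nil
  then show ?case by (simp add: compose_def dimp_def)
next
  case (Cons d ds)
  have pos: "0 < dimp ds" using Cons.prems by (cases "dimp ds = 0") (auto simp: dimp_Cons)
  have "compose ds (\<lambda>j. digit ds j a) = compose ds (\<lambda>j. digit ds j (a mod dimp ds))"
    by (intro compose_cong) (simp add: digit_mod_dimp)
  also have "\<dots> = a mod dimp ds" using pos by (intro Cons.IH) simp
  finally have 1: "compose ds (\<lambda>j. digit ds j a) = a mod dimp ds" .
  have "a div dimp ds < d" using Cons.prems pos by (simp add: dimp_Cons less_mult_imp_div_less)
  then show ?case
    by (simp add: compose_Cons digit_Cons_0 digit_Cons_Suc 1)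
qed

lemma digits_eqI:
  assumes "a < dimp ds" "b < dimp ds" "\<And>j. j < length ds \<Longrightarrow> digit ds j a = digit ds j b"
  shows "a = b"
proof -
  have "a = compose ds (\<lambda>j. digit ds j a)" using assms(1) by (rule compose_digit[symmetric])
  also have "\<dots> = compose ds (\<lambda>j. digit ds j b)" using assms(3) by (rule compose_cong)
  also have "\<dots> = b" using assms(2) by (rule compose_digit)
  finally show ?thesis .
qed

text \<open>Indices correspond to choice functions. The digits are restricted to the parties because
  members of \<open>PiE\<close> are extensional, while \<open>compose\<close> only looks at
  arguments below \<open>length ds\<close>.\<close>

lemma bij_betw_digits:
  assumes "valid_dims ds"
  shows "bij_betw (\<lambda>a. \<lambda>j\<in>{..<length ds}. digit ds j a) {..<dimp ds}
           (PiE {..<length ds} (\<lambda>j. {..<ds ! j}))"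
proof (rule bij_betwI[where g = "compose ds"])
  show "(\<lambda>a. \<lambda>j\<in>{..<length ds}. digit ds j a) \<in> {..<dimp ds} \<rightarrow> (PiE {..<length ds} (\<lambda>j. {..<ds ! j}))"
    using digit_less[OF assms] by auto
  show "compose ds \<in> (PiE {..<length ds} (\<lambda>j. {..<ds ! j})) \<rightarrow> {..<dimp ds}"
    by (auto intro!: compose_less)
  show "compose ds (\<lambda>j\<in>{..<length ds}. digit ds j x) = x" if "x \<in> {..<dimp ds}" for x
  proof -
    have "compose ds (\<lambda>j\<in>{..<length ds}. digit ds j x) = compose ds (\<lambda>j. digit ds j x)"
      by (rule compose_cong) simp
    then show ?thesis using compose_digit[of x ds] that by simp
  qed
  show "(\<lambda>j\<in>{..<length ds}. digit ds j (compose ds f)) = f"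
    if "f \<in> PiE {..<length ds} (\<lambda>j. {..<ds ! j})" for f
  proof
    fix j
    have "\<forall>j<length ds. f j < ds ! j" using that by auto
    then show "(\<lambda>j\<in>{..<length ds}. digit ds j (compose ds f)) j = f j"
      using digit_compose[of ds f j] PiE_arb[OF that, of j] by (cases "j < length ds") simp_all
  qed
qed

text \<open>A sum over global indices of a product over the parties factorises by distributivity.
  Multiplicativity of \<open>trect\<close> and the trace of a tensor product both come from
  here.\<close>

lemma sum_prod_digits:
  fixes g :: "nat \<Rightarrow> nat \<Rightarrow> 'a :: comm_semiring_1"
  assumes "valid_dims ds"
  shows "(\<Sum>a<dimp ds. \<Prod>j<length ds. g j (digit ds j a)) = (\<Prod>j<length ds. \<Sum>x<ds ! j. g j x)"
proof -
  have "(\<Prod>j<length ds. \<Sum>x<ds ! j. g j x) =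
      (\<Sum>f\<in>PiE {..<length ds} (\<lambda>j. {..<ds ! j}). \<Prod>j<length ds. g j (f j))"
    by (intro prod_sum_PiE) auto
  also have "\<dots> = (\<Sum>a<dimp ds. \<Prod>j<length ds. g j ((\<lambda>j\<in>{..<length ds}. digit ds j a) j))"
    by (rule sum.reindex_bij_betw[OF bij_betw_digits[OF assms], symmetric])
  also have "\<dots> = (\<Sum>a<dimp ds. \<Prod>j<length ds. g j (digit ds j a))"
    by (intro sum.cong prod.cong) auto
  finally show ?thesis by simp
qed

lemma prod_digit_delta:
  assumes "a < dimp ds" "b < dimp ds"
  shows "(\<Prod>j<length ds. if digit ds j a = digit ds j b then 1 else 0 :: 'a :: comm_semiring_1) =
    (if a = b then 1 else 0)"
proof (cases "a = b")
  case False
  then obtain j where "j < length ds" "digit ds j a \<noteq> digit ds j b"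
    using digits_eqI[OF assms] by auto
  then show ?thesis using False by (auto intro!: prod_zero)
qed auto

subsection \<open>Matrix entries, adjoint and trace\<close>

lemma dim_mat_adjoint [simp]:
  "dim_row (mat_adjoint A) = dim_col A" "dim_col (mat_adjoint A) = dim_row A"
  by (simp_all add: mat_adjoint_def)

lemma carrier_mat_adjoint [simp]:
  "A \<in> carrier_mat n m \<Longrightarrow> mat_adjoint A \<in> carrier_mat m n"
  by (intro carrier_matI) auto

lemma index_mat_adjoint:
  "i < dim_col A \<Longrightarrow> j < dim_row A \<Longrightarrow> mat_adjoint (A :: complex mat) $$ (i, j) = cnj (A $$ (j, i))"
  by (simp add: mat_adjoint_def mat_of_rows_index)

lemma index_mult_sum:
  "A \<in> carrier_mat n m \<Longrightarrow> B \<in> carrier_mat m k \<Longrightarrow> i < n \<Longrightarrow> j < k \<Longrightarrow>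
    (A * B) $$ (i, j) = (\<Sum>l<m. A $$ (i, l) * B $$ (l, j))"
  by (auto simp: scalar_prod_def atLeast0LessThan intro!: sum.cong)

lemma mat_adjoint_mult:
  assumes "A \<in> carrier_mat n m" "B \<in> carrier_mat m k"
  shows "mat_adjoint (A * B) = mat_adjoint B * mat_adjoint (A :: complex mat)"
proof (rule eq_matI)
  fix i j assume "i < dim_row (mat_adjoint B * mat_adjoint A)" "j < dim_col (mat_adjoint B * mat_adjoint A)"
  then have ij: "i < k" "j < n" using assms by auto
  have "mat_adjoint (A * B) $$ (i, j) = cnj ((A * B) $$ (j, i))"
    using ij assms by (intro index_mat_adjoint) auto
  also have "\<dots> = (\<Sum>l<m. cnj (A $$ (j, l)) * cnj (B $$ (l, i)))"
    by (simp add: index_mult_sum[OF assms ij(2,1)])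
  also have "\<dots> = (\<Sum>l<m. mat_adjoint B $$ (i, l) * mat_adjoint A $$ (l, j))"
    using ij assms by (intro sum.cong) (auto simp: index_mat_adjoint)
  also have "\<dots> = (mat_adjoint B * mat_adjoint A) $$ (i, j)"
    using ij assms by (intro index_mult_sum[symmetric, of _ k m _ n]) auto
  finally show "mat_adjoint (A * B) $$ (i, j) = (mat_adjoint B * mat_adjoint A) $$ (i, j)" .
qed (use assms in auto)

lemma mat_adjoint_adjoint [simp]: "mat_adjoint (mat_adjoint A) = (A :: complex mat)"
  by (rule eq_matI) (auto simp: index_mat_adjoint)

lemma mat_adjoint_one [simp]: "mat_adjoint (1\<^sub>m n :: complex mat) = 1\<^sub>m n"
  by (rule eq_matI) (auto simp: index_mat_adjoint)

lemma index_conj_sum: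
  assumes "K \<in> carrier_mat n m" "A \<in> carrier_mat m m" "i < n" "j < n"
  shows "(K * A * mat_adjoint K) $$ (i, j) =
    (\<Sum>k<m. \<Sum>l<m. K $$ (i, k) * A $$ (k, l) * cnj (K $$ (j, l)))"
proof -
  have "(K * A * mat_adjoint K) $$ (i, j) = (\<Sum>l<m. (K * A) $$ (i, l) * mat_adjoint K $$ (l, j))"
    using assms by (intro index_mult_sum[of _ n m _ n]) auto
  also have "\<dots> = (\<Sum>l<m. (\<Sum>k<m. K $$ (i, k) * A $$ (k, l)) * cnj (K $$ (j, l)))"
    using assms by (intro sum.cong) (auto simp: index_mat_adjoint index_mult_sum[OF assms(1,2)] simp del: index_mult_mat)
  also have "\<dots> = (\<Sum>k<m. \<Sum>l<m. K $$ (i, k) * A $$ (k, l) * cnj (K $$ (j, l)))"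
    unfolding sum_distrib_right by (rule sum.swap)
  finally show ?thesis .
qed

lemma ctrace_mult:
  assumes "A \<in> carrier_mat n m" "B \<in> carrier_mat m n"
  shows "ctrace (A * B) = (\<Sum>i<n. \<Sum>j<m. A $$ (i, j) * B $$ (j, i))"
  using assms unfolding ctrace_def by (auto simp: index_mult_sum[OF assms] simp del: index_mult_mat(1))

lemma ctrace_comm:
  assumes "A \<in> carrier_mat n m" "B \<in> carrier_mat m n"
  shows "ctrace (A * B) = ctrace (B * A)"
  unfolding ctrace_mult[OF assms] ctrace_mult[OF assms(2,1)]
  by (subst sum.swap) (simp add: mult.commute)

subsection \<open>Tensor products of rectangular matrices\<close>

text \<open>\<open>ds\<close> holds the input dimensions (columns) and \<open>ds'\<close> the output
  dimensions (rows). The factors may be rectangular because a local instrument may change the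
  dimension of its party.\<close>

definition trect :: "nat list \<Rightarrow> nat list \<Rightarrow> (nat \<Rightarrow> complex mat) \<Rightarrow> complex mat" where
  "trect ds ds' K = mat (dimp ds') (dimp ds)
     (\<lambda>(a, b). \<Prod>j<length ds. K j $$ (digit ds' j a, digit ds j b))"

definition local_ops :: "nat list \<Rightarrow> nat list \<Rightarrow> (nat \<Rightarrow> complex mat) \<Rightarrow> bool" where
  "local_ops ds ds' K \<longleftrightarrow> valid_dims ds \<and> valid_dims ds' \<and> length ds' = length ds \<and>
     (\<forall>j<length ds. K j \<in> carrier_mat (ds' ! j) (ds ! j))"

lemma trect_carrier [simp]: "trect ds ds' K \<in> carrier_mat (dimp ds') (dimp ds)"
  by (simp add: trect_def)

lemma index_trect:
  "a < dimp ds' \<Longrightarrow> b < dimp ds \<Longrightarrow>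
    trect ds ds' K $$ (a, b) = (\<Prod>j<length ds. K j $$ (digit ds' j a, digit ds j b))"
  by (simp add: trect_def)

lemma trect_cong: "(\<And>j. j < length ds \<Longrightarrow> K j = L j) \<Longrightarrow> trect ds ds' K = trect ds ds' L"
  unfolding trect_def by (intro cong_mat) auto

lemma tensor_list_eq_trect: "tensor_list ds (map F [0..<length ds]) = trect ds ds F"
  unfolding tensor_list_def trect_def by (intro cong_mat) (auto intro!: prod.cong)

lemma local_ops_mult:
  "local_ops ds ds' K \<Longrightarrow> local_ops ds' ds'' L \<Longrightarrow> local_ops ds ds'' (\<lambda>j. L j * K j)"
  by (auto simp: local_ops_def)

lemma local_ops_adjoint: "local_ops ds ds' K \<Longrightarrow> local_ops ds' ds (\<lambda>j. mat_adjoint (K j))"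
  by (auto simp: local_ops_def)

lemma local_ops_one: "valid_dims ds \<Longrightarrow> local_ops ds ds (\<lambda>j. 1\<^sub>m (ds ! j))"
  by (auto simp: local_ops_def)

lemma trect_mult:
  assumes K: "local_ops ds ds' K" and L: "local_ops ds' ds'' L"
  shows "trect ds' ds'' L * trect ds ds' K = trect ds ds'' (\<lambda>j. L j * K j)"
proof (rule eq_matI)
  have len: "length ds' = length ds" "length ds'' = length ds"
    and v: "valid_dims ds" "valid_dims ds'" "valid_dims ds''"
    using K L by (auto simp: local_ops_def)
  fix a b assume "a < dim_row (trect ds ds'' (\<lambda>j. L j * K j))" "b < dim_col (trect ds ds'' (\<lambda>j. L j * K j))"
  then have ab: "a < dimp ds''" "b < dimp ds" by (auto simp: trect_def)
  have "(trect ds' ds'' L * trect ds ds' K) $$ (a, b) =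
      (\<Sum>c<dimp ds'. trect ds' ds'' L $$ (a, c) * trect ds ds' K $$ (c, b))"
    using ab by (intro index_mult_sum) auto
  also have "\<dots> = (\<Sum>c<dimp ds'. \<Prod>j<length ds'. L j $$ (digit ds'' j a, digit ds' j c) * K j $$ (digit ds' j c, digit ds j b))"
    using ab by (intro sum.cong) (auto simp: index_trect len prod.distrib)
  also have "\<dots> = (\<Prod>j<length ds'. \<Sum>x<ds' ! j. L j $$ (digit ds'' j a, x) * K j $$ (x, digit ds j b))"
    by (rule sum_prod_digits[OF v(2)])
  also have "\<dots> = (\<Prod>j<length ds. (L j * K j) $$ (digit ds'' j a, digit ds j b))"
    unfolding len
  proof (rule prod.cong[OF refl])
    fix j assume "j \<in> {..<length ds}"
    then show "(\<Sum>x<ds' ! j. L j $$ (digit ds'' j a, x) * K j $$ (x, digit ds j b)) =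
        (L j * K j) $$ (digit ds'' j a, digit ds j b)"
      using K L v len digit_less[OF v(1), of j b] digit_less[OF v(3), of j a]
      by (intro index_mult_sum[symmetric]) (auto simp: local_ops_def)
  qed
  finally show "(trect ds' ds'' L * trect ds ds' K) $$ (a, b) = trect ds ds'' (\<lambda>j. L j * K j) $$ (a, b)"
    using ab by (simp add: index_trect del: index_mult_mat)
qed (auto simp: trect_def)

lemma trect_one:
  assumes "valid_dims ds"
  shows "trect ds ds (\<lambda>j. 1\<^sub>m (ds ! j)) = 1\<^sub>m (dimp ds)"
proof (rule eq_matI)
  fix a b assume "a < dim_row (1\<^sub>m (dimp ds))" "b < dim_col (1\<^sub>m (dimp ds))"
  then have ab: "a < dimp ds" "b < dimp ds" by auto
  have "trect ds ds (\<lambda>j. 1\<^sub>m (ds ! j)) $$ (a, b) =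
      (\<Prod>j<length ds. if digit ds j a = digit ds j b then 1 else 0)"
    using ab digit_less[OF assms] by (simp add: index_trect)
  then show "trect ds ds (\<lambda>j. 1\<^sub>m (ds ! j)) $$ (a, b) = 1\<^sub>m (dimp ds) $$ (a, b)"
    using ab by (simp add: prod_digit_delta)
qed (auto simp: trect_def)

lemma trect_adjoint:
  assumes "local_ops ds ds' K"
  shows "mat_adjoint (trect ds ds' K) = trect ds' ds (\<lambda>j. mat_adjoint (K j))"
proof (rule eq_matI)
  have len: "length ds' = length ds"
    and v: "valid_dims ds" "valid_dims ds'" and K: "\<And>j. j < length ds \<Longrightarrow> K j \<in> carrier_mat (ds' ! j) (ds ! j)"
    using assms by (auto simp: local_ops_def)
  fix a b assume "a < dim_row (trect ds' ds (\<lambda>j. mat_adjoint (K j)))" "b < dim_col (trect ds' ds (\<lambda>j. mat_adjoint (K j)))"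
  then have ab: "a < dimp ds" "b < dimp ds'" by (auto simp: trect_def)
  have "mat_adjoint (trect ds ds' K) $$ (a, b) = cnj (trect ds ds' K $$ (b, a))"
    using ab by (intro index_mat_adjoint) (auto simp: trect_def)
  also have "\<dots> = (\<Prod>j<length ds. mat_adjoint (K j) $$ (digit ds j a, digit ds' j b))"
    unfolding index_trect[OF ab(2,1)] cnj_prod
  proof (rule prod.cong[OF refl])
    fix j assume "j \<in> {..<length ds}"
    then show "cnj (K j $$ (digit ds' j b, digit ds j a)) = mat_adjoint (K j) $$ (digit ds j a, digit ds' j b)"
      using digit_less[OF v(1), of j a] digit_less[OF v(2), of j b] K[of j] len
      by (simp add: index_mat_adjoint)
  qed
  finally show "mat_adjoint (trect ds ds' K) $$ (a, b) = trect ds' ds (\<lambda>j. mat_adjoint (K j)) $$ (a, b)"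
    using ab len by (simp add: index_trect)
qed (auto simp: trect_def)

lemma trect_conj:
  assumes K: "local_ops ds ds' K" and F: "\<forall>j<length ds. F j \<in> carrier_mat (ds ! j) (ds ! j)"
  shows "trect ds ds' K * trect ds ds F * mat_adjoint (trect ds ds' K) =
    trect ds' ds' (\<lambda>j. K j * F j * mat_adjoint (K j))"
proof -
  have F': "local_ops ds ds F" using K F by (auto simp: local_ops_def)
  show ?thesis
    by (simp add: trect_adjoint[OF K] trect_mult[OF F' K]
        trect_mult[OF local_ops_adjoint[OF K] local_ops_mult[OF F' K]])
qed

lemma valid_dims_update: "valid_dims ds \<Longrightarrow> 0 < d \<Longrightarrow> valid_dims (ds[j := d])"
  unfolding valid_dims_def by (metis length_list_update nth_list_update_eq nth_list_update_neq)

lemma local_ops_embed: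
  assumes "valid_dims ds" "j < length ds" "0 < d" "K \<in> carrier_mat d (ds ! j)"
  shows "local_ops ds (ds[j := d]) (\<lambda>k. if k = j then K else 1\<^sub>m (ds ! k))"
  using assms valid_dims_update by (auto simp: local_ops_def)

text \<open>The Kronecker deltas in \<open>embed\<close> are the entries of identity matrices at the
  digits of the other parties. This makes every step of an LOCC protocol a product operator.\<close>

lemma embed_eq_trect:
  assumes v: "valid_dims ds" and j: "j < length ds" and d: "0 < d" and K: "K \<in> carrier_mat d (ds ! j)"
  shows "embed ds (ds[j := d]) j K = trect ds (ds[j := d]) (\<lambda>k. if k = j then K else 1\<^sub>m (ds ! k))"
  unfolding embed_def trect_def
proof (intro cong_mat refl, clarify)
  fix a b
  let ?ds' = "ds[j := d]"
  let ?f = "\<lambda>k. (if k = j then K else 1\<^sub>m (ds ! k)) $$ (digit ?ds' k a, digit ds k b)"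
  have "(\<Prod>k<length ds. ?f k) = ?f j * (\<Prod>k\<in>{..<length ds} - {j}. ?f k)"
    using j by (intro prod.remove) auto
  also have "(\<Prod>k\<in>{..<length ds} - {j}. ?f k) =
      (\<Prod>k\<in>{..<length ds} - {j}. if digit ?ds' k a = digit ds k b then 1 else 0)"
  proof (rule prod.cong[OF refl])
    fix k assume k: "k \<in> {..<length ds} - {j}"
    then have "digit ?ds' k a < ds ! k" "digit ds k b < ds ! k"
      using digit_less[OF v, of k b] digit_less[OF valid_dims_update[OF v d, of j], of k a] by auto
    then show "?f k = (if digit ?ds' k a = digit ds k b then 1 else 0)" using k by auto
  qed
  finally show "K $$ (digit ?ds' j a, digit ds j b) *
      (\<Prod>k\<in>{..<length ds} - {j}. if digit ?ds' k a = digit ds k b then 1 else 0) = (\<Prod>k<length ds. ?f k)"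
    by simp
qed

subsection \<open>Positive semidefinite matrices\<close>

definition qform :: "nat \<Rightarrow> complex mat \<Rightarrow> (nat \<Rightarrow> complex) \<Rightarrow> complex" where
  "qform N A v = (\<Sum>a<N. \<Sum>b<N. cnj (v a) * A $$ (a, b) * v b)"

lemma psd_qform: "psd N A \<longleftrightarrow> A \<in> carrier_mat N N \<and> (\<forall>v. Im (qform N A v) = 0 \<and> 0 \<le> Re (qform N A v))"
  by (simp add: psd_def qform_def)

lemma sum_swap3: "(\<Sum>a\<in>A. \<Sum>b\<in>B. \<Sum>t\<in>T. f a b t) = (\<Sum>t\<in>T. \<Sum>a\<in>A. \<Sum>b\<in>B. f a b t)"
  by (simp add: sum.swap[of _ T])

lemma qform_gram:
  fixes T :: "'t set"
  assumes "\<And>a b. a < N \<Longrightarrow> b < N \<Longrightarrow> A $$ (a, b) = (\<Sum>t\<in>T. w t a * cnj (w t b))"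
  shows "qform N A v = complex_of_real (\<Sum>t\<in>T. (cmod (\<Sum>a<N. cnj (v a) * w t a))\<^sup>2)"
proof -
  have "qform N A v = (\<Sum>a<N. \<Sum>b<N. \<Sum>t\<in>T. (cnj (v a) * w t a) * cnj (cnj (v b) * w t b))"
    unfolding qform_def
    by (intro sum.cong refl) (simp add: assms sum_distrib_left sum_distrib_right mult_ac)
  also have "\<dots> = (\<Sum>t\<in>T. \<Sum>a<N. \<Sum>b<N. (cnj (v a) * w t a) * cnj (cnj (v b) * w t b))"
    by (rule sum_swap3)
  also have "\<dots> = (\<Sum>t\<in>T. (\<Sum>a<N. cnj (v a) * w t a) * cnj (\<Sum>a<N. cnj (v a) * w t a))"
    by (simp only: sum_product cnj_sum)
  finally show ?thesis by (simp only: complex_norm_square of_real_sum)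
qed

lemma psd_gramI:
  fixes T :: "'t set"
  assumes "A \<in> carrier_mat N N"
    "\<And>a b. a < N \<Longrightarrow> b < N \<Longrightarrow> A $$ (a, b) = (\<Sum>t\<in>T. w t a * cnj (w t b))"
  shows "psd N A"
proof -
  have "qform N A v = complex_of_real (\<Sum>t\<in>T. (cmod (\<Sum>a<N. cnj (v a) * w t a))\<^sup>2)" for v
    using assms(2) by (rule qform_gram)
  then show ?thesis
    unfolding psd_qform using assms(1) by (simp only: Im_complex_of_real Re_complex_of_real) (simp add: sum_nonneg)
qed

text \<open>Along one coordinate direction the form is a quadratic polynomial in \<open>s\<close>
  and its conjugate. Suitable values of \<open>s\<close> yield the diagonal entries, hermiticity and
  the completed square of the elimination step.\<close>

lemma qform_shift:
  assumes "k < N"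
  shows "qform N A (\<lambda>a. v a - (if a = k then s else 0)) =
    qform N A v - cnj s * (\<Sum>b<N. A $$ (k, b) * v b) - s * (\<Sum>a<N. cnj (v a) * A $$ (a, k))
      + cnj s * s * A $$ (k, k)"
proof -
  let ?e = "\<lambda>a. if a = k then s else 0 :: complex"
  have "qform N A (\<lambda>a. v a - ?e a) =
      (\<Sum>a<N. \<Sum>b<N. cnj (v a) * A $$ (a, b) * v b - cnj (?e a) * (A $$ (a, b) * v b)
        - cnj (v a) * A $$ (a, b) * ?e b + cnj (?e a) * (A $$ (a, b) * ?e b))"
    unfolding qform_def by (intro sum.cong refl) (simp add: algebra_simps)
  also have "\<dots> = qform N A v - (\<Sum>a<N. cnj (?e a) * (\<Sum>b<N. A $$ (a, b) * v b))
        - (\<Sum>a<N. \<Sum>b<N. cnj (v a) * A $$ (a, b) * ?e b)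
        + (\<Sum>a<N. cnj (?e a) * (\<Sum>b<N. A $$ (a, b) * ?e b))"
    by (simp add: qform_def sum.distrib sum_subtractf sum_distrib_left)
  also have "(\<Sum>a<N. cnj (?e a) * (\<Sum>b<N. A $$ (a, b) * v b)) = cnj s * (\<Sum>b<N. A $$ (k, b) * v b)"
    using assms by (simp add: if_distrib[of cnj] if_distrib[of "\<lambda>x. x * _"] cong: if_cong)
  also have "(\<Sum>a<N. \<Sum>b<N. cnj (v a) * A $$ (a, b) * ?e b) = s * (\<Sum>a<N. cnj (v a) * A $$ (a, k))"
    using assms by (simp add: if_distrib[of "\<lambda>x. _ * x"] sum_distrib_left mult_ac cong: if_cong)
  also have "(\<Sum>a<N. cnj (?e a) * (\<Sum>b<N. A $$ (a, b) * ?e b)) = cnj s * s * A $$ (k, k)"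
    using assms by (simp add: if_distrib[of cnj] if_distrib[of "\<lambda>x. x * _"] if_distrib[of "\<lambda>x. _ * x"] mult_ac cong: if_cong)
  finally show ?thesis .
qed

lemma qform_unit: "k < N \<Longrightarrow> qform N A (\<lambda>a. if a = k then s else 0) = cnj s * s * A $$ (k, k)"
  using qform_shift[of k N A "\<lambda>_. 0" "- s"] by (simp add: qform_def if_distrib[of uminus] cong: if_cong)

lemma psd_diag:
  assumes "psd N A" "k < N"
  shows "Im (A $$ (k, k)) = 0" "0 \<le> Re (A $$ (k, k))"
  using assms(1) qform_unit[OF assms(2), of A 1] unfolding psd_qform by (metis complex_cnj_one mult_1)+

text \<open>\<open>psd\<close> only demands real, nonnegative values of the form. At the vectors e_l
  - s e_k, \<open>s = 1\<close> compares the imaginary parts of the two entries and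
  \<open>s = \<i>\<close> their real parts.\<close>

lemma psd_hermitian:
  assumes A: "psd N A" and k: "k < N" and l: "l < N"
  shows "A $$ (l, k) = cnj (A $$ (k, l))"
proof (cases "k = l")
  case True
  then show ?thesis using psd_diag[OF A k] by (simp add: complex_eq_iff)
next
  case False
  have *: "Im (- cnj s * A $$ (k, l) - s * A $$ (l, k)) = 0" for s
  proof -
    let ?v = "\<lambda>a. if a = l then 1 else 0 :: complex"
    have 1: "(\<Sum>b<N. A $$ (k, b) * ?v b) = A $$ (k, l)"
      using l by (simp add: if_distrib[of "\<lambda>x. _ * x"] cong: if_cong)
    have 2: "(\<Sum>a<N. cnj (?v a) * A $$ (a, k)) = A $$ (l, k)"
      using l by (simp add: if_distrib[of cnj] if_distrib[of "\<lambda>x. x * _"] cong: if_cong)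
    have "Im (qform N A (\<lambda>a. ?v a - (if a = k then s else 0))) = 0"
      using A by (simp add: psd_qform)
    then show ?thesis
      unfolding qform_shift[OF k] 1 2 qform_unit[OF l]
      using psd_diag[OF A k] psd_diag[OF A l] by (simp add: algebra_simps)
  qed
  show ?thesis using *[of 1] *[of \<i>] by (simp add: complex_eq_iff)
qed

text \<open>Cholesky elimination: \<open>m\<close> is the size of the lower right block that may
  still be nonzero. Subtracting the dyad of the pivot column clears row and column \<open>k\<close>,
  and the rest stays positive because its form takes only values of the form of \<open>A\<close>, at
  vectors with the coordinate \<open>k\<close> adjusted.\<close>

lemma psd_gram_aux:
  assumes "psd N A" "\<forall>a<N. \<forall>b<N. a < N - m \<or> b < N - m \<longrightarrow> A $$ (a, b) = 0" "m \<le> N"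
  shows "\<exists>w. \<forall>a<N. \<forall>b<N. A $$ (a, b) = (\<Sum>t\<in>{N - m..<N}. w t a * cnj (w t b))"
  using assms
proof (induction m arbitrary: A)
  case 0
  then show ?case by auto
next
  case (Suc m)
  define k where "k = N - Suc m"
  have k: "k < N" "Suc k = N - m" using Suc.prems(3) by (auto simp: k_def)
  note A = Suc.prems(1)
  define r where "r = Re (A $$ (k, k))"
  have r: "A $$ (k, k) = complex_of_real r" "0 \<le> r"
    using psd_diag[OF A k(1)] by (auto simp: r_def complex_eq_iff)
  define u where "u v = (\<Sum>b<N. A $$ (k, b) * v b)" for v
  have cu: "(\<Sum>a<N. cnj (v a) * A $$ (a, k)) = cnj (u v)" for v
    unfolding u_def cnj_sum using psd_hermitian[OF A k(1)]
    by (intro sum.cong) (auto simp: mult.commute)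
  have shift: "qform N A (\<lambda>a. v a - (if a = k then s else 0)) =
      qform N A v - cnj s * u v - s * cnj (u v) + cnj s * s * r" for v s
    using qform_shift[OF k(1)] cu r by (simp add: u_def)
  have nonneg: "0 \<le> Re (qform N A v)" "Im (qform N A v) = 0" for v
    using A by (auto simp: psd_qform)
  \<comment> \<open>A vanishing pivot forces the whole row to vanish: otherwise the form would be
    affine and unbounded below along the coordinate \<open>k\<close>.\<close>
  have r0: "u v = 0" if "r = 0" for v
  proof (rule ccontr)
    assume nz: "u v \<noteq> 0"
    \<comment> \<open>This step length lowers the form by twice the value at \<open>v\<close> plus
      one, which is more than it can lose.\<close>
    define x where "x = (Re (qform N A v) + 1) / (cmod (u v))\<^sup>2"
    have "0 \<le> Re (qform N A (\<lambda>a. v a - (if a = k then x * u v else 0)))" by (rule nonneg)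
    also have "qform N A (\<lambda>a. v a - (if a = k then x * u v else 0)) =
        qform N A v - complex_of_real (2 * x * (cmod (u v))\<^sup>2)"
      unfolding shift that of_real_mult complex_norm_square by (simp add: algebra_simps)
    finally have "2 * (x * (cmod (u v))\<^sup>2) \<le> Re (qform N A v)" by simp
    moreover have "x * (cmod (u v))\<^sup>2 = Re (qform N A v) + 1" using nz by (simp add: x_def)
    ultimately show False using nonneg(1)[of v] by simp
  qed
  \<comment> \<open>For \<open>r = 0\<close> the division by zero makes \<open>wk\<close> vanish and
    \<open>B\<close> agrees with \<open>A\<close>; the row and column of the pivot are then zero by
    \<open>r0\<close>.\<close>
  define wk where "wk a = A $$ (a, k) / complex_of_real (sqrt r)" for a
  define B where "B = mat N N (\<lambda>(a, b). A $$ (a, b) - wk a * cnj (wk b))"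
  have qB: "qform N B v = qform N A v - u v * cnj (u v) / r" for v
  proof -
    have "qform N B v = qform N A v - (\<Sum>a<N. \<Sum>b<N. cnj (v a) * (wk a * cnj (wk b)) * v b)"
      unfolding qform_def B_def sum_subtractf[symmetric]
      by (intro sum.cong refl) (simp add: algebra_simps)
    also have "(\<Sum>a<N. \<Sum>b<N. cnj (v a) * (wk a * cnj (wk b)) * v b) =
        (\<Sum>a<N. cnj (v a) * A $$ (a, k) / sqrt r) * (\<Sum>b<N. A $$ (k, b) * v b / sqrt r)"
      unfolding sum_product
    proof (intro sum.cong refl)
      fix a b assume "a \<in> {..<N}" "b \<in> {..<N}"
      then show "cnj (v a) * (wk a * cnj (wk b)) * v b = cnj (v a) * A $$ (a, k) / sqrt r * (A $$ (k, b) * v b / sqrt r)"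
        using psd_hermitian[OF A k(1), of b] by (simp add: wk_def mult_ac)
    qed
    also have "\<dots> = cnj (u v) / sqrt r * (u v / sqrt r)"
      by (simp add: sum_divide_distrib[symmetric] cu, simp add: u_def)
    also have "\<dots> = u v * cnj (u v) / (complex_of_real (sqrt r) * complex_of_real (sqrt r))"
      by (simp add: mult_ac)
    also have "complex_of_real (sqrt r) * complex_of_real (sqrt r) = r"
      using r(2) by (simp flip: of_real_mult)
    finally show ?thesis .
  qed
  have psdB: "psd N B"
  proof -
    have "\<exists>v'. qform N B v = qform N A v'" for v
    proof (cases "r = 0")
      case True
      then show ?thesis using qB[of v] by auto
    next
      case False
      \<comment> \<open>Shifting by \<open>u v / r\<close> minimises the form in the coordinate
        \<open>k\<close>; the Schur complement takes this minimum as its value.\<close>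
      have "qform N A (\<lambda>a. v a - (if a = k then u v / r else 0)) = qform N B v"
        unfolding shift qB using False by (simp add: field_simps)
      then show ?thesis by metis
    qed
    then show ?thesis unfolding psd_qform
      by (metis (no_types, lifting) B_def mat_carrier nonneg)
  qed
  have Ak0: "A $$ (a, k) = 0" if "r = 0" "a < N" for a
  proof -
    have "u (\<lambda>b. if b = a then 1 else 0) = A $$ (k, a)"
      using that by (simp add: u_def if_distrib[of "\<lambda>x. _ * x"] cong: if_cong)
    then show ?thesis using r0[OF that(1)] psd_hermitian[OF A k(1) that(2)] by simp
  qed
  have Bz: "B $$ (a, b) = 0" if "a < N" "b < N" "a < N - m \<or> b < N - m" for a b
  proof -
    have Bab: "B $$ (a, b) = A $$ (a, b) - wk a * cnj (wk b)" using that by (simp add: B_def)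
    have z: "x < N \<Longrightarrow> y < N \<Longrightarrow> x < k \<or> y < k \<Longrightarrow> A $$ (x, y) = 0" for x y
      using Suc.prems(2) by (auto simp: k_def)
    have sq: "wk x * cnj (wk k) = A $$ (x, k)" if "x < N" for x
    proof (cases "r = 0")
      case False
      then show ?thesis using r by (simp add: wk_def field_simps flip: of_real_mult)
    qed (simp add: wk_def Ak0 that)
    have "wk k * cnj (wk x) = cnj (A $$ (x, k))" if "x < N" for x
      using arg_cong[OF sq[OF that], of cnj] by (simp add: mult.commute)
    then have sq': "wk k * cnj (wk x) = A $$ (k, x)" if "x < N" for x
      using psd_hermitian[OF A k(1) that] that by simp
    have "a < k \<or> b < k \<or> a = k \<or> b = k" using that k by linarith
    then consider "a < k \<or> b < k" | "a = k" | "b = k" by blast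
    then show ?thesis
      by cases (use Bab z that k sq sq' in \<open>auto simp: wk_def\<close>)
  qed
  obtain w where w: "\<forall>a<N. \<forall>b<N. B $$ (a, b) = (\<Sum>t\<in>{N - m..<N}. w t a * cnj (w t b))"
    using Suc.IH[OF psdB] Bz Suc.prems(3) by auto
  define w' where "w' t = (if t = k then wk else w t)" for t
  have "A $$ (a, b) = (\<Sum>t\<in>{N - Suc m..<N}. w' t a * cnj (w' t b))" if "a < N" "b < N" for a b
  proof -
    have "(\<Sum>t\<in>{N - Suc m..<N}. w' t a * cnj (w' t b)) =
        wk a * cnj (wk b) + (\<Sum>t\<in>{Suc k..<N}. w' t a * cnj (w' t b))"
      using k(1) unfolding k_def[symmetric] by (subst sum.atLeast_Suc_lessThan) (auto simp: w'_def)
    also have "(\<Sum>t\<in>{Suc k..<N}. w' t a * cnj (w' t b)) = B $$ (a, b)"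
      using w that k(2) by (auto simp: w'_def intro!: sum.cong)
    finally show ?thesis using that by (simp add: B_def)
  qed
  then show ?case by blast
qed

lemma psd_gramE:
  assumes "psd N A"
  obtains w :: "nat \<Rightarrow> nat \<Rightarrow> complex" where
    "\<And>a b. a < N \<Longrightarrow> b < N \<Longrightarrow> A $$ (a, b) = (\<Sum>t<N. w t a * cnj (w t b))"
  using psd_gram_aux[OF assms, of N] by (auto simp: atLeast0LessThan)

lemma psd_carrier: "psd N A \<Longrightarrow> A \<in> carrier_mat N N"
  by (simp add: psd_def)

lemma psd_zero: "psd N (0\<^sub>m N N)"
  by (rule psd_gramI[where T = "{} :: nat set"]) auto

lemma psd_one: "psd N (1\<^sub>m N)"
proof (rule psd_gramI[where T = "{..<N}" and w = "\<lambda>t a. if t = a then 1 else 0"])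
  fix a b assume "a < N" "b < N"
  then show "1\<^sub>m N $$ (a, b) = (\<Sum>t<N. (if t = a then 1 else 0) * cnj (if t = b then 1 else 0 :: complex))"
    by (simp add: if_distrib[of "\<lambda>x. x * _"] cong: if_cong)
qed auto

lemma psd_add:
  assumes "psd N A" "psd N B" shows "psd N (A + B)"
proof -
  have "qform N (A + B) v = qform N A v + qform N B v" for v
    unfolding qform_def sum.distrib[symmetric] using assms[THEN psd_carrier]
    by (intro sum.cong refl) (simp add: algebra_simps)
  then show ?thesis using assms by (auto simp: psd_qform)
qed

lemma psd_smult:
  assumes "psd N A" "0 \<le> c" shows "psd N (complex_of_real c \<cdot>\<^sub>m A)"
proof -
  have "qform N (complex_of_real c \<cdot>\<^sub>m A) v = complex_of_real c * qform N A v" for v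
    unfolding qform_def sum_distrib_left using psd_carrier[OF assms(1)]
    by (intro sum.cong refl) (simp add: algebra_simps)
  then show ?thesis using assms by (auto simp: psd_qform)
qed

lemma psd_conj:
  assumes A: "psd m A" and K: "K \<in> carrier_mat n m"
  shows "psd n (K * A * mat_adjoint K)"
proof -
  obtain w where w: "\<And>a b. a < m \<Longrightarrow> b < m \<Longrightarrow> A $$ (a, b) = (\<Sum>t<m. w t a * cnj (w t b))"
    using psd_gramE[OF A] by blast
  note Ac = psd_carrier[OF A]
  show ?thesis
  proof (rule psd_gramI[where T = "{..<m}" and w = "\<lambda>t i. \<Sum>k<m. K $$ (i, k) * w t k"])
    show "K * A * mat_adjoint K \<in> carrier_mat n n" using K Ac by auto
    fix i j assume ij: "i < n" "j < n"
    have "(K * A * mat_adjoint K) $$ (i, j) =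
        (\<Sum>k<m. \<Sum>l<m. \<Sum>t<m. (K $$ (i, k) * w t k) * cnj (K $$ (j, l) * w t l))"
      unfolding index_conj_sum[OF K Ac ij]
      by (intro sum.cong refl) (simp add: w sum_distrib_left sum_distrib_right mult_ac)
    also have "\<dots> = (\<Sum>t<m. \<Sum>k<m. \<Sum>l<m. (K $$ (i, k) * w t k) * cnj (K $$ (j, l) * w t l))"
      by (rule sum_swap3)
    also have "\<dots> = (\<Sum>t<m. (\<Sum>k<m. K $$ (i, k) * w t k) * cnj (\<Sum>k<m. K $$ (j, k) * w t k))"
      by (simp only: sum_product cnj_sum)
    finally show "(K * A * mat_adjoint K) $$ (i, j) =
        (\<Sum>t<m. (\<Sum>k<m. K $$ (i, k) * w t k) * cnj (\<Sum>k<m. K $$ (j, k) * w t k))" .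
  qed
qed

text \<open>Expanding \<open>A\<close> as a sum of dyads turns the trace into a sum of values of the
  quadratic form of \<open>B\<close>.\<close>

lemma ctrace_psd_mult:
  assumes A: "psd N A" and B: "psd N B"
  shows "Im (ctrace (A * B)) = 0" "0 \<le> Re (ctrace (A * B))"
proof -
  obtain w where w: "\<And>a b. a < N \<Longrightarrow> b < N \<Longrightarrow> A $$ (a, b) = (\<Sum>t<N. w t a * cnj (w t b))"
    using psd_gramE[OF A] by blast
  have "ctrace (A * B) = (\<Sum>i<N. \<Sum>j<N. \<Sum>t<N. cnj (w t j) * B $$ (j, i) * w t i)"
    unfolding ctrace_mult[OF psd_carrier[OF A] psd_carrier[OF B]]
    by (intro sum.cong refl) (simp add: w sum_distrib_left sum_distrib_right mult_ac)
  also have "\<dots> = (\<Sum>t<N. \<Sum>i<N. \<Sum>j<N. cnj (w t j) * B $$ (j, i) * w t i)"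
    by (rule sum_swap3)
  also have "\<dots> = (\<Sum>t<N. qform N B (w t))"
    unfolding qform_def by (rule sum.cong[OF refl]) (rule sum.swap)
  finally have "ctrace (A * B) = (\<Sum>t<N. qform N B (w t))" .
  then show "Im (ctrace (A * B)) = 0" "0 \<le> Re (ctrace (A * B))"
    using B by (auto simp: psd_qform intro!: sum_nonneg)
qed

lemma ctrace_psd:
  assumes "psd N A" shows "Im (ctrace A) = 0" "0 \<le> Re (ctrace A)"
  using ctrace_psd_mult[OF assms psd_one] psd_carrier[OF assms] by auto

text \<open>Cauchy-Schwarz for the Gram vectors, through the inequality of geometric and arithmetic
  mean, bounds an entry by the mean of two diagonal entries. This gives the boundedness of states
  for the compactness argument and the vanishing of positive matrices of trace zero.\<close>

lemma psd_entry_bound: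
  assumes A: "psd N A" and ab: "a < N" "b < N"
  shows "cmod (A $$ (a, b)) \<le> Re (ctrace A)"
proof -
  obtain w where w: "\<And>a b. a < N \<Longrightarrow> b < N \<Longrightarrow> A $$ (a, b) = (\<Sum>t<N. w t a * cnj (w t b))"
    using psd_gramE[OF A] by blast
  have diag: "Re (A $$ (c, c)) = (\<Sum>t<N. (cmod (w t c))\<^sup>2)" if "c < N" for c
    unfolding w[OF that that] Re_sum cmod_power2 by (intro sum.cong) (simp_all add: power2_eq_square)
  have le: "Re (A $$ (c, c)) \<le> Re (ctrace A)" if "c < N" for c
  proof -
    have "Re (A $$ (c, c)) \<le> (\<Sum>c<N. Re (A $$ (c, c)))"
      using that psd_diag[OF A] by (intro member_le_sum) auto
    then show ?thesis using psd_carrier[OF A] by (auto simp: ctrace_def)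
  qed
  have "cmod (A $$ (a, b)) \<le> (\<Sum>t<N. cmod (w t a) * cmod (w t b))"
    unfolding w[OF ab] by (rule order_trans[OF norm_sum]) (simp add: norm_mult)
  also have "\<dots> \<le> (\<Sum>t<N. ((cmod (w t a))\<^sup>2 + (cmod (w t b))\<^sup>2) / 2)"
  proof (rule sum_mono)
    fix t
    show "cmod (w t a) * cmod (w t b) \<le> ((cmod (w t a))\<^sup>2 + (cmod (w t b))\<^sup>2) / 2"
      using sum_squares_bound[of "cmod (w t a)" "cmod (w t b)"] by simp
  qed
  also have "\<dots> = (Re (A $$ (a, a)) + Re (A $$ (b, b))) / 2"
    by (simp add: diag ab sum.distrib sum_divide_distrib[symmetric])
  also have "\<dots> \<le> Re (ctrace A)" using le[OF ab(1)] le[OF ab(2)] by simp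
  finally show ?thesis .
qed

lemma psd_trace_zero:
  assumes "psd N A" "Re (ctrace A) = 0" shows "A = 0\<^sub>m N N"
  using psd_entry_bound[OF assms(1)] assms(2) psd_carrier[OF assms(1)]
  by (intro eq_matI) auto

text \<open>Products of Gram vectors of the factors, one product for each choice function
  \<open>f\<close>, are Gram vectors of the tensor product.\<close>

lemma psd_trect:
  assumes v: "valid_dims ds" and F: "\<forall>j<length ds. psd (ds ! j) (F j)"
  shows "psd (dimp ds) (trect ds ds F)"
proof -
  have "\<forall>j. \<exists>w. j < length ds \<longrightarrow> (\<forall>a<ds ! j. \<forall>b<ds ! j. F j $$ (a, b) = (\<Sum>t<ds ! j. w t a * cnj (w t b)))"
    using F psd_gramE by metis
  then obtain w where w: "\<And>j a b. j < length ds \<Longrightarrow> a < ds ! j \<Longrightarrow> b < ds ! j \<Longrightarrow>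
      F j $$ (a, b) = (\<Sum>t<ds ! j. w j t a * cnj (w j t b))" by metis
  show ?thesis
  proof (rule psd_gramI[where T = "PiE {..<length ds} (\<lambda>j. {..<ds ! j})"
        and w = "\<lambda>f a. \<Prod>j<length ds. w j (f j) (digit ds j a)"])
    fix a b assume ab: "a < dimp ds" "b < dimp ds"
    have "trect ds ds F $$ (a, b) = (\<Prod>j<length ds. \<Sum>t<ds ! j. w j t (digit ds j a) * cnj (w j t (digit ds j b)))"
      using ab digit_less[OF v] by (simp add: index_trect w)
    also have "\<dots> = (\<Sum>f\<in>PiE {..<length ds} (\<lambda>j. {..<ds ! j}).
        \<Prod>j<length ds. w j (f j) (digit ds j a) * cnj (w j (f j) (digit ds j b)))"
      by (intro prod_sum_PiE) auto
    finally show "trect ds ds F $$ (a, b) = (\<Sum>f\<in>PiE {..<length ds} (\<lambda>j. {..<ds ! j}).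
        (\<Prod>j<length ds. w j (f j) (digit ds j a)) * cnj (\<Prod>j<length ds. w j (f j) (digit ds j b)))"
      by (simp add: prod.distrib)
  qed simp
qed

subsection \<open>Cones of matrices that are stable under local operations\<close>

text \<open>The instances are the positive matrices, where the post-measurement states of \<rho>
  live, and the separable and PPT cones, where those of a free state live. The predicate depends on
  \<open>ds\<close> because product operators change the local dimensions.\<close>

locale local_cone =
  fixes C :: "nat list \<Rightarrow> complex mat \<Rightarrow> bool"
  assumes cone_carrier: "C ds A \<Longrightarrow> A \<in> carrier_mat (dimp ds) (dimp ds)"
    and cone_zero: "valid_dims ds \<Longrightarrow> C ds (0\<^sub>m (dimp ds) (dimp ds))"
    and cone_add: "C ds A \<Longrightarrow> C ds B \<Longrightarrow> C ds (A + B)"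
    and cone_conj: "local_ops ds ds' K \<Longrightarrow> C ds A \<Longrightarrow>
      C ds' (trect ds ds' K * A * mat_adjoint (trect ds ds' K))"
begin

lemma cone_sum:
  assumes "valid_dims ds" "finite I" "\<And>i. i \<in> I \<Longrightarrow> C ds (A i)"
  shows "C ds (mat (dimp ds) (dimp ds) (\<lambda>ab. \<Sum>i\<in>I. A i $$ ab))"
  using assms(2,3)
proof (induction I rule: finite_induct)
  case empty
  have "mat (dimp ds) (dimp ds) (\<lambda>ab. \<Sum>i\<in>{}. A i $$ ab) = 0\<^sub>m (dimp ds) (dimp ds)"
    by (auto intro!: eq_matI)
  then show ?case using cone_zero[OF assms(1)] by simp
next
  case (insert i I)
  have "mat (dimp ds) (dimp ds) (\<lambda>ab. \<Sum>i\<in>insert i I. A i $$ ab) =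
      A i + mat (dimp ds) (dimp ds) (\<lambda>ab. \<Sum>i\<in>I. A i $$ ab)"
    using insert cone_carrier[of ds "A i"] by (intro eq_matI) auto
  then show ?case using insert cone_add by simp
qed

lemma cone_sum_list:
  assumes "valid_dims ds" "\<And>A. A \<in> set As \<Longrightarrow> C ds A"
  shows "C ds (mat (dimp ds) (dimp ds) (\<lambda>ab. \<Sum>A\<leftarrow>As. A $$ ab))"
proof -
  have "mat (dimp ds) (dimp ds) (\<lambda>ab. \<Sum>A\<leftarrow>As. A $$ ab) =
      mat (dimp ds) (dimp ds) (\<lambda>ab. \<Sum>i<length As. (As ! i) $$ ab)"
    by (simp add: sum_list_sum_nth atLeast0LessThan)
  also have "C ds \<dots>" using assms by (intro cone_sum) auto
  finally show ?thesis .
qed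

end

interpretation psd_cone: local_cone "\<lambda>ds. psd (dimp ds)"
  by unfold_locales (auto simp: psd_carrier psd_zero psd_add intro!: psd_conj)

text \<open>With weights in \<open>{1}\<close> this is the shape of the elements of a separable POVM, with
  nonnegative weights it is the cone generated by the separable states.  The two differ only
  for the system without parties.\<close>

definition gsep :: "real set \<Rightarrow> nat list \<Rightarrow> complex mat \<Rightarrow> bool" where
  "gsep W ds A \<longleftrightarrow> valid_dims ds \<and> (\<exists>(m::nat) c F. (\<forall>k<m. c k \<in> W \<and> (\<forall>j<length ds. psd (ds ! j) (F k j))) \<and>
     A = mat (dimp ds) (dimp ds) (\<lambda>ab. \<Sum>k<m. complex_of_real (c k) * trect ds ds (F k) $$ ab))"

lemma gsep_zero: "valid_dims ds \<Longrightarrow> gsep W ds (0\<^sub>m (dimp ds) (dimp ds))"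
  unfolding gsep_def by (intro conjI exI[of _ 0]) (auto intro!: eq_matI)

lemma gsep_carrier: "gsep W ds A \<Longrightarrow> A \<in> carrier_mat (dimp ds) (dimp ds)"
  by (auto simp: gsep_def)

lemma gsep_add_term:
  assumes "gsep W ds A" "c \<in> W" "\<forall>j<length ds. psd (ds ! j) (F j)"
  shows "gsep W ds (complex_of_real c \<cdot>\<^sub>m trect ds ds F + A)"
proof -
  obtain m :: nat and c' F' where *: "\<forall>k<m. c' k \<in> W \<and> (\<forall>j<length ds. psd (ds ! j) (F' k j))"
    "A = mat (dimp ds) (dimp ds) (\<lambda>ab. \<Sum>k<m. complex_of_real (c' k) * trect ds ds (F' k) $$ ab)"
    using assms(1) unfolding gsep_def by blast
  have "complex_of_real c \<cdot>\<^sub>m trect ds ds F + A = mat (dimp ds) (dimp ds) (\<lambda>ab.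
      \<Sum>k<Suc m. complex_of_real ((c'(m := c)) k) * trect ds ds ((F'(m := F)) k) $$ ab)"
    unfolding *(2) by (intro eq_matI) (auto simp: carrier_matD[OF trect_carrier])
  then show ?thesis using assms *(1) unfolding gsep_def
    by (intro conjI exI[of _ "Suc m"] exI[of _ "c'(m := c)"] exI[of _ "F'(m := F)"])
      (auto simp: less_Suc_eq)
qed

text \<open>Splitting off one product term at a time replaces manipulations of the indexed sum in
  \<open>gsep_def\<close>; linear statements on separable matrices then reduce to product
  terms.\<close>

lemma gsep_induct [consumes 1, case_names zero add]:
  assumes "gsep W ds A"
    and zero: "Q (0\<^sub>m (dimp ds) (dimp ds))"
    and add: "\<And>c F B. c \<in> W \<Longrightarrow> \<forall>j<length ds. psd (ds ! j) (F j) \<Longrightarrow> gsep W ds B \<Longrightarrow> Q B \<Longrightarrow>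
      Q (complex_of_real c \<cdot>\<^sub>m trect ds ds F + B)"
  shows "Q A"
proof -
  obtain m :: nat and c F where *: "\<forall>k<m. c k \<in> W \<and> (\<forall>j<length ds. psd (ds ! j) (F k j))"
    "A = mat (dimp ds) (dimp ds) (\<lambda>ab. \<Sum>k<m. complex_of_real (c k) * trect ds ds (F k) $$ ab)"
    and v: "valid_dims ds"
    using assms(1) unfolding gsep_def by blast
  define B where "B n = mat (dimp ds) (dimp ds) (\<lambda>ab. \<Sum>k<n. complex_of_real (c k) * trect ds ds (F k) $$ ab)" for n
  have "n \<le> m \<Longrightarrow> Q (B n)" for n
  proof (induction n)
    case 0
    have "B 0 = 0\<^sub>m (dimp ds) (dimp ds)" by (auto simp: B_def intro!: eq_matI)
    then show ?case using zero by simp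
  next
    case (Suc n)
    have "B (Suc n) = complex_of_real (c n) \<cdot>\<^sub>m trect ds ds (F n) + B n"
      unfolding B_def by (intro eq_matI) (auto simp: carrier_matD[OF trect_carrier])
    moreover have "gsep W ds (B n)" using * v Suc.prems unfolding gsep_def B_def
      by (intro conjI exI[of _ n] exI[of _ c] exI[of _ F]) auto
    ultimately show ?case using Suc * add by auto
  qed
  then show ?thesis using * by (auto simp: B_def)
qed

lemma gsep_valid: "gsep W ds A \<Longrightarrow> valid_dims ds"
  by (simp add: gsep_def)

lemma gsep_add:
  assumes "gsep W ds A" "gsep W ds B"
  shows "gsep W ds (A + B)"
  using assms(1)
proof (induction rule: gsep_induct)
  case zero
  then show ?case using assms(2) gsep_carrier[OF assms(2)] by simp
next
  case (add c F A)
  have "complex_of_real c \<cdot>\<^sub>m trect ds ds F + A + B = complex_of_real c \<cdot>\<^sub>m trect ds ds F + (A + B)"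
    using gsep_carrier[OF assms(2)] gsep_carrier[OF add(3)] by (intro assoc_add_mat) auto
  then show ?case using gsep_add_term[OF add(4,1,2)] by simp
qed

lemma gsep_trect:
  assumes "valid_dims ds" "\<forall>j<length ds. psd (ds ! j) (F j)" "1 \<in> W"
  shows "gsep W ds (trect ds ds F)"
proof -
  have "complex_of_real 1 \<cdot>\<^sub>m trect ds ds F + 0\<^sub>m (dimp ds) (dimp ds) = trect ds ds F"
    by (intro eq_matI) (auto simp: trect_def)
  then show ?thesis using gsep_add_term[OF gsep_zero[OF assms(1)] assms(3,2)] by simp
qed

lemma conj_add_mat:
  fixes E :: "complex mat"
  assumes "E \<in> carrier_mat n m" "A \<in> carrier_mat m m" "B \<in> carrier_mat m m"
  shows "E * (A + B) * mat_adjoint E = E * A * mat_adjoint E + E * B * mat_adjoint E"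
  using assms by (simp add: mult_add_distrib_mat[of _ n m _ m] add_mult_distrib_mat[of _ n m _ _ n])

lemma conj_smult_mat:
  fixes E :: "complex mat"
  assumes "E \<in> carrier_mat n m" "A \<in> carrier_mat m m"
  shows "E * (c \<cdot>\<^sub>m A) * mat_adjoint E = c \<cdot>\<^sub>m (E * A * mat_adjoint E)"
  using assms by (simp add: mult_smult_distrib[of _ n m _ m] mult_smult_assoc_mat[of _ n m _ n])

lemma gsep_conj:
  assumes K: "local_ops ds ds' K" and A: "gsep W ds A"
  shows "gsep W ds' (trect ds ds' K * A * mat_adjoint (trect ds ds' K))"
  using A
proof (induction rule: gsep_induct)
  case zero
  have "trect ds ds' K * 0\<^sub>m (dimp ds) (dimp ds) * mat_adjoint (trect ds ds' K) = 0\<^sub>m (dimp ds') (dimp ds')"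
    by (simp add: right_mult_zero_mat[OF trect_carrier] left_mult_zero_mat[OF carrier_mat_adjoint[OF trect_carrier]])
  then show ?case using K by (simp add: gsep_zero local_ops_def)
next
  case (add c F B)
  let ?E = "trect ds ds' K"
  have "?E * (complex_of_real c \<cdot>\<^sub>m trect ds ds F + B) * mat_adjoint ?E =
      complex_of_real c \<cdot>\<^sub>m (?E * trect ds ds F * mat_adjoint ?E) + ?E * B * mat_adjoint ?E"
    using gsep_carrier[OF add(3)]
    by (simp add: conj_add_mat[OF trect_carrier] conj_smult_mat[OF trect_carrier trect_carrier])
  also have "?E * trect ds ds F * mat_adjoint ?E = trect ds' ds' (\<lambda>j. K j * F j * mat_adjoint (K j))"
    using add(2) by (intro trect_conj[OF K]) (auto simp: psd_carrier)
  finally have eq: "?E * (complex_of_real c \<cdot>\<^sub>m trect ds ds F + B) * mat_adjoint ?E =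
      complex_of_real c \<cdot>\<^sub>m trect ds' ds' (\<lambda>j. K j * F j * mat_adjoint (K j)) + ?E * B * mat_adjoint ?E" .
  have "\<forall>j<length ds'. psd (ds' ! j) (K j * F j * mat_adjoint (K j))"
    using K add(2) by (auto simp: local_ops_def intro: psd_conj)
  then show ?case unfolding eq by (rule gsep_add_term[OF add(4,1)])
qed

interpretation gsep_cone: local_cone "gsep W" for W
  by unfold_locales (auto simp: gsep_carrier gsep_zero gsep_add gsep_conj)

lemma gsep_psd:
  assumes "W \<subseteq> {0..}" "gsep W ds A"
  shows "psd (dimp ds) A"
  using assms(2)
proof (induction rule: gsep_induct)
  case (add c F B)
  then show ?case using assms(1) psd_trect[OF gsep_valid[OF assms(2)]]
    by (intro psd_add psd_smult) auto
qed (rule psd_zero)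

lemma gsep_smult:
  assumes "\<And>x. x \<in> W \<Longrightarrow> r * x \<in> W" "gsep W ds A"
  shows "gsep W ds (complex_of_real r \<cdot>\<^sub>m A)"
  using assms(2)
proof (induction rule: gsep_induct)
  case zero
  then show ?case using gsep_zero[OF gsep_valid[OF assms(2)], of W] by (simp add: smult_zero_mat)
next
  case (add c F B)
  have "complex_of_real r \<cdot>\<^sub>m (complex_of_real c \<cdot>\<^sub>m trect ds ds F + B) =
      complex_of_real (r * c) \<cdot>\<^sub>m trect ds ds F + complex_of_real r \<cdot>\<^sub>m B"
    using gsep_carrier[OF add(3)] by (intro eq_matI) (auto simp: algebra_simps carrier_matD[OF trect_carrier])
  then show ?case using gsep_add_term[OF add(4) assms(1)[OF add(1)] add(2)] by simp
qed

text \<open>Rank-one form of a separable effect: an index \<open>t\<close> consists of a product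
  term and a choice of one Gram vector for every party, so each vector in the sum is itself a
  product vector.\<close>

lemma gsep_gramE:
  assumes A: "gsep {1} ds A"
  obtains T :: "(nat \<times> (nat \<Rightarrow> nat)) set" and w :: "nat \<times> (nat \<Rightarrow> nat) \<Rightarrow> nat \<Rightarrow> nat \<Rightarrow> complex"
  where "finite T"
    "\<And>a b. a < dimp ds \<Longrightarrow> b < dimp ds \<Longrightarrow> A $$ (a, b) =
      (\<Sum>t\<in>T. (\<Prod>j<length ds. w t j (digit ds j a)) * cnj (\<Prod>j<length ds. w t j (digit ds j b)))"
proof -
  obtain m :: nat and c F where *: "\<forall>k<m. c k \<in> {1::real} \<and> (\<forall>j<length ds. psd (ds ! j) (F k j))"
    "A = mat (dimp ds) (dimp ds) (\<lambda>ab. \<Sum>k<m. complex_of_real (c k) * trect ds ds (F k) $$ ab)"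
    and v: "valid_dims ds"
    using A unfolding gsep_def by blast
  have "\<forall>k j. \<exists>w. k < m \<longrightarrow> j < length ds \<longrightarrow> (\<forall>a<ds ! j. \<forall>b<ds ! j. F k j $$ (a, b) = (\<Sum>t<ds ! j. w t a * cnj (w t b)))"
    using * psd_gramE by metis
  then obtain w where w: "\<And>k j a b. k < m \<Longrightarrow> j < length ds \<Longrightarrow> a < ds ! j \<Longrightarrow> b < ds ! j \<Longrightarrow>
      F k j $$ (a, b) = (\<Sum>t<ds ! j. w k j t a * cnj (w k j t b))" by metis
  define P where "P = PiE {..<length ds} (\<lambda>j. {..<ds ! j})"
  have finP: "finite P" by (auto simp: P_def intro!: finite_PiE)
  show thesis
  proof (rule that[of "{..<m} \<times> P" "\<lambda>t j x. w (fst t) j (snd t j) x"])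
    show "finite ({..<m} \<times> P)" using finP by simp
    fix a b assume ab: "a < dimp ds" "b < dimp ds"
    let ?g = "\<lambda>k f. (\<Prod>j<length ds. w k j (f j) (digit ds j a)) * cnj (\<Prod>j<length ds. w k j (f j) (digit ds j b))"
    have tr: "trect ds ds (F k) $$ (a, b) = (\<Sum>f\<in>P. ?g k f)" if "k < m" for k
    proof -
      have "trect ds ds (F k) $$ (a, b) = (\<Prod>j<length ds. \<Sum>t<ds ! j. w k j t (digit ds j a) * cnj (w k j t (digit ds j b)))"
        using ab digit_less[OF v] that by (simp add: index_trect w)
      also have "\<dots> = (\<Sum>f\<in>P. \<Prod>j<length ds. w k j (f j) (digit ds j a) * cnj (w k j (f j) (digit ds j b)))"
        unfolding P_def by (intro prod_sum_PiE) auto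
      finally show ?thesis by (simp add: prod.distrib)
    qed
    have "A $$ (a, b) = (\<Sum>k<m. \<Sum>f\<in>P. ?g k f)"
      using ab *(1) by (simp add: *(2) tr)
    then show "A $$ (a, b) = (\<Sum>t\<in>{..<m} \<times> P.
        (\<Prod>j<length ds. w (fst t) j (snd t j) (digit ds j a)) *
        cnj (\<Prod>j<length ds. w (fst t) j (snd t j) (digit ds j b)))"
      by (simp add: sum.cartesian_product case_prod_unfold)
  qed
qed

subsection \<open>Partial transposes\<close>

lemma mixidx_less: "valid_dims ds \<Longrightarrow> mixidx ds S a b < dimp ds"
  unfolding mixidx_def by (intro compose_less) (auto simp: digit_less)

lemma digit_mixidx:
  "valid_dims ds \<Longrightarrow> j < length ds \<Longrightarrow>
    digit ds j (mixidx ds S a b) = (if j \<in> S then digit ds j b else digit ds j a)"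
  unfolding mixidx_def by (subst digit_compose) (auto simp: digit_less)

text \<open>Exchanging the digits in \<open>S\<close> between two indices is an involution on pairs
  of indices, which makes partial transposition a reindexing.\<close>

lemma mixidx_mixidx:
  assumes "valid_dims ds" "a < dimp ds"
  shows "mixidx ds S (mixidx ds S a b) (mixidx ds S b a) = a"
  by (rule digits_eqI[of _ ds]) (use assms in \<open>auto simp: mixidx_less digit_mixidx\<close>)

text \<open>The PPT condition without normalisation; the case \<open>S = {}\<close> contains
  positivity of \<open>A\<close> itself.\<close>

definition pptcone :: "nat list \<Rightarrow> complex mat \<Rightarrow> bool" where
  "pptcone ds A \<longleftrightarrow> A \<in> carrier_mat (dimp ds) (dimp ds) \<and> (\<forall>S\<subseteq>{..<length ds}. psd (dimp ds) (ptrans ds S A))"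

lemma bij_betw_mixidx_pair:
  assumes v: "valid_dims ds"
  shows "bij_betw (\<lambda>(k, l). (mixidx ds S k l, mixidx ds S l k))
    ({..<dimp ds} \<times> {..<dimp ds}) ({..<dimp ds} \<times> {..<dimp ds})"
  by (rule bij_betwI[where g = "\<lambda>(k, l). (mixidx ds S k l, mixidx ds S l k)"])
    (use mixidx_less[OF v] mixidx_mixidx[OF v] in \<open>auto\<close>)

text \<open>A partial transpose exchanges the row and column digits of the parties in
  \<open>S\<close>. In a conjugation by a product operator this swaps the factor of such a party
  with its conjugated partner, so the result is again a conjugation by a product operator, with the
  factors in \<open>S\<close> complex conjugated.\<close>

lemma ptrans_conj:
  assumes K: "local_ops ds ds' K" and A: "A \<in> carrier_mat (dimp ds) (dimp ds)"
  defines "K' S \<equiv> \<lambda>j. if j \<in> S then map_mat cnj (K j) else K j"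
  shows "ptrans ds' S (trect ds ds' K * A * mat_adjoint (trect ds ds' K)) =
    trect ds ds' (K' S) * ptrans ds S A * mat_adjoint (trect ds ds' (K' S))" (is "?l = ?r")
proof (rule eq_matI)
  have v: "valid_dims ds" "valid_dims ds'" and len: "length ds' = length ds"
    and Kc: "\<And>j. j < length ds \<Longrightarrow> K j \<in> carrier_mat (ds' ! j) (ds ! j)"
    using K by (auto simp: local_ops_def)
  let ?E = "trect ds ds' K" and ?E' = "trect ds ds' (K' S)"
  let ?m = "mixidx ds S" and ?m' = "mixidx ds' S"
  fix a b assume "a < dim_row ?r" "b < dim_col ?r"
  then have ab: "a < dimp ds'" "b < dimp ds'" by (auto simp: trect_def)
  have key: "?E $$ (?m' a b, ?m k l) * cnj (?E $$ (?m' b a, ?m l k)) = ?E' $$ (a, k) * cnj (?E' $$ (b, l))"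
    if "k < dimp ds" "l < dimp ds" for k l
  proof -
    have "K j $$ (digit ds' j (?m' a b), digit ds j (?m k l)) * cnj (K j $$ (digit ds' j (?m' b a), digit ds j (?m l k))) =
        K' S j $$ (digit ds' j a, digit ds j k) * cnj (K' S j $$ (digit ds' j b, digit ds j l))"
      if j: "j < length ds" for j
    proof -
      have "digit ds' j a < dim_row (K j)" "digit ds' j b < dim_row (K j)"
        "digit ds j k < dim_col (K j)" "digit ds j l < dim_col (K j)"
        using Kc[OF j] digit_less[OF v(1), of j] digit_less[OF v(2), of j] len j by auto
      then show ?thesis using j len by (simp add: digit_mixidx[OF v(1)] digit_mixidx[OF v(2)] K'_def)
    qed
    then show ?thesis
      unfolding index_trect[OF ab(1) that(1)] index_trect[OF ab(2) that(2)]
        index_trect[OF mixidx_less[OF v(2)] mixidx_less[OF v(1)]] cnj_prod prod.distrib[symmetric]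
      by (intro prod.cong) auto
  qed
  have "?l $$ (a, b) = (?E * A * mat_adjoint ?E) $$ (?m' a b, ?m' b a)"
    using ab by (simp add: ptrans_def)
  also have "\<dots> = (\<Sum>k<dimp ds. \<Sum>l<dimp ds. ?E $$ (?m' a b, k) * A $$ (k, l) * cnj (?E $$ (?m' b a, l)))"
    by (intro index_conj_sum[OF trect_carrier A] mixidx_less v)
  also have "\<dots> = (\<Sum>(k, l)\<in>{..<dimp ds} \<times> {..<dimp ds}. ?E $$ (?m' a b, k) * A $$ (k, l) * cnj (?E $$ (?m' b a, l)))"
    by (simp add: sum.cartesian_product)
  \<comment> \<open>The sum runs over all pairs of indices, and the exchange of digits permutes
    these pairs.\<close>
  also have "\<dots> = (\<Sum>(k, l)\<in>{..<dimp ds} \<times> {..<dimp ds}.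
      ?E $$ (?m' a b, ?m k l) * A $$ (?m k l, ?m l k) * cnj (?E $$ (?m' b a, ?m l k)))"
    by (subst sum.reindex_bij_betw[OF bij_betw_mixidx_pair[OF v(1), of S], symmetric])
      (simp add: case_prod_unfold)
  also have "\<dots> = (\<Sum>(k, l)\<in>{..<dimp ds} \<times> {..<dimp ds}.
      ?E' $$ (a, k) * ptrans ds S A $$ (k, l) * cnj (?E' $$ (b, l)))"
  proof (rule sum.cong[OF refl], clarify)
    fix k l assume kl: "k < dimp ds" "l < dimp ds"
    have "?E $$ (?m' a b, ?m k l) * A $$ (?m k l, ?m l k) * cnj (?E $$ (?m' b a, ?m l k)) =
        (?E $$ (?m' a b, ?m k l) * cnj (?E $$ (?m' b a, ?m l k))) * A $$ (?m k l, ?m l k)"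
      by (simp add: mult_ac)
    also have "\<dots> = (?E' $$ (a, k) * cnj (?E' $$ (b, l))) * A $$ (?m k l, ?m l k)"
      by (simp only: key[OF kl])
    also have "\<dots> = ?E' $$ (a, k) * ptrans ds S A $$ (k, l) * cnj (?E' $$ (b, l))"
      using kl by (simp add: ptrans_def mult_ac)
    finally show "?E $$ (?m' a b, ?m k l) * A $$ (?m k l, ?m l k) * cnj (?E $$ (?m' b a, ?m l k)) =
        ?E' $$ (a, k) * ptrans ds S A $$ (k, l) * cnj (?E' $$ (b, l))" .
  qed
  also have "\<dots> = ?r $$ (a, b)"
    unfolding sum.cartesian_product[symmetric]
    by (rule index_conj_sum[OF trect_carrier _ ab, symmetric]) (simp add: ptrans_def)
  finally show "?l $$ (a, b) = ?r $$ (a, b)" .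
qed (auto simp: ptrans_def trect_def)

interpretation pptcone: local_cone pptcone
proof
  fix ds :: "nat list" and A B :: "complex mat"
  show "pptcone ds A \<Longrightarrow> A \<in> carrier_mat (dimp ds) (dimp ds)" by (simp add: pptcone_def)
  show "pptcone ds (0\<^sub>m (dimp ds) (dimp ds))" if "valid_dims ds"
  proof -
    have "ptrans ds S (0\<^sub>m (dimp ds) (dimp ds)) = 0\<^sub>m (dimp ds) (dimp ds)" for S
      using that by (auto simp: ptrans_def mixidx_less intro!: eq_matI)
    then show ?thesis by (simp add: pptcone_def psd_zero)
  qed
  show "pptcone ds (A + B)" if "pptcone ds A" "pptcone ds B"
  proof -
    have c: "A \<in> carrier_mat (dimp ds) (dimp ds)" "B \<in> carrier_mat (dimp ds) (dimp ds)"
      using that by (auto simp: pptcone_def)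
    \<comment> \<open>Closure under addition is stated for all \<open>ds\<close>; if a local
      dimension is zero, \<open>dimp ds\<close> is zero and there is no index
      \<open>a\<close>.\<close>
    have "mixidx ds S a b < dimp ds" if "a < dimp ds" for a b S
    proof (cases "valid_dims ds")
      case False
      then have "dimp ds = 0" by (auto simp: valid_dims_def dimp_def prod_list_zero_iff in_set_conv_nth)
      then show ?thesis using that by simp
    qed (simp add: mixidx_less)
    then have "ptrans ds S (A + B) = ptrans ds S A + ptrans ds S B" for S
      using c by (intro eq_matI) (auto simp: ptrans_def)
    then show ?thesis using that by (auto simp: pptcone_def psd_add)
  qed
  fix ds' K
  show "pptcone ds' (trect ds ds' K * A * mat_adjoint (trect ds ds' K))"
    if K: "local_ops ds ds' K" and A: "pptcone ds A"
  proof -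
    have "psd (dimp ds') (ptrans ds' S (trect ds ds' K * A * mat_adjoint (trect ds ds' K)))"
      if "S \<subseteq> {..<length ds'}" for S
      using A that K by (subst ptrans_conj) (auto simp: pptcone_def local_ops_def intro!: psd_conj)
    moreover have "trect ds ds' K * A * mat_adjoint (trect ds ds' K) \<in> carrier_mat (dimp ds') (dimp ds')"
      by (intro mult_carrier_mat[of _ _ "dimp ds"]) (use A in \<open>auto simp: pptcone_def\<close>)
    ultimately show ?thesis by (simp add: pptcone_def)
  qed
qed

lemma pptcone_smult:
  assumes v: "valid_dims ds" and A: "pptcone ds A" and "0 \<le> c"
  shows "pptcone ds (complex_of_real c \<cdot>\<^sub>m A)"
proof -
  have "ptrans ds S (complex_of_real c \<cdot>\<^sub>m A) = complex_of_real c \<cdot>\<^sub>m ptrans ds S A" for S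
    using A by (intro eq_matI) (auto simp: ptrans_def pptcone_def mixidx_less[OF v])
  then show ?thesis using assms by (auto simp: pptcone_def psd_smult)
qed

lemma ppt_state_iff: "ppt_state ds \<rho> \<longleftrightarrow> is_state (dimp ds) \<rho> \<and> pptcone ds \<rho>"
  by (auto simp: ppt_state_def pptcone_def is_state_def psd_carrier)

subsection \<open>LOCC instruments and their POVMs\<close>

definition lsum :: "nat \<Rightarrow> complex mat list \<Rightarrow> complex mat" where
  "lsum N As = mat N N (\<lambda>ab. \<Sum>A\<leftarrow>As. A $$ ab)"

text \<open>The action on an effect \<open>M\<close> of the completely positive map with Kraus operators
  \<open>Ks\<close>, in the Heisenberg picture.\<close>

definition pull :: "nat \<Rightarrow> complex mat list \<Rightarrow> complex mat \<Rightarrow> complex mat" where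
  "pull N Ks M = lsum N (map (\<lambda>K. mat_adjoint K * M * K) Ks)"

definition locop :: "nat list \<Rightarrow> nat list \<Rightarrow> complex mat \<Rightarrow> bool" where
  "locop ds ds' E \<longleftrightarrow> (\<exists>K. local_ops ds ds' K \<and> E = trect ds ds' K)"

lemma lsum_carrier [simp]: "lsum N As \<in> carrier_mat N N"
  by (simp add: lsum_def)

lemma index_lsum: "a < N \<Longrightarrow> b < N \<Longrightarrow> lsum N As $$ (a, b) = (\<Sum>A\<leftarrow>As. A $$ (a, b))"
  by (simp add: lsum_def)

lemma dim_lsum [simp]: "dim_row (lsum N As) = N" "dim_col (lsum N As) = N"
  by (simp_all add: lsum_def)

lemma lsum_append: "lsum N (As @ Bs) = lsum N As + lsum N Bs"
  by (rule eq_matI) (auto simp: lsum_def)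

lemma lsum_Nil: "lsum N [] = 0\<^sub>m N N"
  by (rule eq_matI) (auto simp: lsum_def)

lemma lsum_Cons: "A \<in> carrier_mat N N \<Longrightarrow> lsum N (A # As) = A + lsum N As"
  by (rule eq_matI) (auto simp: lsum_def)

lemma sum_list_map_concat:
  fixes f :: "'a \<Rightarrow> 'b :: comm_monoid_add"
  shows "(\<Sum>x\<leftarrow>concat xss. f x) = (\<Sum>xs\<leftarrow>xss. \<Sum>x\<leftarrow>xs. f x)"
  by (induction xss) auto

lemma lsum_concat: "lsum N (concat Ass) = lsum N (map (lsum N) Ass)"
  by (rule eq_matI) (auto simp: lsum_def sum_list_map_concat comp_def cong: map_cong)

lemma lsum_cong: "(\<And>A a b. A \<in> set As \<Longrightarrow> a < N \<Longrightarrow> b < N \<Longrightarrow> f A $$ (a, b) = g A $$ (a, b)) \<Longrightarrow>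
    lsum N (map f As) = lsum N (map g As)"
  unfolding lsum_def by (intro cong_mat) (auto simp: comp_def cong: map_cong)

lemma lsum_swap: "lsum N (map (\<lambda>x. lsum N (map (\<lambda>y. f x y) ys)) xs) = lsum N (map (\<lambda>y. lsum N (map (\<lambda>x. f x y) xs)) ys)"
proof (rule eq_matI)
  fix a b assume "a < dim_row (lsum N (map (\<lambda>y. lsum N (map (\<lambda>x. f x y) xs)) ys))"
    "b < dim_col (lsum N (map (\<lambda>y. lsum N (map (\<lambda>x. f x y) xs)) ys))"
  then have ab: "a < N" "b < N" by auto
  have "(\<Sum>x\<leftarrow>xs. \<Sum>y\<leftarrow>ys. f x y $$ (a, b)) = (\<Sum>y\<leftarrow>ys. \<Sum>x\<leftarrow>xs. f x y $$ (a, b))"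
    by (induction xs) (auto simp: sum_list_addf)
  then show "lsum N (map (\<lambda>x. lsum N (map (\<lambda>y. f x y) ys)) xs) $$ (a, b) =
      lsum N (map (\<lambda>y. lsum N (map (\<lambda>x. f x y) xs)) ys) $$ (a, b)"
    using ab by (simp add: index_lsum comp_def)
qed auto

lemma conj_lsum:
  assumes E: "E \<in> carrier_mat n m" and As: "\<forall>A\<in>set As. A \<in> carrier_mat m m"
  shows "E * lsum m As * mat_adjoint E = lsum n (map (\<lambda>A. E * A * mat_adjoint E) As)"
  using As
proof (induction As)
  case Nil
  then show ?case using E by (simp add: lsum_Nil right_mult_zero_mat[of _ n m] left_mult_zero_mat[of _ m n])
next
  case (Cons A As)
  have "E * lsum m (A # As) * mat_adjoint E = E * A * mat_adjoint E + E * lsum m As * mat_adjoint E"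
    using Cons.prems by (simp add: lsum_Cons conj_add_mat[OF E])
  also have "\<dots> = lsum n (map (\<lambda>A. E * A * mat_adjoint E) (A # As))"
    using Cons E by (simp add: lsum_Cons[OF mult_carrier_mat[OF mult_carrier_mat[of E n m A m] carrier_mat_adjoint]])
  finally show ?case .
qed

lemma pull_carrier [simp]: "pull N Ks M \<in> carrier_mat N N"
  by (simp add: pull_def)

lemma pull_one_list: "M \<in> carrier_mat N N \<Longrightarrow> pull N [1\<^sub>m N] M = M"
  by (rule eq_matI) (auto simp: pull_def lsum_def)

lemma pull_append: "pull N (Ks @ Ls) M = pull N Ks M + pull N Ls M"
  by (simp add: pull_def lsum_append)

lemma pull_lsum:
  assumes "\<forall>K\<in>set Ks. K \<in> carrier_mat n N" "\<forall>M\<in>set Ms. M \<in> carrier_mat n n"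
  shows "pull N Ks (lsum n Ms) = lsum N (map (pull N Ks) Ms)"
proof -
  have "pull N Ks (lsum n Ms) = lsum N (map (\<lambda>K. lsum N (map (\<lambda>M. mat_adjoint K * M * K) Ms)) Ks)"
    unfolding pull_def
    using assms conj_lsum[of "mat_adjoint _" N n Ms] by (intro lsum_cong) simp
  also have "\<dots> = lsum N (map (pull N Ks) Ms)"
    unfolding pull_def by (rule lsum_swap)
  finally show ?thesis .
qed

text \<open>In the Heisenberg picture the later operation acts on the effect first. The combined
  list of Kraus operators has the shape produced by \<open>stepI\<close>.\<close>

lemma pull_pull:
  assumes K: "\<forall>K\<in>set Ks. K \<in> carrier_mat k n" and E: "\<forall>E\<in>set Es. E \<in> carrier_mat n N"
    and M: "M \<in> carrier_mat k k"
  shows "pull N Es (pull n Ks M) = pull N [K * E. K \<leftarrow> Ks, E \<leftarrow> Es] M"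
proof -
  have "pull N Es (pull n Ks M) = lsum N (map (pull N Es) (map (\<lambda>K. mat_adjoint K * M * K) Ks))"
    unfolding pull_def[of n] using K M by (intro pull_lsum[OF E]) (auto intro!: mult_carrier_mat[of _ _ k])
  also have "\<dots> = lsum N (map (\<lambda>K. lsum N (map (\<lambda>E. mat_adjoint (K * E) * M * (K * E)) Es)) Ks)"
    unfolding map_map comp_def pull_def
  proof (intro arg_cong[where f = "lsum N"] map_cong refl)
    fix K E' assume *: "K \<in> set Ks" "E' \<in> set Es"
    then have c: "K \<in> carrier_mat k n" "E' \<in> carrier_mat n N" using K E by auto
    show "mat_adjoint E' * (mat_adjoint K * M * K) * E' = mat_adjoint (K * E') * M * (K * E')"
    proof -
      have cA: "mat_adjoint E' \<in> carrier_mat N n" "mat_adjoint K \<in> carrier_mat n k" using c by auto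
      have BM: "mat_adjoint K * M \<in> carrier_mat n k" using cA M by auto
      have "mat_adjoint E' * (mat_adjoint K * M * K) * E' = mat_adjoint E' * (mat_adjoint K * M * K * E')"
        using cA c BM by (intro assoc_mult_mat[of _ N n _ n _ N]) auto
      also have "mat_adjoint K * M * K * E' = mat_adjoint K * M * (K * E')"
        using c BM by (intro assoc_mult_mat[of _ n k _ n _ N]) auto
      also have "mat_adjoint E' * (mat_adjoint K * M * (K * E')) = mat_adjoint E' * (mat_adjoint K * M) * (K * E')"
        using c cA BM by (intro assoc_mult_mat[symmetric, of _ N n _ k _ N]) auto
      also have "mat_adjoint E' * (mat_adjoint K * M) = mat_adjoint E' * mat_adjoint K * M"
        using cA M by (intro assoc_mult_mat[symmetric, of _ N n _ k _ k]) auto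
      finally show ?thesis by (simp add: mat_adjoint_mult[OF c])
    qed
  qed
  also have "\<dots> = lsum N (concat (map (\<lambda>K. map (\<lambda>E. mat_adjoint (K * E) * M * (K * E)) Es) Ks))"
    by (simp add: lsum_concat comp_def)
  also have "\<dots> = pull N [K * E. K \<leftarrow> Ks, E \<leftarrow> Es] M"
    by (simp add: pull_def map_concat comp_def)
  finally show ?thesis .
qed

lemma pull_one:
  assumes "\<forall>K\<in>set Ks. K \<in> carrier_mat k N"
  shows "pull N Ks (1\<^sub>m k) = lsum N (map (\<lambda>K. mat_adjoint K * K) Ks)"
  unfolding pull_def using assms by (intro lsum_cong) (auto simp: right_mult_one_mat[of _ N k])

lemma locop_carrier: "locop ds ds' E \<Longrightarrow> E \<in> carrier_mat (dimp ds') (dimp ds)"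
  by (auto simp: locop_def)

lemma locop_one: "valid_dims ds \<Longrightarrow> locop ds ds (1\<^sub>m (dimp ds))"
  unfolding locop_def using trect_one local_ops_one by metis

lemma locop_mult: "locop ds ds' E \<Longrightarrow> locop ds' ds'' F \<Longrightarrow> locop ds ds'' (F * E)"
  unfolding locop_def using trect_mult local_ops_mult by metis

lemma locop_adjoint: "locop ds ds' E \<Longrightarrow> locop ds' ds (mat_adjoint E)"
  unfolding locop_def using trect_adjoint local_ops_adjoint by metis

lemma locop_embed:
  "valid_dims ds \<Longrightarrow> j < length ds \<Longrightarrow> 0 < d \<Longrightarrow> K \<in> carrier_mat d (ds ! j) \<Longrightarrow>
    locop ds (ds[j := d]) (embed ds (ds[j := d]) j K)"
  unfolding locop_def using embed_eq_trect local_ops_embed by metis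

context local_cone
begin

lemma cone_locop: "locop ds ds' E \<Longrightarrow> C ds A \<Longrightarrow> C ds' (E * A * mat_adjoint E)"
  by (auto simp: locop_def cone_conj)

lemma cone_pull:
  assumes "valid_dims ds" "\<forall>K\<in>set Ks. locop ds ds' K" "C ds' M"
  shows "C ds (pull (dimp ds) Ks M)"
  unfolding pull_def lsum_def
proof (rule cone_sum_list[OF assms(1)])
  fix A assume "A \<in> set (map (\<lambda>K. mat_adjoint K * M * K) Ks)"
  then obtain K where K: "K \<in> set Ks" "A = mat_adjoint K * M * mat_adjoint (mat_adjoint K)" by auto
  show "C ds A" unfolding K(2) using K(1) assms by (intro cone_locop[of ds'] locop_adjoint) auto
qed

end

lemma local_instrumentD:
  assumes "local_instrument d I" "x \<in> set I"
  shows "0 < fst x" "K \<in> set (snd x) \<Longrightarrow> K \<in> carrier_mat (fst x) d"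
  using assms by (auto simp: local_instrument_def)

text \<open>Local steps are product operators and their products are product operators again;
  merging only concatenates lists of Kraus operators. Statements on cones reach LOCC protocols
  through this fact.\<close>

lemma locc_instr_kraus:
  "locc_instr ds L \<Longrightarrow> valid_dims ds \<and> (\<forall>q\<in>set L. valid_dims (fst q) \<and> length (fst q) = length ds \<and>
    (\<forall>K\<in>set (snd q). locop ds (fst q) K))"
proof (induction rule: locc_instr.induct)
  case (idI ds)
  then show ?case by (auto simp: locop_one)
next
  case (stepI ds j I L)
  have "locop ds (ds[j := fst (I ! x)]) (embed ds (ds[j := fst (I ! x)]) j Kl)"
    if "x < length I" "Kl \<in> set (snd (I ! x))" for x Kl
    using that stepI(1,2) local_instrumentD[OF stepI(3), of "I ! x"] by (intro locop_embed) auto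
  then show ?case using stepI(1,4) by (fastforce intro: locop_mult)
qed auto

text \<open>The output dimensions are recorded because only outcomes of equal dimensions may be merged.\<close>

inductive LD :: "nat list \<Rightarrow> (nat list \<times> complex mat) list \<Rightarrow> bool" where
  LD_id: "valid_dims ds \<Longrightarrow> LD ds [(ds, 1\<^sub>m (dimp ds))]"
| LD_step: "valid_dims ds \<Longrightarrow> j < length ds \<Longrightarrow> local_instrument (ds ! j) I \<Longrightarrow>
    (\<forall>x<length I. LD (ds[j := fst (I ! x)]) (D x)) \<Longrightarrow>
    LD ds (concat (map (\<lambda>x. map (\<lambda>z. (fst z, pull (dimp ds)
        (map (embed ds (ds[j := fst (I ! x)]) j) (snd (I ! x))) (snd z))) (D x)) [0..<length I]))"
| LD_merge: "LD ds (D1 @ [(ds', A)] @ D2 @ [(ds', B)] @ D3) \<Longrightarrow> LD ds (D1 @ [(ds', A + B)] @ D2 @ D3)"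

definition dpovm :: "nat list \<Rightarrow> (nat list \<times> complex mat list) list \<Rightarrow> (nat list \<times> complex mat) list" where
  "dpovm ds L = map (\<lambda>q. (fst q, pull (dimp ds) (snd q) (1\<^sub>m (dimp (fst q))))) L"

lemma povm_of_instr_dpovm:
  assumes "locc_instr ds L"
  shows "povm_of_instr ds L = map snd (dpovm ds L)"
proof -
  have "lsum (dimp ds) (map (\<lambda>K. mat_adjoint K * K) (snd q)) = pull (dimp ds) (snd q) (1\<^sub>m (dimp (fst q)))"
    if "q \<in> set L" for q
    using locc_instr_kraus[OF assms] that by (intro pull_one[symmetric]) (auto simp: locop_carrier)
  then show ?thesis by (auto simp: povm_of_instr_def dpovm_def lsum_def comp_def)
qed

lemma dpovm_step:
  assumes v: "valid_dims ds" and j: "j < length ds" and I: "local_instrument (ds ! j) I"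
    and L: "\<forall>x<length I. locc_instr (ds[j := fst (I ! x)]) (L x)"
  shows "dpovm ds (concat (map (\<lambda>x. map (\<lambda>q. (fst q,
        [K * embed ds (ds[j := fst (I ! x)]) j Kl. K \<leftarrow> snd q, Kl \<leftarrow> snd (I ! x)])) (L x)) [0..<length I])) =
    concat (map (\<lambda>x. map (\<lambda>z. (fst z, pull (dimp ds)
        (map (embed ds (ds[j := fst (I ! x)]) j) (snd (I ! x))) (snd z))) (dpovm (ds[j := fst (I ! x)]) (L x))) [0..<length I])"
proof -
  have "pull (dimp ds) [K * embed ds (ds[j := fst (I ! x)]) j Kl. K \<leftarrow> snd q, Kl \<leftarrow> snd (I ! x)] (1\<^sub>m (dimp (fst q))) =
      pull (dimp ds) (map (embed ds (ds[j := fst (I ! x)]) j) (snd (I ! x)))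
        (pull (dimp (ds[j := fst (I ! x)])) (snd q) (1\<^sub>m (dimp (fst q))))"
    if "x < length I" "q \<in> set (L x)" for x q
  proof -
    have "pull (dimp ds) (map (embed ds (ds[j := fst (I ! x)]) j) (snd (I ! x)))
        (pull (dimp (ds[j := fst (I ! x)])) (snd q) (1\<^sub>m (dimp (fst q)))) =
        pull (dimp ds) [K * E. K \<leftarrow> snd q, E \<leftarrow> map (embed ds (ds[j := fst (I ! x)]) j) (snd (I ! x))] (1\<^sub>m (dimp (fst q)))"
    proof (rule pull_pull)
      show "\<forall>K\<in>set (snd q). K \<in> carrier_mat (dimp (fst q)) (dimp (ds[j := fst (I ! x)]))"
        using locc_instr_kraus L that by (meson locop_carrier)
      show "\<forall>E\<in>set (map (embed ds (ds[j := fst (I ! x)]) j) (snd (I ! x))). E \<in> carrier_mat (dimp (ds[j := fst (I ! x)])) (dimp ds)"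
        by (auto simp: embed_def)
    qed auto
    then show ?thesis by (simp add: comp_def)
  qed
  then show ?thesis
    unfolding dpovm_def map_concat map_map comp_def fst_conv snd_conv
    by (intro arg_cong[where f = concat] map_cong refl) auto
qed

lemma LD_dpovm: "locc_instr ds L \<Longrightarrow> LD ds (dpovm ds L)"
proof (induction rule: locc_instr.induct)
  case (idI ds)
  then show ?case using LD_id[of ds] by (simp add: dpovm_def pull_one_list)
next
  case (stepI ds j I L)
  then have "\<forall>x<length I. locc_instr (ds[j := fst (I ! x)]) (L x)" by blast
  from dpovm_step[OF stepI(1-3) this] show ?case
    using LD_step[OF stepI(1-3), of "\<lambda>x. dpovm (ds[j := fst (I ! x)]) (L x)"] stepI(4) by simp
next
  case (mergeI ds L1 ds' K1 L2 K2 L3)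
  then show ?case
    using LD_merge[of ds "dpovm ds L1" ds' _ "dpovm ds L2" _ "dpovm ds L3"]
    by (simp add: dpovm_def pull_append)
qed

text \<open>Protocols can thus be assembled on the level of effects, where merging is addition, and
  be realised by Kraus operators afterwards.\<close>

lemma LD_imp_locc_instr: "LD ds D \<Longrightarrow> \<exists>L. locc_instr ds L \<and> D = dpovm ds L"
proof (induction rule: LD.induct)
  case (LD_id ds)
  then show ?case using idI[of ds] by (intro exI[of _ "[(ds, [1\<^sub>m (dimp ds)])]"]) (simp add: dpovm_def pull_one_list)
next
  case (LD_step ds j I D)
  then obtain L where L: "\<forall>x<length I. locc_instr (ds[j := fst (I ! x)]) (L x)"
    and D: "\<And>x. x < length I \<Longrightarrow> D x = dpovm (ds[j := fst (I ! x)]) (L x)" by metis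
  show ?case
    by (intro exI conjI, rule stepI[OF LD_step(1-3) L], unfold dpovm_step[OF LD_step(1-3) L])
      (auto simp: D intro!: arg_cong[where f = concat])
next
  case (LD_merge ds D1 ds' A D2 B D3)
  then obtain L where L: "locc_instr ds L" "D1 @ [(ds', A)] @ D2 @ [(ds', B)] @ D3 = dpovm ds L" by blast
  define f where "f = (\<lambda>q::nat list \<times> complex mat list. (fst q, pull (dimp ds) (snd q) (1\<^sub>m (dimp (fst q)))))"
  have "map f L = D1 @ [(ds', A)] @ D2 @ [(ds', B)] @ D3" using L(2) by (simp add: dpovm_def f_def)
  \<comment> \<open>The decomposition of the list of effects is pulled back along
    \<open>map f\<close> to the list of outcomes; the equal recorded dimensions then permit the
    merge.\<close>
  then obtain L1 q1 L2 q2 L3 where *: "L = L1 @ [q1] @ L2 @ [q2] @ L3" "D1 = map f L1" "(ds', A) = f q1"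
    "D2 = map f L2" "(ds', B) = f q2" "D3 = map f L3"
    by (auto simp: map_eq_append_conv map_eq_Cons_conv append_eq_map_conv Cons_eq_map_conv)
  have "fst q1 = ds'" "fst q2 = ds'" using *(3,5) by (auto simp: f_def)
  then have q: "q1 = (ds', snd q1)" "q2 = (ds', snd q2)" by (metis prod.collapse)+
  have "locc_instr ds (L1 @ [(ds', snd q1)] @ L2 @ [(ds', snd q2)] @ L3)" using L(1) *(1) q by simp
  from mergeI[OF this] have "locc_instr ds (L1 @ [(ds', snd q1 @ snd q2)] @ L2 @ L3)" .
  moreover have "D1 @ [(ds', A + B)] @ D2 @ D3 = dpovm ds (L1 @ [(ds', snd q1 @ snd q2)] @ L2 @ L3)"
    using *(2-6) q by (auto simp: dpovm_def f_def pull_append)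
  ultimately show ?case by blast
qed

lemma locc_povm_iff: "locc_povm ds Ms \<longleftrightarrow> (\<exists>D. LD ds D \<and> Ms = map snd D)"
  unfolding locc_povm_def using LD_dpovm LD_imp_locc_instr povm_of_instr_dpovm by metis

lemma gsep_one: "valid_dims ds \<Longrightarrow> 1 \<in> W \<Longrightarrow> gsep W ds (1\<^sub>m (dimp ds))"
  using gsep_trect[of ds "\<lambda>j. 1\<^sub>m (ds ! j)" W] by (simp add: trect_one psd_one)

lemma embed_adjoint_mult:
  assumes v: "valid_dims ds" and j: "j < length ds" and d: "0 < d" and K: "K \<in> carrier_mat d (ds ! j)"
  shows "mat_adjoint (embed ds (ds[j := d]) j K) * embed ds (ds[j := d]) j K = embed ds ds j (mat_adjoint K * K)"
proof -
  let ?K = "\<lambda>k. if k = j then K else 1\<^sub>m (ds ! k)"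
  note lo = local_ops_embed[OF v j d K]
  have "mat_adjoint (embed ds (ds[j := d]) j K) * embed ds (ds[j := d]) j K =
      trect ds ds (\<lambda>k. mat_adjoint (?K k) * ?K k)"
    unfolding embed_eq_trect[OF v j d K] trect_adjoint[OF lo]
    by (rule trect_mult[OF lo local_ops_adjoint[OF lo]])
  also have "\<dots> = trect ds ds (\<lambda>k. if k = j then mat_adjoint K * K else 1\<^sub>m (ds ! k))"
    by (rule trect_cong) auto
  also have "\<dots> = embed ds (ds[j := ds ! j]) j (mat_adjoint K * K)"
    using v j K by (subst embed_eq_trect) (auto simp: valid_dims_def)
  finally show ?thesis by simp
qed

lemma embed_one:
  assumes "valid_dims ds" "j < length ds"
  shows "embed ds ds j (1\<^sub>m (ds ! j)) = 1\<^sub>m (dimp ds)"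
proof -
  have "embed ds (ds[j := ds ! j]) j (1\<^sub>m (ds ! j)) = trect ds ds (\<lambda>k. if k = j then 1\<^sub>m (ds ! j) else 1\<^sub>m (ds ! k))"
    using assms by (subst embed_eq_trect) (auto simp: valid_dims_def)
  also have "\<dots> = trect ds ds (\<lambda>k. 1\<^sub>m (ds ! k))" by (rule trect_cong) auto
  finally show ?thesis using assms by (simp add: trect_one)
qed

text \<open>The entry at (a, b) separates into a sum over the local instrument, taken at the digits
  of party \<open>j\<close>, and a common Kronecker delta for the other parties; completeness of
  \<open>I\<close> turns the first factor into an identity entry.\<close>

lemma embed_complete:
  assumes v: "valid_dims ds" and j: "j < length ds" and I: "local_instrument (ds ! j) I"
  shows "lsum (dimp ds) (map (\<lambda>x. pull (dimp ds) (map (embed ds (ds[j := fst (I ! x)]) j) (snd (I ! x)))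
      (1\<^sub>m (dimp (ds[j := fst (I ! x)])))) [0..<length I]) = 1\<^sub>m (dimp ds)" (is "?l = _")
proof (rule eq_matI)
  fix a b assume "a < dim_row (1\<^sub>m (dimp ds))" "b < dim_col (1\<^sub>m (dimp ds))"
  then have ab: "a < dimp ds" "b < dimp ds" by auto
  let ?\<delta> = "\<Prod>k\<in>{..<length ds} - {j}. if digit ds k a = digit ds k b then 1 else 0 :: complex"
  let ?a = "digit ds j a" and ?b = "digit ds j b"
  have dl: "?a < ds ! j" "?b < ds ! j" using digit_less[OF v j] by auto
  have emb: "pull (dimp ds) (map (embed ds (ds[j := fst x]) j) (snd x)) (1\<^sub>m (dimp (ds[j := fst x]))) $$ (a, b) =
      (\<Sum>K\<leftarrow>snd x. (mat_adjoint K * K) $$ (?a, ?b)) * ?\<delta>" if "x \<in> set I" for x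
  proof -
    have "pull (dimp ds) (map (embed ds (ds[j := fst x]) j) (snd x)) (1\<^sub>m (dimp (ds[j := fst x]))) =
        lsum (dimp ds) (map (\<lambda>K. mat_adjoint K * K) (map (embed ds (ds[j := fst x]) j) (snd x)))"
      by (rule pull_one) (auto simp: embed_def)
    also have "\<dots> = lsum (dimp ds) (map (\<lambda>K. embed ds ds j (mat_adjoint K * K)) (snd x))"
      unfolding map_map comp_def using local_instrumentD[OF I that]
      by (intro arg_cong[where f = "lsum _"] map_cong refl embed_adjoint_mult[OF v j])
    also have "\<dots> $$ (a, b) = (\<Sum>K\<leftarrow>snd x. embed ds ds j (mat_adjoint K * K) $$ (a, b))"
      using ab by (simp add: index_lsum comp_def)
    also have "\<dots> = (\<Sum>K\<leftarrow>snd x. (mat_adjoint K * K) $$ (?a, ?b) * ?\<delta>)"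
      using ab by (simp add: embed_def del: index_mult_mat)
    finally show ?thesis by (simp only: sum_list_mult_const)
  qed
  have one: "(\<Sum>x\<leftarrow>I. \<Sum>K\<leftarrow>snd x. (mat_adjoint K * K) $$ (?a, ?b)) = 1\<^sub>m (ds ! j) $$ (?a, ?b)"
  proof -
    have "mat (ds ! j) (ds ! j) (\<lambda>ab. \<Sum>x\<leftarrow>I. \<Sum>K\<leftarrow>snd x. (mat_adjoint K * K) $$ ab) $$ (?a, ?b) =
        1\<^sub>m (ds ! j) $$ (?a, ?b)" using I by (simp add: local_instrument_def)
    then show ?thesis using dl by simp
  qed
  have "?l $$ (a, b) = (\<Sum>x\<leftarrow>[0..<length I]. pull (dimp ds) (map (embed ds (ds[j := fst (I ! x)]) j) (snd (I ! x)))
      (1\<^sub>m (dimp (ds[j := fst (I ! x)]))) $$ (a, b))"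
    using ab by (simp add: index_lsum comp_def)
  also have "\<dots> = (\<Sum>x\<leftarrow>map (\<lambda>i. I ! i) [0..<length I]. pull (dimp ds) (map (embed ds (ds[j := fst x]) j) (snd x))
      (1\<^sub>m (dimp (ds[j := fst x]))) $$ (a, b))"
    by (simp only: map_map comp_def)
  also have "\<dots> = (\<Sum>x\<leftarrow>I. (\<Sum>K\<leftarrow>snd x. (mat_adjoint K * K) $$ (?a, ?b)) * ?\<delta>)"
    unfolding map_nth by (intro arg_cong[where f = sum_list] map_cong refl emb)
  also have "\<dots> = 1\<^sub>m (ds ! j) $$ (?a, ?b) * ?\<delta>" by (simp only: sum_list_mult_const one)
  also have "\<dots> = embed ds ds j (1\<^sub>m (ds ! j)) $$ (a, b)" using ab by (simp add: embed_def)
  finally show "?l $$ (a, b) = 1\<^sub>m (dimp ds) $$ (a, b)" by (simp add: embed_one[OF v j])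
qed auto

text \<open>Pulling back along product operators keeps effects separable, and the effects of each
  continuation sum to the identity before they are pulled back. The inclusion of LOCC measurements
  in separable ones rests on this.\<close>

lemma LD_props:
  "LD ds D \<Longrightarrow> valid_dims ds \<and> (\<forall>z\<in>set D. valid_dims (fst z) \<and> length (fst z) = length ds \<and> gsep {1} ds (snd z)) \<and>
    lsum (dimp ds) (map snd D) = 1\<^sub>m (dimp ds)"
proof (induction rule: LD.induct)
  case (LD_id ds)
  then show ?case by (simp add: gsep_one lsum_Cons lsum_Nil)
next
  case (LD_step ds j I D)
  let ?E = "\<lambda>x. map (embed ds (ds[j := fst (I ! x)]) j) (snd (I ! x))"
  have loc: "\<forall>E\<in>set (?E x). locop ds (ds[j := fst (I ! x)]) E" if "x < length I" for x
    using LD_step(1,2) local_instrumentD[OF LD_step(3), of "I ! x"] that by (auto intro!: locop_embed)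
  have "lsum (dimp ds) (map snd (concat (map (\<lambda>x. map (\<lambda>z. (fst z, pull (dimp ds) (?E x) (snd z))) (D x)) [0..<length I]))) =
     lsum (dimp ds) (map (\<lambda>x. lsum (dimp ds) (map (pull (dimp ds) (?E x)) (map snd (D x)))) [0..<length I])"
    by (simp add: map_concat lsum_concat comp_def)
  also have "\<dots> = lsum (dimp ds) (map (\<lambda>x. pull (dimp ds) (?E x) (1\<^sub>m (dimp (ds[j := fst (I ! x)])))) [0..<length I])"
  proof (intro arg_cong[where f = "lsum _"] map_cong refl)
    fix x assume "x \<in> set [0..<length I]"
    then have x: "x < length I" by simp
    have "lsum (dimp ds) (map (pull (dimp ds) (?E x)) (map snd (D x))) =
        pull (dimp ds) (?E x) (lsum (dimp (ds[j := fst (I ! x)])) (map snd (D x)))"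
      using LD_step(4) x loc[OF x]
      by (intro pull_lsum[symmetric]) (auto intro: locop_carrier, metis gsep_carrier snd_conv)
    then show "lsum (dimp ds) (map (pull (dimp ds) (?E x)) (map snd (D x))) =
        pull (dimp ds) (?E x) (1\<^sub>m (dimp (ds[j := fst (I ! x)])))"
      using LD_step(4) x by simp
  qed
  also have "\<dots> = 1\<^sub>m (dimp ds)" by (rule embed_complete[OF LD_step(1-3)])
  finally show ?case
    using LD_step(1,4) loc by (auto intro!: gsep_cone.cone_pull)
next
  case (LD_merge ds D1 ds' A D2 B D3)
  have c: "A \<in> carrier_mat (dimp ds) (dimp ds)" "B \<in> carrier_mat (dimp ds) (dimp ds)"
    using LD_merge by (auto simp: gsep_carrier)
  have "lsum (dimp ds) (map snd (D1 @ [(ds', A + B)] @ D2 @ D3)) =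
      lsum (dimp ds) (map snd (D1 @ [(ds', A)] @ D2 @ [(ds', B)] @ D3))"
    unfolding lsum_def using c by (intro cong_mat refl) (auto simp: algebra_simps)
  then show ?case using LD_merge by (auto simp: gsep_add)
qed

lemma sep_povm_iff:
  assumes "valid_dims ds"
  shows "sep_povm ds Ms \<longleftrightarrow> (\<forall>M\<in>set Ms. gsep {1} ds M) \<and> lsum (dimp ds) Ms = 1\<^sub>m (dimp ds)"
proof -
  have "gsep {1} ds M \<longleftrightarrow> (\<exists>(m::nat) (F :: nat \<Rightarrow> nat \<Rightarrow> complex mat).
        (\<forall>k<m. \<forall>j<length ds. psd (ds ! j) (F k j)) \<and>
        M = mat (dimp ds) (dimp ds)
              (\<lambda>ab. \<Sum>k<m. tensor_list ds (map (F k) [0..<length ds]) $$ ab))" (is "_ = ?R") for M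
  proof
    assume "gsep {1} ds M"
    then obtain m :: nat and c F where *: "\<forall>k<m. c k \<in> {1::real} \<and> (\<forall>j<length ds. psd (ds ! j) (F k j))"
      "M = mat (dimp ds) (dimp ds) (\<lambda>ab. \<Sum>k<m. complex_of_real (c k) * trect ds ds (F k) $$ ab)"
      unfolding gsep_def by blast
    have "M = mat (dimp ds) (dimp ds) (\<lambda>ab. \<Sum>k<m. trect ds ds (F k) $$ ab)"
      unfolding *(2) using *(1) by (intro cong_mat sum.cong) auto
    then show ?R using * unfolding tensor_list_eq_trect by blast
  next
    assume ?R
    then obtain m :: nat and F where F: "\<forall>k<m. \<forall>j<length ds. psd (ds ! j) (F k j)"
      "M = mat (dimp ds) (dimp ds) (\<lambda>ab. \<Sum>k<m. trect ds ds (F k) $$ ab)"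
      unfolding tensor_list_eq_trect by blast
    show "gsep {1} ds M" unfolding gsep_def
      using assms F by (intro conjI exI[of _ m] exI[of _ "\<lambda>_. 1"] exI[of _ F]) auto
  qed
  then show ?thesis
    using gsep_psd[of "{1}" ds] unfolding sep_povm_def povm_def lsum_def by auto
qed

lemma locc_povm_sep_povm: "valid_dims ds \<Longrightarrow> locc_povm ds Ms \<Longrightarrow> sep_povm ds Ms"
  unfolding locc_povm_iff sep_povm_iff by (auto dest!: LD_props)

subsection \<open>Composition of instruments with measurements\<close>

text \<open>Cuts an annotated list \<open>Z\<close> into the blocks of the individual branches. As
  the entries of \<open>xs\<close> are distinct, the blocks can be given as a function of
  \<open>x\<close>.\<close>

lemma map_eq_concat_ex:
  assumes "map g Z = concat (map f xs)" "distinct xs"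
  shows "\<exists>h. Z = concat (map h xs) \<and> (\<forall>x\<in>set xs. map g (h x) = f x)"
  using assms
proof (induction xs arbitrary: Z)
  case (Cons x xs)
  then obtain U V where Z: "Z = U @ V" "map g U = f x" "map g V = concat (map f xs)"
    by (auto simp: map_eq_append_conv append_eq_map_conv)
  obtain h where h: "V = concat (map h xs)" "\<forall>x\<in>set xs. map g (h x) = f x"
    using Cons.IH[OF Z(3)] Cons.prems by auto
  have "concat (map (\<lambda>y. if y = x then U else h y) xs) = concat (map h xs)"
    using Cons.prems by (intro arg_cong[where f = concat] map_cong) auto
  then show ?case using Z h Cons.prems by (intro exI[of _ "\<lambda>y. if y = x then U else h y"]) auto
qed auto

lemma concat_concat_eq: "concat (concat xsss) = concat (map concat xsss)"
  by (induction xsss) auto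

text \<open>Two copies of a block are merged outcome by outcome; each merged outcome moves into the
  prefix \<open>D1\<close>, which the induction therefore leaves arbitrary.\<close>

lemma LD_merge_blocks:
  "LD ds (D1 @ map (\<lambda>z. (d z, A z)) zs @ D2 @ map (\<lambda>z. (d z, B z)) zs @ D3) \<Longrightarrow>
    LD ds (D1 @ map (\<lambda>z. (d z, A z + B z)) zs @ D2 @ D3)"
proof (induction zs arbitrary: D1 D3)
  case (Cons z zs)
  have "LD ds (D1 @ [(d z, A z)] @ (map (\<lambda>z. (d z, A z)) zs @ D2) @ [(d z, B z)] @ (map (\<lambda>z. (d z, B z)) zs @ D3))"
    using Cons.prems by simp
  from LD_merge[OF this]
  have "LD ds ((D1 @ [(d z, A z + B z)]) @ map (\<lambda>z. (d z, A z)) zs @ D2 @ map (\<lambda>z. (d z, B z)) zs @ D3)" by simp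
  from Cons.IH[OF this] show ?case by simp
qed simp

text \<open>\<open>Z\<close> attaches a continuation to every outcome of \<open>L\<close>. At a
  local step the continuations are handed to the branches. At a merged outcome the single
  continuation is run separately after both constituents and the results are merged, so that
  coarse-graining is postponed to the end.\<close>

lemma LD_compose:
  assumes "locc_instr ds L"
  shows "map fst Z = L \<Longrightarrow> (\<forall>z\<in>set Z. LD (fst (fst z)) (snd z)) \<Longrightarrow>
    LD ds (concat (map (\<lambda>z. map (\<lambda>w. (fst w, pull (dimp ds) (snd (fst z)) (snd w))) (snd z)) Z))"
  using assms
proof (induction arbitrary: Z rule: locc_instr.induct)
  case (idI ds)
  then obtain D where Z: "Z = [((ds, [1\<^sub>m (dimp ds)]), D)]" by (cases Z) auto
  then have D: "LD ds D" using idI by auto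
  have "map (\<lambda>w. (fst w, pull (dimp ds) [1\<^sub>m (dimp ds)] (snd w))) D = D"
    using LD_props[OF D] by (intro map_idI) (auto simp: pull_one_list gsep_carrier)
  then show ?case using D by (simp add: Z)
next
  case (stepI ds j I L)
  let ?d = "\<lambda>x. ds[j := fst (I ! x)]"
  let ?E = "\<lambda>x. map (embed ds (?d x) j) (snd (I ! x))"
  define \<phi> where "\<phi> x = (\<lambda>q. (fst q :: nat list, [K * embed ds (?d x) j Kl. K \<leftarrow> snd q, Kl \<leftarrow> snd (I ! x)]))" for x
  have "map fst Z = concat (map (\<lambda>x. map (\<phi> x) (L x)) [0..<length I])"
    using stepI.prems(1) by (simp add: \<phi>_def)
  then obtain h where Z: "Z = concat (map h [0..<length I])"
    and h: "\<forall>x\<in>set [0..<length I]. map fst (h x) = map (\<phi> x) (L x)"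
    using map_eq_concat_ex[OF _ distinct_upt] by blast
  \<comment> \<open>The outcomes of branch \<open>x\<close> before the Kraus operators of the first
    step are attached, paired with the continuations found in \<open>Z\<close>.\<close>
  define Z' where "Z' x = zip (L x) (map snd (h x))" for x
  have len: "length (h x) = length (L x)" if "x < length I" for x
    using h that by (metis atLeast0LessThan lessThan_iff length_map set_upt)
  have fstZ': "map fst (Z' x) = L x" if "x < length I" for x
    using len[OF that] by (simp add: Z'_def)
  have hZ': "h x = map (\<lambda>z. (\<phi> x (fst z), snd z)) (Z' x)" if x: "x < length I" for x
  proof (rule nth_equalityI)
    fix i assume i: "i < length (h x)"
    have "fst (h x ! i) = \<phi> x (L x ! i)"
      using arg_cong[OF h[rule_format, of x], of "\<lambda>l. l ! i"] i len[OF x] x by simp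
    then show "h x ! i = map (\<lambda>z. (\<phi> x (fst z), snd z)) (Z' x) ! i"
      using i len[OF x] by (simp add: Z'_def prod_eq_iff)
  qed (simp add: Z'_def len[OF x])
  have ldZ': "\<forall>z\<in>set (Z' x). LD (fst (fst z)) (snd z)" if x: "x < length I" for x
  proof
    fix z assume "z \<in> set (Z' x)"
    then have "(\<phi> x (fst z), snd z) \<in> set Z" using hZ'[OF x] x by (force simp: Z)
    then show "LD (fst (fst z)) (snd z)" using stepI.prems(2) by (force simp: \<phi>_def)
  qed
  define D where "D x = concat (map (\<lambda>z. map (\<lambda>w. (fst w, pull (dimp (?d x)) (snd (fst z)) (snd w))) (snd z)) (Z' x))" for x
  have "\<forall>x<length I. LD (?d x) (D x)"
    using stepI(4) fstZ' ldZ' unfolding D_def by blast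
  from LD_step[OF stepI(1-3) this]
  have "LD ds (concat (map (\<lambda>x. map (\<lambda>z. (fst z, pull (dimp ds) (?E x) (snd z))) (D x)) [0..<length I]))" .
  also have "concat (map (\<lambda>x. map (\<lambda>z. (fst z, pull (dimp ds) (?E x) (snd z))) (D x)) [0..<length I]) =
      concat (map (\<lambda>z. map (\<lambda>w. (fst w, pull (dimp ds) (snd (fst z)) (snd w))) (snd z)) Z)"
  proof -
    have "map (\<lambda>z. (fst z, pull (dimp ds) (?E x) (snd z))) (D x) =
        concat (map (\<lambda>z. map (\<lambda>w. (fst w, pull (dimp ds) (snd (fst z)) (snd w))) (snd z)) (h x))"
      if x: "x < length I" for x
      unfolding D_def map_concat map_map comp_def hZ'[OF x] fst_conv snd_conv
    proof (intro arg_cong[where f = concat] map_cong refl)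
      fix z w assume z: "z \<in> set (Z' x)" and w: "w \<in> set (snd z)"
      have "fst z \<in> set (L x)" using z fstZ'[OF x] by (metis image_eqI list.set_map)
      then have "\<forall>K\<in>set (snd (fst z)). K \<in> carrier_mat (dimp (fst (fst z))) (dimp (?d x))"
        using stepI(4) x locc_instr_kraus by (meson locop_carrier)
      moreover have "snd w \<in> carrier_mat (dimp (fst (fst z))) (dimp (fst (fst z)))"
        using LD_props ldZ'[OF x] z w gsep_carrier by blast
      moreover have "\<forall>E\<in>set (?E x). E \<in> carrier_mat (dimp (?d x)) (dimp ds)" by (auto simp: embed_def)
      ultimately have "pull (dimp ds) (?E x) (pull (dimp (?d x)) (snd (fst z)) (snd w)) =
          pull (dimp ds) [K * E. K \<leftarrow> snd (fst z), E \<leftarrow> ?E x] (snd w)"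
        by (intro pull_pull) auto
      then show "(fst w, pull (dimp ds) (?E x) (pull (dimp (?d x)) (snd (fst z)) (snd w))) =
          (fst w, pull (dimp ds) (snd (\<phi> x (fst z))) (snd w))"
        by (simp add: \<phi>_def comp_def)
    qed
    then have "map (\<lambda>x. map (\<lambda>z. (fst z, pull (dimp ds) (?E x) (snd z))) (D x)) [0..<length I] =
        map (\<lambda>x. concat (map (\<lambda>z. map (\<lambda>w. (fst w, pull (dimp ds) (snd (fst z)) (snd w))) (snd z)) (h x))) [0..<length I]"
      by simp
    then show ?thesis unfolding Z map_concat by (simp only: concat_concat_eq map_map comp_def)
  qed
  finally show ?case .
next
  case (mergeI ds L1 ds' K1 L2 K2 L3)
  let ?f = "\<lambda>z. map (\<lambda>w. (fst w, pull (dimp ds) (snd (fst z)) (snd w))) (snd z)"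
  obtain Z1 D Z2 Z3 where Z: "Z = Z1 @ [((ds', K1 @ K2), D)] @ Z2 @ Z3"
    "map fst Z1 = L1" "map fst Z2 = L2" "map fst Z3 = L3"
  proof -
    obtain Z1 R where 1: "Z = Z1 @ R" "map fst Z1 = L1" "map fst R = (ds', K1 @ K2) # L2 @ L3"
      using mergeI.prems(1) by (auto simp: map_eq_append_conv)
    obtain r R' where 2: "R = r # R'" "fst r = (ds', K1 @ K2)" "map fst R' = L2 @ L3"
      using 1(3) by (auto simp: map_eq_Cons_conv)
    obtain Z2 Z3 where 3: "R' = Z2 @ Z3" "map fst Z2 = L2" "map fst Z3 = L3"
      using 2(3) by (auto simp: map_eq_append_conv)
    have "r = ((ds', K1 @ K2), snd r)" using 2(2) by (metis prod.collapse)
    then show thesis using 1 2 3 by (intro that[of Z1 "snd r" Z2 Z3]) simp_all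
  qed
  let ?Z = "Z1 @ [((ds', K1), D)] @ Z2 @ [((ds', K2), D)] @ Z3"
  have "LD ds (concat (map ?f ?Z))"
    by (rule mergeI.IH) (use Z mergeI.prems(2) in auto)
  then have "LD ds (concat (map ?f Z1) @ map (\<lambda>w. (fst w, pull (dimp ds) K1 (snd w))) D @ concat (map ?f Z2) @
      map (\<lambda>w. (fst w, pull (dimp ds) K2 (snd w))) D @ concat (map ?f Z3))" by simp
  from LD_merge_blocks[OF this] show ?case by (simp add: Z pull_append)
qed

definition seq_povm :: "nat list \<Rightarrow> (nat list \<times> complex mat list) list \<Rightarrow> (nat \<Rightarrow> complex mat list) \<Rightarrow> complex mat list" where
  "seq_povm ds L Ms = concat (map (\<lambda>i. map (pull (dimp ds) (snd (L ! i))) (Ms i)) [0..<length L])"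

lemma locc_povm_seq:
  assumes L: "locc_instr ds L" and Ms: "\<forall>i<length L. locc_povm (fst (L ! i)) (Ms i)"
  shows "locc_povm ds (seq_povm ds L Ms)"
proof -
  obtain D where D: "\<And>i. i < length L \<Longrightarrow> LD (fst (L ! i)) (D i)" "\<And>i. i < length L \<Longrightarrow> Ms i = map snd (D i)"
    using Ms unfolding locc_povm_iff by metis
  let ?Z = "map (\<lambda>i. (L ! i, D i)) [0..<length L]"
  have "map fst ?Z = L" by (simp add: comp_def map_nth)
  moreover have "\<forall>z\<in>set ?Z. LD (fst (fst z)) (snd z)" using D(1) by auto
  ultimately have "LD ds (concat (map (\<lambda>z. map (\<lambda>w. (fst w, pull (dimp ds) (snd (fst z)) (snd w))) (snd z)) ?Z))"
    by (rule LD_compose[OF L])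
  moreover have "seq_povm ds L Ms = map snd (concat (map (\<lambda>z. map (\<lambda>w. (fst w, pull (dimp ds) (snd (fst z)) (snd w))) (snd z)) ?Z))"
    unfolding seq_povm_def map_concat map_map comp_def
    by (intro arg_cong[where f = concat] map_cong refl) (simp add: D(2) comp_def)
  ultimately show ?thesis unfolding locc_povm_iff by blast
qed

lemma locc_instr_complete:
  assumes "locc_instr ds L"
  shows "lsum (dimp ds) (map (\<lambda>i. pull (dimp ds) (snd (L ! i)) (1\<^sub>m (dimp (fst (L ! i))))) [0..<length L]) = 1\<^sub>m (dimp ds)"
proof -
  have "lsum (dimp ds) (map snd (dpovm ds L)) = 1\<^sub>m (dimp ds)" using LD_props[OF LD_dpovm[OF assms]] by simp
  moreover have "map snd (dpovm ds (map (\<lambda>i. L ! i) [0..<length L])) =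
      map (\<lambda>i. pull (dimp ds) (snd (L ! i)) (1\<^sub>m (dimp (fst (L ! i))))) [0..<length L]"
    unfolding dpovm_def map_map by (simp add: comp_def)
  ultimately show ?thesis by (simp add: map_nth)
qed

lemma sep_povm_seq:
  assumes L: "locc_instr ds L" and Ms: "\<forall>i<length L. sep_povm (fst (L ! i)) (Ms i)"
  shows "sep_povm ds (seq_povm ds L Ms)"
proof -
  have v: "valid_dims ds" and vi: "\<And>i. i < length L \<Longrightarrow> valid_dims (fst (L ! i))"
    and loc: "\<And>i. i < length L \<Longrightarrow> \<forall>K\<in>set (snd (L ! i)). locop ds (fst (L ! i)) K"
    using locc_instr_kraus[OF L] by auto
  have Ms': "\<And>M. M \<in> set (Ms i) \<Longrightarrow> gsep {1} (fst (L ! i)) M"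
    "lsum (dimp (fst (L ! i))) (Ms i) = 1\<^sub>m (dimp (fst (L ! i)))" if "i < length L" for i
    using Ms sep_povm_iff[OF vi[OF that]] that by auto
  have "lsum (dimp ds) (seq_povm ds L Ms) =
      lsum (dimp ds) (map (\<lambda>i. lsum (dimp ds) (map (pull (dimp ds) (snd (L ! i))) (Ms i))) [0..<length L])"
    by (simp add: seq_povm_def lsum_concat comp_def)
  also have "\<dots> = lsum (dimp ds) (map (\<lambda>i. pull (dimp ds) (snd (L ! i)) (1\<^sub>m (dimp (fst (L ! i))))) [0..<length L])"
  proof (intro arg_cong[where f = "lsum _"] map_cong refl)
    fix i assume "i \<in> set [0..<length L]"
    then have i: "i < length L" by simp
    have "lsum (dimp ds) (map (pull (dimp ds) (snd (L ! i))) (Ms i)) =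
        pull (dimp ds) (snd (L ! i)) (lsum (dimp (fst (L ! i))) (Ms i))"
      using loc[OF i] Ms'(1)[OF i] by (intro pull_lsum[symmetric]) (auto intro: gsep_carrier locop_carrier)
    then show "lsum (dimp ds) (map (pull (dimp ds) (snd (L ! i))) (Ms i)) =
        pull (dimp ds) (snd (L ! i)) (1\<^sub>m (dimp (fst (L ! i))))" by (simp add: Ms'(2)[OF i])
  qed
  also have "\<dots> = 1\<^sub>m (dimp ds)" by (rule locc_instr_complete[OF L])
  finally show ?thesis unfolding sep_povm_iff[OF v]
    using v by (auto simp: seq_povm_def intro!: gsep_cone.cone_pull loc[rule_format] Ms'(1))
qed

subsection \<open>Joint systems\<close>

text \<open>Each party holds a pair of systems, an active and a passive one.  The flag tells whether the active
  system is the more significant one in the index of the pair; this treats the two factors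
  of a joint system symmetrically.\<close>

definition pr :: "bool \<Rightarrow> nat \<Rightarrow> nat \<Rightarrow> nat \<Rightarrow> nat \<Rightarrow> nat" where
  "pr s d e x y = (if s then x * e + y else y * d + x)"

definition act :: "bool \<Rightarrow> nat \<Rightarrow> nat \<Rightarrow> nat \<Rightarrow> nat" where
  "act s d e z = (if s then z div e else z mod d)"

definition pas :: "bool \<Rightarrow> nat \<Rightarrow> nat \<Rightarrow> nat \<Rightarrow> nat" where
  "pas s d e z = (if s then z mod e else z div d)"

lemma pr_less: "x < d \<Longrightarrow> y < e \<Longrightarrow> pr s d e x y < d * e"
proof -
  have *: "x * e + y < d * e" if "x < d" "y < e" for x y d e :: nat
  proof -
    have "x * e + y < Suc x * e" using that by simp
    also have "\<dots> \<le> d * e" using that by (intro mult_le_mono1) simp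
    finally show ?thesis .
  qed
  show "x < d \<Longrightarrow> y < e \<Longrightarrow> ?thesis" using *[of x d y e] *[of y e x d] by (auto simp: pr_def mult.commute)
qed

lemma act_pr: "x < d \<Longrightarrow> y < e \<Longrightarrow> act s d e (pr s d e x y) = x"
  by (auto simp: act_def pr_def)

lemma pas_pr: "x < d \<Longrightarrow> y < e \<Longrightarrow> pas s d e (pr s d e x y) = y"
  by (auto simp: pas_def pr_def)

lemma pr_act_pas: "pr s d e (act s d e z) (pas s d e z) = z"
  by (auto simp: pr_def act_def pas_def)

lemma act_less: "z < d * e \<Longrightarrow> act s d e z < d"
  by (cases "d = 0") (auto simp: act_def less_mult_imp_div_less)

lemma pas_less: "z < d * e \<Longrightarrow> pas s d e z < e"
  by (cases "e = 0") (auto simp: pas_def less_mult_imp_div_less mult.commute)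

lemma act_not: "act (\<not> s) d e = pas s e d" "pas (\<not> s) d e = act s e d"
  by (auto simp: act_def pas_def)

lemma sum_pr:
  fixes f :: "nat \<Rightarrow> 'a :: comm_monoid_add"
  shows "(\<Sum>z<d * e. f z) = (\<Sum>x<d. \<Sum>y<e. f (pr s d e x y))"
proof -
  have "bij_betw (\<lambda>(x, y). pr s d e x y) ({..<d} \<times> {..<e}) {..<d * e}"
    by (rule bij_betwI[where g = "\<lambda>z. (act s d e z, pas s d e z)"])
      (auto simp: pr_less act_less pas_less act_pr pas_pr pr_act_pas)
  from sum.reindex_bij_betw[OF this, of f] show ?thesis
    by (simp add: sum.cartesian_product case_prod_unfold)
qed

text \<open>The Kronecker product of an active and a passive operator held by one party; the flag
  only fixes the ordering of the two indices.\<close>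

definition kr :: "bool \<Rightarrow> nat \<Rightarrow> nat \<Rightarrow> nat \<Rightarrow> nat \<Rightarrow> complex mat \<Rightarrow> complex mat \<Rightarrow> complex mat" where
  "kr s d d' e e' A B = mat (d' * e') (d * e)
     (\<lambda>(u, v). A $$ (act s d' e' u, act s d e v) * B $$ (pas s d' e' u, pas s d e v))"

lemma kr_carrier [simp]: "kr s d d' e e' A B \<in> carrier_mat (d' * e') (d * e)"
  by (simp add: kr_def)

lemma kr_mult:
  assumes "A \<in> carrier_mat d' d" "B \<in> carrier_mat e' e" "A' \<in> carrier_mat d'' d'" "B' \<in> carrier_mat e'' e'"
  shows "kr s d' d'' e' e'' A' B' * kr s d d' e e' A B = kr s d d'' e e'' (A' * A) (B' * B)"
proof (rule eq_matI)
  fix u v assume "u < dim_row (kr s d d'' e e'' (A' * A) (B' * B))" "v < dim_col (kr s d d'' e e'' (A' * A) (B' * B))"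
  then have uv: "u < d'' * e''" "v < d * e" by (auto simp: kr_def)
  let ?a = "act s d'' e'' u" and ?b = "pas s d'' e'' u" and ?c = "act s d e v" and ?d = "pas s d e v"
  have "(kr s d' d'' e' e'' A' B' * kr s d d' e e' A B) $$ (u, v) =
      (\<Sum>z<d' * e'. kr s d' d'' e' e'' A' B' $$ (u, z) * kr s d d' e e' A B $$ (z, v))"
    by (rule index_mult_sum[OF kr_carrier kr_carrier uv])
  also have "\<dots> = (\<Sum>x<d'. \<Sum>y<e'. A' $$ (?a, x) * B' $$ (?b, y) * (A $$ (x, ?c) * B $$ (y, ?d)))"
    unfolding sum_pr[of _ d' e' s] using uv
    by (intro sum.cong refl) (auto simp: kr_def pr_less act_pr pas_pr)
  also have "\<dots> = (\<Sum>x<d'. A' $$ (?a, x) * A $$ (x, ?c)) * (\<Sum>y<e'. B' $$ (?b, y) * B $$ (y, ?d))"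
    unfolding sum_product by (intro sum.cong refl) (simp add: mult_ac)
  also have "\<dots> = (A' * A) $$ (?a, ?c) * (B' * B) $$ (?b, ?d)"
    using uv assms
    by (simp only: index_mult_sum[OF assms(3,1)] index_mult_sum[OF assms(4,2)] act_less pas_less)
  finally show "(kr s d' d'' e' e'' A' B' * kr s d d' e e' A B) $$ (u, v) = kr s d d'' e e'' (A' * A) (B' * B) $$ (u, v)"
    using uv by (simp add: kr_def)
qed (auto simp: kr_def)

lemma kr_one: "kr s d d e e (1\<^sub>m d) (1\<^sub>m e) = 1\<^sub>m (d * e)"
proof (rule eq_matI)
  fix u v assume "u < dim_row (1\<^sub>m (d * e))" "v < dim_col (1\<^sub>m (d * e))"
  then have uv: "u < d * e" "v < d * e" by auto
  have "act s d e u = act s d e v \<and> pas s d e u = pas s d e v \<longleftrightarrow> u = v"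
    by (metis pr_act_pas)
  then show "kr s d d e e (1\<^sub>m d) (1\<^sub>m e) $$ (u, v) = 1\<^sub>m (d * e) $$ (u, v)"
    using uv by (auto simp: kr_def act_less pas_less)
qed (auto simp: kr_def)

lemma kr_adjoint:
  assumes "A \<in> carrier_mat d' d" "B \<in> carrier_mat e' e"
  shows "mat_adjoint (kr s d d' e e' A B) = kr s d' d e' e (mat_adjoint A) (mat_adjoint B)"
proof (rule eq_matI)
  fix u v assume "u < dim_row (kr s d' d e' e (mat_adjoint A) (mat_adjoint B))"
    "v < dim_col (kr s d' d e' e (mat_adjoint A) (mat_adjoint B))"
  then have uv: "u < d * e" "v < d' * e'" by (auto simp: kr_def)
  then show "mat_adjoint (kr s d d' e e' A B) $$ (u, v) = kr s d' d e' e (mat_adjoint A) (mat_adjoint B) $$ (u, v)"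
    using assms by (subst index_mat_adjoint) (auto simp: kr_def index_mat_adjoint act_less pas_less)
qed (auto simp: kr_def)

lemma psd_kr:
  assumes A: "psd d A" and B: "psd e B"
  shows "psd (d * e) (kr s d d e e A B)"
proof -
  obtain w where w: "\<And>a b. a < d \<Longrightarrow> b < d \<Longrightarrow> A $$ (a, b) = (\<Sum>t<d. w t a * cnj (w t b))"
    using psd_gramE[OF A] by blast
  obtain w' where w': "\<And>a b. a < e \<Longrightarrow> b < e \<Longrightarrow> B $$ (a, b) = (\<Sum>t<e. w' t a * cnj (w' t b))"
    using psd_gramE[OF B] by blast
  show ?thesis
  proof (rule psd_gramI[where T = "{..<d} \<times> {..<e}" and w = "\<lambda>t u. w (fst t) (act s d e u) * w' (snd t) (pas s d e u)"])
    fix u v assume uv: "u < d * e" "v < d * e"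
    have "kr s d d e e A B $$ (u, v) =
        (\<Sum>t<d. w t (act s d e u) * cnj (w t (act s d e v))) * (\<Sum>t<e. w' t (pas s d e u) * cnj (w' t (pas s d e v)))"
      using uv by (simp add: kr_def w w' act_less pas_less)
    also have "\<dots> = (\<Sum>t\<in>{..<d} \<times> {..<e}. w (fst t) (act s d e u) * w' (snd t) (pas s d e u) *
        cnj (w (fst t) (act s d e v) * w' (snd t) (pas s d e v)))"
      unfolding sum_product sum.cartesian_product by (intro sum.cong) (auto simp: mult_ac)
    finally show "kr s d d e e A B $$ (u, v) = (\<Sum>t\<in>{..<d} \<times> {..<e}. w (fst t) (act s d e u) * w' (snd t) (pas s d e u) *
        cnj (w (fst t) (act s d e v) * w' (snd t) (pas s d e v)))" .
  qed simp
qed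

lemma joint_dims_commute: "joint_dims ds es = joint_dims es ds"
  unfolding joint_dims_def by (rule nth_equalityI) (auto simp: mult.commute)

lemma length_joint_dims: "length es = length ds \<Longrightarrow> length (joint_dims ds es) = length ds"
  by (simp add: joint_dims_def)

lemma nth_joint_dims: "length es = length ds \<Longrightarrow> j < length ds \<Longrightarrow> joint_dims ds es ! j = ds ! j * es ! j"
  by (simp add: joint_dims_def)

lemma valid_joint_dims: "valid_dims ds \<Longrightarrow> valid_dims es \<Longrightarrow> length es = length ds \<Longrightarrow> valid_dims (joint_dims ds es)"
  by (auto simp: valid_dims_def length_joint_dims nth_joint_dims)

lemma joint_dims_update:
  "length es = length ds \<Longrightarrow> j < length ds \<Longrightarrow> joint_dims (ds[j := d]) es = (joint_dims ds es)[j := d * es ! j]"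
  by (rule nth_equalityI) (auto simp: length_joint_dims nth_joint_dims nth_list_update)

definition jidx :: "bool \<Rightarrow> nat list \<Rightarrow> nat list \<Rightarrow> nat \<Rightarrow> nat \<Rightarrow> nat" where
  "jidx s ds es a c = compose (joint_dims ds es) (\<lambda>j. pr s (ds ! j) (es ! j) (digit ds j a) (digit es j c))"

definition jact :: "bool \<Rightarrow> nat list \<Rightarrow> nat list \<Rightarrow> nat \<Rightarrow> nat" where
  "jact s ds es u = compose ds (\<lambda>j. act s (ds ! j) (es ! j) (digit (joint_dims ds es) j u))"

definition jpas :: "bool \<Rightarrow> nat list \<Rightarrow> nat list \<Rightarrow> nat \<Rightarrow> nat" where
  "jpas s ds es u = compose es (\<lambda>j. pas s (ds ! j) (es ! j) (digit (joint_dims ds es) j u))"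

locale joint_system =
  fixes ds es :: "nat list"
  assumes vd: "valid_dims ds" and ve: "valid_dims es" and len: "length es = length ds"
begin

lemma vj: "valid_dims (joint_dims ds es)"
  by (rule valid_joint_dims[OF vd ve len])

lemma digit_joint_less: "j < length ds \<Longrightarrow> digit (joint_dims ds es) j u < ds ! j * es ! j"
  using digit_less[OF vj, of j] by (simp add: length_joint_dims nth_joint_dims len)

lemma jidx_less: "jidx s ds es a c < dimp (joint_dims ds es)"
  unfolding jidx_def using len
  by (intro compose_less) (auto simp: length_joint_dims nth_joint_dims digit_less[OF vd] digit_less[OF ve] pr_less)

lemma digit_jidx: "j < length ds \<Longrightarrow>
    digit (joint_dims ds es) j (jidx s ds es a c) = pr s (ds ! j) (es ! j) (digit ds j a) (digit es j c)"
  unfolding jidx_def using len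
  by (intro digit_compose) (auto simp: length_joint_dims nth_joint_dims digit_less[OF vd] digit_less[OF ve] pr_less)

lemma jact_less: "jact s ds es u < dimp ds"
  unfolding jact_def by (intro compose_less) (auto intro: act_less digit_joint_less)

lemma jpas_less: "jpas s ds es u < dimp es"
  unfolding jpas_def using len by (intro compose_less) (auto intro: pas_less digit_joint_less)

lemma digit_jact: "j < length ds \<Longrightarrow>
    digit ds j (jact s ds es u) = act s (ds ! j) (es ! j) (digit (joint_dims ds es) j u)"
  unfolding jact_def by (intro digit_compose) (auto intro: act_less digit_joint_less)

lemma digit_jpas: "j < length ds \<Longrightarrow>
    digit es j (jpas s ds es u) = pas s (ds ! j) (es ! j) (digit (joint_dims ds es) j u)"
  unfolding jpas_def using len by (intro digit_compose) (auto intro: pas_less digit_joint_less)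

lemma jact_jidx: "a < dimp ds \<Longrightarrow> jact s ds es (jidx s ds es a c) = a"
  by (rule digits_eqI[of _ ds])
    (auto simp: jact_less digit_jact digit_jidx act_pr digit_less[OF vd] digit_less[OF ve] len)

lemma jpas_jidx: "c < dimp es \<Longrightarrow> jpas s ds es (jidx s ds es a c) = c"
  by (rule digits_eqI[of _ es])
    (auto simp: jpas_less digit_jpas digit_jidx pas_pr digit_less[OF vd] digit_less[OF ve] len)

lemma jidx_jact_jpas: "u < dimp (joint_dims ds es) \<Longrightarrow> jidx s ds es (jact s ds es u) (jpas s ds es u) = u"
  by (rule digits_eqI[of _ "joint_dims ds es"])
    (auto simp: jidx_less digit_jidx digit_jact digit_jpas length_joint_dims len pr_act_pas)

lemma sum_jidx:
  fixes f :: "nat \<Rightarrow> 'a :: comm_monoid_add"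
  shows "(\<Sum>u<dimp (joint_dims ds es). f u) = (\<Sum>a<dimp ds. \<Sum>c<dimp es. f (jidx s ds es a c))"
proof -
  have "bij_betw (\<lambda>(a, c). jidx s ds es a c) ({..<dimp ds} \<times> {..<dimp es}) {..<dimp (joint_dims ds es)}"
    by (rule bij_betwI[where g = "\<lambda>u. (jact s ds es u, jpas s ds es u)"])
      (auto simp: jidx_less jact_less jpas_less jact_jidx jpas_jidx jidx_jact_jpas)
  from sum.reindex_bij_betw[OF this, of f] show ?thesis
    by (simp add: sum.cartesian_product case_prod_unfold)
qed

end

text \<open>Flipping the flag exchanges the roles of the two systems while the joint index stays the
  same; statements on the active system carry over to the other one in this way.\<close>

lemma jact_not:
  assumes "length es = length ds"
  shows "jact (\<not> s) ds es = jpas s es ds" "jpas (\<not> s) ds es = jact s es ds"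
  unfolding jact_def jpas_def by (auto simp: act_not joint_dims_commute[of es ds])

lemma jidx_not:
  assumes "length es = length ds"
  shows "jidx (\<not> s) ds es a c = jidx s es ds c a"
  unfolding jidx_def joint_dims_commute[of es ds] by (intro compose_cong) (auto simp: pr_def)

lemma joinidx_eq: "joinidx ds es a c = jidx True ds es a c"
  by (simp add: joinidx_def jidx_def pr_def)

text \<open>The tensor product of an operator of the active and an operator of the passive system,
  in a basis whose indices interleave the two systems party by party.\<close>

definition jt :: "bool \<Rightarrow> nat list \<Rightarrow> nat list \<Rightarrow> nat list \<Rightarrow> nat list \<Rightarrow> complex mat \<Rightarrow> complex mat \<Rightarrow> complex mat" where
  "jt s ds ds' es es' A B = mat (dimp (joint_dims ds' es')) (dimp (joint_dims ds es))
     (\<lambda>(u, v). A $$ (jact s ds' es' u, jact s ds es v) * B $$ (jpas s ds' es' u, jpas s ds es v))"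

lemma jt_carrier [simp]: "jt s ds ds' es es' A B \<in> carrier_mat (dimp (joint_dims ds' es')) (dimp (joint_dims ds es))"
  by (simp add: jt_def)

lemma jt_not:
  assumes "length es = length ds" "length es' = length ds'"
  shows "jt (\<not> s) ds ds' es es' A B = jt s es es' ds ds' B A"
  unfolding jt_def using assms by (simp add: jact_not joint_dims_commute[of es] joint_dims_commute[of es'] mult.commute)

lemma jt_mult:
  assumes "joint_system ds es" "joint_system ds' es'" "joint_system ds'' es''"
    and c: "A \<in> carrier_mat (dimp ds') (dimp ds)" "B \<in> carrier_mat (dimp es') (dimp es)"
      "A' \<in> carrier_mat (dimp ds'') (dimp ds')" "B' \<in> carrier_mat (dimp es'') (dimp es')"
  shows "jt s ds' ds'' es' es'' A' B' * jt s ds ds' es es' A B = jt s ds ds'' es es'' (A' * A) (B' * B)"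
proof (rule eq_matI)
  interpret j: joint_system ds es by fact
  interpret j': joint_system ds' es' by fact
  interpret j'': joint_system ds'' es'' by fact
  fix u v assume "u < dim_row (jt s ds ds'' es es'' (A' * A) (B' * B))" "v < dim_col (jt s ds ds'' es es'' (A' * A) (B' * B))"
  then have uv: "u < dimp (joint_dims ds'' es'')" "v < dimp (joint_dims ds es)" by (auto simp: jt_def)
  let ?a = "jact s ds'' es'' u" and ?b = "jpas s ds'' es'' u" and ?c = "jact s ds es v" and ?d = "jpas s ds es v"
  have "(jt s ds' ds'' es' es'' A' B' * jt s ds ds' es es' A B) $$ (u, v) =
      (\<Sum>z<dimp (joint_dims ds' es'). jt s ds' ds'' es' es'' A' B' $$ (u, z) * jt s ds ds' es es' A B $$ (z, v))"
    by (rule index_mult_sum[OF jt_carrier jt_carrier uv])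
  also have "\<dots> = (\<Sum>x<dimp ds'. \<Sum>y<dimp es'. A' $$ (?a, x) * B' $$ (?b, y) * (A $$ (x, ?c) * B $$ (y, ?d)))"
    unfolding j'.sum_jidx[of _ s] using uv
    by (intro sum.cong refl) (auto simp: jt_def j'.jidx_less j'.jact_jidx j'.jpas_jidx)
  also have "\<dots> = (\<Sum>x<dimp ds'. A' $$ (?a, x) * A $$ (x, ?c)) * (\<Sum>y<dimp es'. B' $$ (?b, y) * B $$ (y, ?d))"
    unfolding sum_product by (intro sum.cong refl) (simp add: mult_ac)
  also have "\<dots> = (A' * A) $$ (?a, ?c) * (B' * B) $$ (?b, ?d)"
    by (simp only: index_mult_sum[OF c(3,1)] index_mult_sum[OF c(4,2)] j.jact_less j.jpas_less j''.jact_less j''.jpas_less)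
  finally show "(jt s ds' ds'' es' es'' A' B' * jt s ds ds' es es' A B) $$ (u, v) = jt s ds ds'' es es'' (A' * A) (B' * B) $$ (u, v)"
    using uv by (simp add: jt_def)
qed (auto simp: jt_def)

text \<open>A tensor product may be grouped first by systems or first by parties. Product operators
  of the two systems therefore combine into product operators of the joint parties.\<close>

lemma jt_trect:
  assumes "joint_system ds es" "joint_system ds' es'" and l: "length ds' = length ds"
  shows "jt s ds ds' es es' (trect ds ds' F) (trect es es' G) =
    trect (joint_dims ds es) (joint_dims ds' es') (\<lambda>j. kr s (ds ! j) (ds' ! j) (es ! j) (es' ! j) (F j) (G j))"
  unfolding jt_def trect_def[of "joint_dims ds es"]
proof (intro cong_mat refl, clarify)
  interpret j: joint_system ds es by fact
  interpret j': joint_system ds' es' by fact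
  fix u v
  have "trect ds ds' F $$ (jact s ds' es' u, jact s ds es v) * trect es es' G $$ (jpas s ds' es' u, jpas s ds es v) =
     (\<Prod>j<length ds. F j $$ (digit ds' j (jact s ds' es' u), digit ds j (jact s ds es v)) *
        G j $$ (digit es' j (jpas s ds' es' u), digit es j (jpas s ds es v)))"
    using j.len by (simp add: index_trect j.jact_less j'.jact_less j.jpas_less j'.jpas_less prod.distrib)
  also have "\<dots> = (\<Prod>j<length (joint_dims ds es). kr s (ds ! j) (ds' ! j) (es ! j) (es' ! j) (F j) (G j) $$
      (digit (joint_dims ds' es') j u, digit (joint_dims ds es) j v))"
    using l by (intro prod.cong)
      (auto simp: length_joint_dims j.len j.digit_jact j'.digit_jact j.digit_jpas j'.digit_jpas kr_def
        j.digit_joint_less j'.digit_joint_less)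
  finally show "trect ds ds' F $$ (jact s ds' es' u, jact s ds es v) * trect es es' G $$ (jpas s ds' es' u, jpas s ds es v) =
     (\<Prod>j<length (joint_dims ds es). kr s (ds ! j) (ds' ! j) (es ! j) (es' ! j) (F j) (G j) $$
      (digit (joint_dims ds' es') j u, digit (joint_dims ds es) j v))" .
qed

lemma jt_one:
  assumes "joint_system ds es"
  shows "jt s ds ds es es (1\<^sub>m (dimp ds)) (1\<^sub>m (dimp es)) = 1\<^sub>m (dimp (joint_dims ds es))"
proof -
  interpret joint_system ds es by fact
  have "jt s ds ds es es (1\<^sub>m (dimp ds)) (1\<^sub>m (dimp es)) =
      jt s ds ds es es (trect ds ds (\<lambda>j. 1\<^sub>m (ds ! j))) (trect es es (\<lambda>j. 1\<^sub>m (es ! j)))"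
    by (simp add: trect_one vd ve)
  also have "\<dots> = trect (joint_dims ds es) (joint_dims ds es) (\<lambda>j. 1\<^sub>m (joint_dims ds es ! j))"
    unfolding jt_trect[OF assms assms refl]
    by (intro trect_cong) (auto simp: length_joint_dims nth_joint_dims len kr_one)
  finally show ?thesis by (simp add: trect_one vj)
qed

lemma jt_adjoint:
  assumes "joint_system ds es" "joint_system ds' es'"
    "A \<in> carrier_mat (dimp ds') (dimp ds)" "B \<in> carrier_mat (dimp es') (dimp es)"
  shows "mat_adjoint (jt s ds ds' es es' A B) = jt s ds' ds es' es (mat_adjoint A) (mat_adjoint B)"
proof (rule eq_matI)
  interpret j: joint_system ds es by fact
  interpret j': joint_system ds' es' by fact
  fix u v assume "u < dim_row (jt s ds' ds es' es (mat_adjoint A) (mat_adjoint B))"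
    "v < dim_col (jt s ds' ds es' es (mat_adjoint A) (mat_adjoint B))"
  then show "mat_adjoint (jt s ds ds' es es' A B) $$ (u, v) = jt s ds' ds es' es (mat_adjoint A) (mat_adjoint B) $$ (u, v)"
    using assms(3,4) by (subst index_mat_adjoint)
      (auto simp: jt_def index_mat_adjoint j.jact_less j.jpas_less j'.jact_less j'.jpas_less)
qed (auto simp: jt_def)

text \<open>Bilinearity reduces the claim to two product terms, and regrouping makes their tensor
  product a product over the joint parties.\<close>

lemma jt_gsep:
  assumes "joint_system ds es" "gsep {1} ds A" "gsep {1} es B"
  shows "gsep {1} (joint_dims ds es) (jt s ds ds es es A B)"
proof -
  interpret joint_system ds es by fact
  have add1: "jt s ds ds es es (A + A') B = jt s ds ds es es A B + jt s ds ds es es A' B"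
    if "A \<in> carrier_mat (dimp ds) (dimp ds)" "A' \<in> carrier_mat (dimp ds) (dimp ds)" for A A' B
    using that by (intro eq_matI) (auto simp: jt_def jact_less jpas_less algebra_simps)
  have add2: "jt s ds ds es es A (B + B') = jt s ds ds es es A B + jt s ds ds es es A B'"
    if "B \<in> carrier_mat (dimp es) (dimp es)" "B' \<in> carrier_mat (dimp es) (dimp es)" for A B B'
    using that by (intro eq_matI) (auto simp: jt_def jact_less jpas_less algebra_simps)
  have sm: "complex_of_real 1 \<cdot>\<^sub>m X = X" for X :: "complex mat" by (rule eq_matI) auto
  show ?thesis using assms(2)
  proof (induction rule: gsep_induct)
    case zero
    have "jt s ds ds es es (0\<^sub>m (dimp ds) (dimp ds)) B = 0\<^sub>m (dimp (joint_dims ds es)) (dimp (joint_dims ds es))"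
      by (intro eq_matI) (auto simp: jt_def jact_less)
    then show ?case by (simp add: gsep_zero vj)
  next
    case (add c F A)
    have 1: "gsep {1} (joint_dims ds es) (jt s ds ds es es (trect ds ds F) B)"
      using assms(3)
    proof (induction rule: gsep_induct)
      case zero
      have "jt s ds ds es es A (0\<^sub>m (dimp es) (dimp es)) = 0\<^sub>m (dimp (joint_dims ds es)) (dimp (joint_dims ds es))" for A
        by (intro eq_matI) (auto simp: jt_def jpas_less)
      then show ?case by (simp add: gsep_zero vj)
    next
      case (add c' G B)
      have c': "complex_of_real c' \<cdot>\<^sub>m trect es es G = trect es es G" using add(1) sm by simp
      have "gsep {1} (joint_dims ds es) (jt s ds ds es es (trect ds ds F) (trect es es G))"
        unfolding jt_trect[OF assms(1,1) refl] using \<open>\<forall>j<length ds. psd (ds ! j) (F j)\<close> add(2) len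
        by (intro gsep_trect[OF vj]) (auto simp: length_joint_dims nth_joint_dims psd_kr)
      then show ?case unfolding c' add2[OF trect_carrier gsep_carrier[OF add(3)]] using add(4) by (rule gsep_add)
    qed
    have c: "complex_of_real c \<cdot>\<^sub>m trect ds ds F = trect ds ds F" using add(1) sm by simp
    show ?case unfolding c add1[OF trect_carrier gsep_carrier[OF add(3)]] using 1 add(4) by (rule gsep_add)
  qed
qed

subsection \<open>Measurements on joint systems\<close>

lemma embed_kr:
  assumes "joint_system ds es" and j: "j < length ds" and d: "0 < d" and K: "K \<in> carrier_mat d (ds ! j)"
  shows "embed (joint_dims ds es) (joint_dims (ds[j := d]) es) j (kr s (ds ! j) d (es ! j) (es ! j) K (1\<^sub>m (es ! j))) =
    jt s ds (ds[j := d]) es es (embed ds (ds[j := d]) j K) (1\<^sub>m (dimp es))"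
proof -
  interpret joint_system ds es by fact
  interpret u: joint_system "ds[j := d]" es
    using valid_dims_update[OF vd d] ve len by unfold_locales auto
  let ?F = "\<lambda>k. if k = j then K else 1\<^sub>m (ds ! k)"
  have "embed ds (ds[j := d]) j K = trect ds (ds[j := d]) ?F" by (rule embed_eq_trect[OF vd j d K])
  moreover have "1\<^sub>m (dimp es) = trect es es (\<lambda>k. 1\<^sub>m (es ! k))" by (simp add: trect_one ve)
  ultimately have "jt s ds (ds[j := d]) es es (embed ds (ds[j := d]) j K) (1\<^sub>m (dimp es)) =
      trect (joint_dims ds es) (joint_dims (ds[j := d]) es)
        (\<lambda>k. kr s (ds ! k) (ds[j := d] ! k) (es ! k) (es ! k) (?F k) (1\<^sub>m (es ! k)))"
    using jt_trect[OF joint_system_axioms u.joint_system_axioms] by simp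
  also have "\<dots> = trect (joint_dims ds es) (joint_dims (ds[j := d]) es)
        (\<lambda>k. if k = j then kr s (ds ! j) d (es ! j) (es ! j) K (1\<^sub>m (es ! j)) else 1\<^sub>m (joint_dims ds es ! k))"
    using j by (intro trect_cong) (auto simp: length_joint_dims nth_joint_dims len kr_one)
  also have "\<dots> = embed (joint_dims ds es) (joint_dims (ds[j := d]) es) j (kr s (ds ! j) d (es ! j) (es ! j) K (1\<^sub>m (es ! j)))"
    unfolding joint_dims_update[OF len j] using j d ve len
    by (intro embed_eq_trect[OF vj, symmetric]) (auto simp: length_joint_dims nth_joint_dims valid_dims_def)
  finally show ?thesis by simp
qed

definition lift_local :: "bool \<Rightarrow> nat \<Rightarrow> nat \<Rightarrow> (nat \<times> complex mat list) list \<Rightarrow> (nat \<times> complex mat list) list" where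
  "lift_local s d e I = map (\<lambda>x. (fst x * e, map (\<lambda>K. kr s d (fst x) e e K (1\<^sub>m e)) (snd x))) I"

lemma local_instrument_lift:
  assumes I: "local_instrument d I" and e: "0 < e"
  shows "local_instrument (d * e) (lift_local s d e I)"
proof -
  have "(\<Sum>x\<leftarrow>lift_local s d e I. \<Sum>K\<leftarrow>snd x. (mat_adjoint K * K) $$ (u, v)) = 1\<^sub>m (d * e) $$ (u, v)"
    if uv: "u < d * e" "v < d * e" for u v
  proof -
    let ?a = "act s d e u" and ?b = "act s d e v" and ?c = "1\<^sub>m e $$ (pas s d e u, pas s d e v) :: complex"
    have "(\<Sum>x\<leftarrow>lift_local s d e I. \<Sum>K\<leftarrow>snd x. (mat_adjoint K * K) $$ (u, v)) =
        (\<Sum>x\<leftarrow>I. \<Sum>K\<leftarrow>snd x. (mat_adjoint K * K) $$ (?a, ?b) * ?c)"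
      unfolding lift_local_def map_map comp_def snd_conv
    proof (intro arg_cong[where f = sum_list] map_cong refl)
      fix x K assume "x \<in> set I" "K \<in> set (snd x)"
      then have K: "K \<in> carrier_mat (fst x) d" using local_instrumentD[OF I] by auto
      show "(mat_adjoint (kr s d (fst x) e e K (1\<^sub>m e)) * kr s d (fst x) e e K (1\<^sub>m e)) $$ (u, v) =
          (mat_adjoint K * K) $$ (?a, ?b) * ?c"
        unfolding kr_adjoint[OF K one_carrier_mat]
        using uv K by (subst kr_mult) (auto simp: kr_def)
    qed
    also have "\<dots> = (\<Sum>x\<leftarrow>I. \<Sum>K\<leftarrow>snd x. (mat_adjoint K * K) $$ (?a, ?b)) * ?c"
      by (simp only: sum_list_mult_const)
    also have "(\<Sum>x\<leftarrow>I. \<Sum>K\<leftarrow>snd x. (mat_adjoint K * K) $$ (?a, ?b)) = 1\<^sub>m d $$ (?a, ?b)"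
    proof -
      have "mat d d (\<lambda>ab. \<Sum>x\<leftarrow>I. \<Sum>K\<leftarrow>snd x. (mat_adjoint K * K) $$ ab) $$ (?a, ?b) = 1\<^sub>m d $$ (?a, ?b)"
        using I by (simp add: local_instrument_def)
      then show ?thesis using uv by (simp add: act_less)
    qed
    also have "1\<^sub>m d $$ (?a, ?b) * ?c = 1\<^sub>m (d * e) $$ (u, v)"
      using kr_one[of s d e, symmetric] uv by (simp add: kr_def)
    finally show ?thesis .
  qed
  then have "mat (d * e) (d * e) (\<lambda>ab. \<Sum>x\<leftarrow>lift_local s d e I. \<Sum>K\<leftarrow>snd x. (mat_adjoint K * K) $$ ab) = 1\<^sub>m (d * e)"
    by (intro eq_matI) auto
  then show ?thesis using I e unfolding local_instrument_def by (auto simp: lift_local_def)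
qed

definition lift_instr :: "bool \<Rightarrow> nat list \<Rightarrow> nat list \<Rightarrow> (nat list \<times> complex mat list) list \<Rightarrow> (nat list \<times> complex mat list) list" where
  "lift_instr s ds es L = map (\<lambda>q. (joint_dims (fst q) es, map (\<lambda>K. jt s ds (fst q) es es K (1\<^sub>m (dimp es))) (snd q))) L"

text \<open>Each local instrument is tensored with the identity on the passive system of the acting
  party, and the tree of the protocol keeps its shape. The active dimensions vary in the induction,
  \<open>es\<close> stays fixed.\<close>

lemma locc_instr_lift:
  assumes "locc_instr ds L" "valid_dims es"
  shows "length es = length ds \<Longrightarrow> locc_instr (joint_dims ds es) (lift_instr s ds es L)"
  using assms(1)
proof (induction rule: locc_instr.induct)
  case (idI ds)
  then interpret joint_system ds es using assms(2) by unfold_locales auto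
  show ?case using locc_instr.idI[OF vj] by (simp add: lift_instr_def jt_one[OF joint_system_axioms])
next
  case (stepI ds j I L)
  interpret joint_system ds es using stepI assms(2) by unfold_locales auto
  let ?J = "joint_dims ds es" and ?e = "es ! j"
  let ?I = "lift_local s (ds ! j) ?e I"
  let ?d = "\<lambda>x. ds[j := fst (I ! x)]"
  note j = stepI(2)
  have e: "0 < ?e" using ve j len by (simp add: valid_dims_def)
  have Ix: "?I ! x = (fst (I ! x) * ?e, map (\<lambda>K. kr s (ds ! j) (fst (I ! x)) ?e ?e K (1\<^sub>m ?e)) (snd (I ! x)))"
    if "x < length I" for x using that by (simp add: lift_local_def)
  have lenI: "length ?I = length I" by (simp add: lift_local_def)
  have Jx: "?J[j := fst (?I ! x)] = joint_dims (?d x) es" if "x < length I" for x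
    using Ix[OF that] joint_dims_update[OF len j] by simp
  have I': "local_instrument (?J ! j) ?I"
    using local_instrument_lift[OF stepI(3) e] j len by (simp add: nth_joint_dims)
  have "\<forall>x<length ?I. locc_instr (?J[j := fst (?I ! x)]) (lift_instr s (?d x) es (L x))"
    using stepI(4) len Jx by (simp add: lenI)
  from locc_instr.stepI[OF vj _ I' this] j
  have "locc_instr ?J (concat (map (\<lambda>x. map (\<lambda>q. (fst q,
        [K * embed ?J (?J[j := fst (?I ! x)]) j Kl. K \<leftarrow> snd q, Kl \<leftarrow> snd (?I ! x)])) (lift_instr s (?d x) es (L x)))
      [0..<length ?I]))" by (simp add: length_joint_dims len)
  also have "concat (map (\<lambda>x. map (\<lambda>q. (fst q,
        [K * embed ?J (?J[j := fst (?I ! x)]) j Kl. K \<leftarrow> snd q, Kl \<leftarrow> snd (?I ! x)])) (lift_instr s (?d x) es (L x)))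
      [0..<length ?I]) =
    concat (map (\<lambda>x. map (\<lambda>q. (joint_dims (fst q) es, map (\<lambda>K. jt s ds (fst q) es es K (1\<^sub>m (dimp es)))
      [K * embed ds (?d x) j Kl. K \<leftarrow> snd q, Kl \<leftarrow> snd (I ! x)])) (L x)) [0..<length I])"
    unfolding lenI
  proof (rule arg_cong[where f = concat], rule map_cong[OF refl])
    fix x assume "x \<in> set [0..<length I]"
    then have x: "x < length I" by simp
    have Kl: "0 < fst (I ! x)" "\<And>Kl. Kl \<in> set (snd (I ! x)) \<Longrightarrow> Kl \<in> carrier_mat (fst (I ! x)) (ds ! j)"
      using local_instrumentD[OF stepI(3), of "I ! x"] x by auto
    interpret u: joint_system "?d x" es
      using valid_dims_update[OF vd Kl(1)] ve len by unfold_locales auto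
    have key: "jt s (?d x) (fst q) es es K (1\<^sub>m (dimp es)) *
        embed ?J (joint_dims (?d x) es) j (kr s (ds ! j) (fst (I ! x)) ?e ?e Kl (1\<^sub>m ?e)) =
        jt s ds (fst q) es es (K * embed ds (?d x) j Kl) (1\<^sub>m (dimp es))"
      if q: "q \<in> set (L x)" and K: "K \<in> set (snd q)" and l: "Kl \<in> set (snd (I ! x))" for q K Kl
    proof -
      have lq: "locc_instr (?d x) (L x)" using stepI(4) x by auto
      have vq: "valid_dims (fst q)" "length (fst q) = length ds" and Kc: "K \<in> carrier_mat (dimp (fst q)) (dimp (?d x))"
        using locc_instr_kraus[OF lq] q K by (auto intro: locop_carrier)
      interpret v: joint_system "fst q" es using vq ve len by unfold_locales auto
      have "jt s (?d x) (fst q) es es K (1\<^sub>m (dimp es)) * jt s ds (?d x) es es (embed ds (?d x) j Kl) (1\<^sub>m (dimp es)) =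
          jt s ds (fst q) es es (K * embed ds (?d x) j Kl) (1\<^sub>m (dimp es) * 1\<^sub>m (dimp es))"
        by (rule jt_mult[OF joint_system_axioms u.joint_system_axioms v.joint_system_axioms])
          (use Kc in \<open>auto simp: embed_def\<close>)
      then show ?thesis
        using embed_kr[OF joint_system_axioms j Kl(1) Kl(2)[OF l]] by simp
    qed
    show "map (\<lambda>q. (fst q, [K * embed ?J (?J[j := fst (?I ! x)]) j Kl. K \<leftarrow> snd q, Kl \<leftarrow> snd (?I ! x)])) (lift_instr s (?d x) es (L x)) =
      map (\<lambda>q. (joint_dims (fst q) es, map (\<lambda>K. jt s ds (fst q) es es K (1\<^sub>m (dimp es)))
        [K * embed ds (?d x) j Kl. K \<leftarrow> snd q, Kl \<leftarrow> snd (I ! x)])) (L x)"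
      unfolding Jx[OF x] by (simp add: Ix[OF x] lift_instr_def map_concat comp_def key cong: map_cong)
  qed
  finally show ?case unfolding lift_instr_def map_concat map_map comp_def fst_conv snd_conv .
next
  case (mergeI ds L1 ds' K1 L2 K2 L3)
  then have "locc_instr (joint_dims ds es) (lift_instr s ds es (L1 @ [(ds', K1)] @ L2 @ [(ds', K2)] @ L3))" by simp
  then show ?case
    using locc_instr.mergeI[of "joint_dims ds es" "lift_instr s ds es L1" "joint_dims ds' es" _ "lift_instr s ds es L2"
        _ "lift_instr s ds es L3"]
    by (simp add: lift_instr_def)
qed

lemma jt_lsum_left:
  assumes "joint_system ds es" "\<forall>A\<in>set As. A \<in> carrier_mat (dimp ds) (dimp ds)"
  shows "jt s ds ds es es (lsum (dimp ds) As) B = lsum (dimp (joint_dims ds es)) (map (\<lambda>A. jt s ds ds es es A B) As)"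
proof (rule eq_matI)
  interpret joint_system ds es by fact
  fix u v assume "u < dim_row (lsum (dimp (joint_dims ds es)) (map (\<lambda>A. jt s ds ds es es A B) As))"
    "v < dim_col (lsum (dimp (joint_dims ds es)) (map (\<lambda>A. jt s ds ds es es A B) As))"
  then have uv: "u < dimp (joint_dims ds es)" "v < dimp (joint_dims ds es)" by auto
  show "jt s ds ds es es (lsum (dimp ds) As) B $$ (u, v) =
      lsum (dimp (joint_dims ds es)) (map (\<lambda>A. jt s ds ds es es A B) As) $$ (u, v)"
    using uv by (simp add: jt_def index_lsum jact_less comp_def sum_list_mult_const)
qed (auto simp: jt_def)

lemma jt_lsum_right:
  assumes "joint_system ds es" "\<forall>B\<in>set Bs. B \<in> carrier_mat (dimp es) (dimp es)"
  shows "jt s ds ds es es A (lsum (dimp es) Bs) = lsum (dimp (joint_dims ds es)) (map (jt s ds ds es es A) Bs)"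
proof (rule eq_matI)
  interpret joint_system ds es by fact
  fix u v assume "u < dim_row (lsum (dimp (joint_dims ds es)) (map (jt s ds ds es es A) Bs))"
    "v < dim_col (lsum (dimp (joint_dims ds es)) (map (jt s ds ds es es A) Bs))"
  then have uv: "u < dimp (joint_dims ds es)" "v < dimp (joint_dims ds es)" by auto
  show "jt s ds ds es es A (lsum (dimp es) Bs) $$ (u, v) =
      lsum (dimp (joint_dims ds es)) (map (jt s ds ds es es A) Bs) $$ (u, v)"
    using uv by (simp add: jt_def index_lsum jpas_less comp_def sum_list_const_mult)
qed (auto simp: jt_def)

lemma pull_lift:
  assumes "joint_system ds es" "joint_system d es" "\<forall>K\<in>set Ks. K \<in> carrier_mat (dimp d) (dimp ds)"
    and A: "A \<in> carrier_mat (dimp d) (dimp d)" and B: "B \<in> carrier_mat (dimp es) (dimp es)"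
  shows "pull (dimp (joint_dims ds es)) (map (\<lambda>K. jt s ds d es es K (1\<^sub>m (dimp es))) Ks) (jt s d d es es A B) =
    jt s ds ds es es (pull (dimp ds) Ks A) B"
proof -
  have "pull (dimp (joint_dims ds es)) (map (\<lambda>K. jt s ds d es es K (1\<^sub>m (dimp es))) Ks) (jt s d d es es A B) =
      lsum (dimp (joint_dims ds es)) (map (\<lambda>K. jt s ds ds es es (mat_adjoint K * A * K) B) Ks)"
    unfolding pull_def map_map comp_def
  proof (intro arg_cong[where f = "lsum _"] map_cong refl)
    fix K assume "K \<in> set Ks"
    then have K: "K \<in> carrier_mat (dimp d) (dimp ds)" using assms(3) by auto
    then have K': "mat_adjoint K \<in> carrier_mat (dimp ds) (dimp d)" by simp
    have "mat_adjoint (jt s ds d es es K (1\<^sub>m (dimp es))) * jt s d d es es A B = jt s d ds es es (mat_adjoint K * A) (1\<^sub>m (dimp es) * B)"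
      using jt_mult[OF assms(2,2,1) A B K' one_carrier_mat] jt_adjoint[OF assms(1,2) K one_carrier_mat] by simp
    moreover have "jt s d ds es es (mat_adjoint K * A) (1\<^sub>m (dimp es) * B) * jt s ds d es es K (1\<^sub>m (dimp es)) =
        jt s ds ds es es (mat_adjoint K * A * K) (1\<^sub>m (dimp es) * B * 1\<^sub>m (dimp es))"
      using K K' A B by (intro jt_mult[OF assms(1,2,1)]) (auto intro: mult_carrier_mat)
    ultimately show "mat_adjoint (jt s ds d es es K (1\<^sub>m (dimp es))) * jt s d d es es A B * jt s ds d es es K (1\<^sub>m (dimp es)) =
        jt s ds ds es es (mat_adjoint K * A * K) B" using B by simp
  qed
  also have "\<dots> = jt s ds ds es es (pull (dimp ds) Ks A) B"
    unfolding pull_def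
    by (subst jt_lsum_left[OF assms(1)]) (use assms(3) A in \<open>auto simp: comp_def intro!: mult_carrier_mat[of _ _ "dimp d"]\<close>)
  finally show ?thesis .
qed

lemma locc_povm_lift:
  assumes "joint_system ds es" and Ms: "locc_povm ds Ms"
  shows "locc_povm (joint_dims ds es) (map (\<lambda>M. jt s ds ds es es M (1\<^sub>m (dimp es))) Ms)"
proof -
  interpret joint_system ds es by fact
  obtain L where L: "locc_instr ds L" "Ms = povm_of_instr ds L" using Ms by (auto simp: locc_povm_def)
  note L' = locc_instr_lift[OF L(1) ve len, of s]
  have "povm_of_instr (joint_dims ds es) (lift_instr s ds es L) = map (\<lambda>M. jt s ds ds es es M (1\<^sub>m (dimp es))) Ms"
    unfolding povm_of_instr_dpovm[OF L'] L(2) povm_of_instr_dpovm[OF L(1)]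
    unfolding dpovm_def lift_instr_def map_map comp_def fst_conv snd_conv
  proof (intro map_cong refl)
    fix q assume q: "q \<in> set L"
    have vq: "valid_dims (fst q)" "length (fst q) = length ds" and Kc: "\<forall>K\<in>set (snd q). K \<in> carrier_mat (dimp (fst q)) (dimp ds)"
      using locc_instr_kraus[OF L(1)] q by (auto intro: locop_carrier)
    interpret v: joint_system "fst q" es using vq ve len by unfold_locales auto
    show "pull (dimp (joint_dims ds es)) (map (\<lambda>K. jt s ds (fst q) es es K (1\<^sub>m (dimp es))) (snd q))
        (1\<^sub>m (dimp (joint_dims (fst q) es))) = jt s ds ds es es (pull (dimp ds) (snd q) (1\<^sub>m (dimp (fst q)))) (1\<^sub>m (dimp es))"
      using pull_lift[OF joint_system_axioms v.joint_system_axioms Kc one_carrier_mat one_carrier_mat]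
      by (simp add: jt_one[OF v.joint_system_axioms])
  qed
  then show ?thesis using L' unfolding locc_povm_def by metis
qed

definition joint_povm :: "nat list \<Rightarrow> nat list \<Rightarrow> complex mat list \<Rightarrow> (nat \<Rightarrow> complex mat list) \<Rightarrow> complex mat list" where
  "joint_povm ds es Ms Ns = concat (map (\<lambda>i. map (jt True ds ds es es (Ms ! i)) (Ns i)) [0..<length Ms])"

text \<open>A protocol on the active system, followed after outcome \<open>i\<close> by
  \<open>Ns i\<close> on the passive one. The second stage must be a measurement of the whole
  remaining system, whose first half has dimensions \<open>fst (L ! i)\<close>: it is
  \<open>Ns i\<close> tensored with the identity there, obtained from lifting with the flag
  flipped.\<close>

lemma locc_povm_joint:
  assumes "joint_system ds es" and Ms: "locc_povm ds Ms" and Ns: "\<forall>i<length Ms. locc_povm es (Ns i)"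
  shows "locc_povm (joint_dims ds es) (joint_povm ds es Ms Ns)"
proof -
  interpret joint_system ds es by fact
  obtain L where L: "locc_instr ds L" "Ms = povm_of_instr ds L" using Ms by (auto simp: locc_povm_def)
  have lenM: "length Ms = length L" by (simp add: L(2) povm_of_instr_def)
  let ?L = "lift_instr True ds es L"
  let ?N = "\<lambda>i. map (jt True (fst (L ! i)) (fst (L ! i)) es es (1\<^sub>m (dimp (fst (L ! i))))) (Ns i)"
  have js: "joint_system (fst (L ! i)) es" and Kc: "\<forall>K\<in>set (snd (L ! i)). K \<in> carrier_mat (dimp (fst (L ! i))) (dimp ds)"
    if "i < length L" for i
    using locc_instr_kraus[OF L(1)] that ve len by (auto simp: joint_system_def intro: locop_carrier)
  have N: "locc_povm (fst (?L ! i)) (?N i)" if i: "i < length ?L" for i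
  proof -
    have i': "i < length L" using i by (simp add: lift_instr_def)
    interpret v: joint_system "fst (L ! i)" es using js[OF i'] .
    have "joint_system es (fst (L ! i))" using v.vd v.ve v.len by unfold_locales auto
    moreover have "locc_povm es (Ns i)" using Ns i' lenM by simp
    ultimately have "locc_povm (joint_dims es (fst (L ! i)))
        (map (\<lambda>M. jt (\<not> True) es es (fst (L ! i)) (fst (L ! i)) M (1\<^sub>m (dimp (fst (L ! i))))) (Ns i))"
      by (rule locc_povm_lift)
    then show ?thesis using i' v.len
      by (simp add: jt_not[of _ _ _ _ True, simplified] joint_dims_commute[of es] lift_instr_def)
  qed
  then have "locc_povm (joint_dims ds es) (seq_povm (joint_dims ds es) ?L ?N)"
    by (intro locc_povm_seq locc_instr_lift[OF L(1) ve len]) auto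
  also have "seq_povm (joint_dims ds es) ?L ?N = joint_povm ds es Ms Ns"
    unfolding seq_povm_def joint_povm_def lenM
  proof -
    have "map (\<lambda>i. map (pull (dimp (joint_dims ds es)) (snd (?L ! i))) (?N i)) [0..<length L] =
        map (\<lambda>i. map (jt True ds ds es es (Ms ! i)) (Ns i)) [0..<length L]"
    proof (unfold map_map comp_def, intro map_cong refl)
      fix i N assume "i \<in> set [0..<length L]" and N: "N \<in> set (Ns i)"
      then have i: "i < length L" by simp
      have "valid_dims es" by (rule ve)
      then have Nc: "N \<in> carrier_mat (dimp es) (dimp es)"
        using Ns N i lenM locc_povm_sep_povm[OF ve, of "Ns i"] sep_povm_iff[OF ve, of "Ns i"] by (auto intro: gsep_carrier)
      have Mi: "Ms ! i = pull (dimp ds) (snd (L ! i)) (1\<^sub>m (dimp (fst (L ! i))))"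
        unfolding L(2) povm_of_instr_dpovm[OF L(1)] using i by (simp add: dpovm_def)
      show "pull (dimp (joint_dims ds es)) (snd (?L ! i)) (jt True (fst (L ! i)) (fst (L ! i)) es es (1\<^sub>m (dimp (fst (L ! i)))) N) =
          jt True ds ds es es (Ms ! i) N"
        unfolding Mi pull_lift[OF joint_system_axioms js[OF i] Kc[OF i] one_carrier_mat Nc, of True, symmetric]
        using i by (simp add: lift_instr_def)
    qed
    moreover have "length ?L = length L" by (simp add: lift_instr_def)
    ultimately show "concat (map (\<lambda>i. map (pull (dimp (joint_dims ds es)) (snd (?L ! i))) (?N i)) [0..<length ?L]) =
        concat (map (\<lambda>i. map (jt True ds ds es es (Ms ! i)) (Ns i)) [0..<length L])"
      by (simp only:)
  qed
  finally show ?thesis .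
qed

lemma sep_povm_joint:
  assumes "joint_system ds es" and Ms: "sep_povm ds Ms" and Ns: "\<forall>i<length Ms. sep_povm es (Ns i)"
  shows "sep_povm (joint_dims ds es) (joint_povm ds es Ms Ns)"
proof -
  interpret joint_system ds es by fact
  have Ms': "\<And>M. M \<in> set Ms \<Longrightarrow> gsep {1} ds M" "lsum (dimp ds) Ms = 1\<^sub>m (dimp ds)"
    using Ms by (auto simp: sep_povm_iff[OF vd])
  have Ns': "\<And>N. N \<in> set (Ns i) \<Longrightarrow> gsep {1} es N" "lsum (dimp es) (Ns i) = 1\<^sub>m (dimp es)" if "i < length Ms" for i
    using Ns that by (auto simp: sep_povm_iff[OF ve])
  have "lsum (dimp (joint_dims ds es)) (joint_povm ds es Ms Ns) =
      lsum (dimp (joint_dims ds es)) (map (\<lambda>i. lsum (dimp (joint_dims ds es)) (map (jt True ds ds es es (Ms ! i)) (Ns i))) [0..<length Ms])"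
    by (simp add: joint_povm_def lsum_concat comp_def)
  also have "\<dots> = lsum (dimp (joint_dims ds es)) (map (\<lambda>i. jt True ds ds es es (Ms ! i) (1\<^sub>m (dimp es))) [0..<length Ms])"
  proof (intro arg_cong[where f = "lsum _"] map_cong refl)
    fix i assume "i \<in> set [0..<length Ms]"
    then have i: "i < length Ms" by simp
    have "\<forall>B\<in>set (Ns i). B \<in> carrier_mat (dimp es) (dimp es)" using Ns'(1)[OF i] by (auto intro: gsep_carrier)
    from jt_lsum_right[OF joint_system_axioms this, of True "Ms ! i"]
    show "lsum (dimp (joint_dims ds es)) (map (jt True ds ds es es (Ms ! i)) (Ns i)) = jt True ds ds es es (Ms ! i) (1\<^sub>m (dimp es))"
      by (simp add: Ns'(2)[OF i])
  qed
  also have "\<dots> = lsum (dimp (joint_dims ds es)) (map (\<lambda>M. jt True ds ds es es M (1\<^sub>m (dimp es))) (map (\<lambda>i. Ms ! i) [0..<length Ms]))"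
    by (simp add: comp_def)
  also have "\<dots> = jt True ds ds es es (lsum (dimp ds) Ms) (1\<^sub>m (dimp es))"
    unfolding map_nth using Ms'(1) by (intro jt_lsum_left[OF joint_system_axioms, symmetric]) (auto intro: gsep_carrier)
  also have "\<dots> = 1\<^sub>m (dimp (joint_dims ds es))"
    by (simp add: Ms'(2) jt_one[OF joint_system_axioms])
  finally show ?thesis unfolding sep_povm_iff[OF vj]
    by (auto simp: joint_povm_def intro!: jt_gsep[OF joint_system_axioms] Ms'(1) Ns'(1))
qed

subsection \<open>Partial contraction of a joint state with an effect\<close>

text \<open>The partial trace of (M tensor 1) \<sigma> over the active system, that is, the
  unnormalised state of the passive system after the effect \<open>M\<close>.\<close>

definition ctr :: "bool \<Rightarrow> nat list \<Rightarrow> nat list \<Rightarrow> complex mat \<Rightarrow> complex mat \<Rightarrow> complex mat" where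
  "ctr s ds es M \<sigma> = mat (dimp es) (dimp es) (\<lambda>(c, c'). \<Sum>a<dimp ds. \<Sum>b<dimp ds.
     M $$ (b, a) * \<sigma> $$ (jidx s ds es a c, jidx s ds es b c'))"

lemma ctr_carrier [simp]: "ctr s ds es M \<sigma> \<in> carrier_mat (dimp es) (dimp es)"
  by (simp add: ctr_def)

lemma ctrace_ctr:
  assumes "joint_system ds es" and N: "N \<in> carrier_mat (dimp es) (dimp es)"
    and \<sigma>: "\<sigma> \<in> carrier_mat (dimp (joint_dims ds es)) (dimp (joint_dims ds es))"
  shows "ctrace (N * ctr s ds es M \<sigma>) = ctrace (jt s ds ds es es M N * \<sigma>)"
proof -
  interpret joint_system ds es by fact
  let ?D = "dimp ds" and ?E = "dimp es" and ?x = "jidx s ds es"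
  let ?f = "\<lambda>a c b c'. M $$ (a, b) * N $$ (c, c') * \<sigma> $$ (?x b c', ?x a c)"
  have "ctrace (jt s ds ds es es M N * \<sigma>) = (\<Sum>a<?D. \<Sum>c<?E. \<Sum>b<?D. \<Sum>c'<?E. ?f a c b c')"
    unfolding ctrace_mult[OF jt_carrier \<sigma>] sum_jidx[of _ s]
    by (intro sum.cong refl) (simp add: jt_def jidx_less jact_jidx jpas_jidx)
  also have "\<dots> = (\<Sum>c<?E. \<Sum>a<?D. \<Sum>b<?D. \<Sum>c'<?E. ?f a c b c')" by (rule sum.swap)
  also have "\<dots> = (\<Sum>c<?E. \<Sum>c'<?E. \<Sum>a<?D. \<Sum>b<?D. ?f a c b c')"
    by (rule sum.cong[OF refl]) (rule sum_swap3)
  also have "\<dots> = (\<Sum>c<?E. \<Sum>c'<?E. \<Sum>b<?D. \<Sum>a<?D. ?f a c b c')"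
    by (rule sum.cong[OF refl], rule sum.cong[OF refl]) (rule sum.swap)
  also have "\<dots> = ctrace (N * ctr s ds es M \<sigma>)"
    unfolding ctrace_mult[OF N ctr_carrier]
    by (intro sum.cong refl) (simp add: ctr_def sum_distrib_left mult_ac)
  finally show ?thesis by simp
qed

text \<open>For an effect |w><w| with a product vector w, contraction is conjugation by <w| tensor
  1, a product operator from the joint to the passive system. A separable effect is a sum of such
  effects, and cones are closed under sums.\<close>

lemma (in local_cone) cone_ctr:
  assumes "joint_system ds es" and M: "gsep {1} ds M" and \<sigma>: "C (joint_dims ds es) \<sigma>"
  shows "C es (ctr s ds es M \<sigma>)"
proof -
  interpret j: joint_system ds es by fact
  let ?J = "joint_dims ds es" and ?x = "jidx s ds es"
  obtain T :: "(nat \<times> (nat \<Rightarrow> nat)) set" and w where T: "finite T"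
    and w: "\<And>a b. a < dimp ds \<Longrightarrow> b < dimp ds \<Longrightarrow> M $$ (a, b) =
      (\<Sum>t\<in>T. (\<Prod>j<length ds. w t j (digit ds j a)) * cnj (\<Prod>j<length ds. w t j (digit ds j b)))"
    using gsep_gramE[OF M] by blast
  define \<omega> where "\<omega> t a = (\<Prod>j<length ds. w t j (digit ds j a))" for t a
  \<comment> \<open>The factor of party \<open>j\<close>: the bra of its part of the vector on the
    active system and the identity on the passive one.\<close>
  define K where "K t j = mat (es ! j) (ds ! j * es ! j) (\<lambda>(c, z).
      cnj (w t j (act s (ds ! j) (es ! j) z)) * (if c = pas s (ds ! j) (es ! j) z then 1 else 0))" for t j
  have lo: "local_ops ?J es (K t)" for t
    unfolding local_ops_def using j.vj j.ve j.len by (auto simp: length_joint_dims nth_joint_dims K_def)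
  have E: "trect ?J es (K t) $$ (c, ?x a y) = cnj (\<omega> t a) * (if c = y then 1 else 0)"
    if "a < dimp ds" "y < dimp es" "c < dimp es" for t a c y
  proof -
    have "trect ?J es (K t) $$ (c, ?x a y) =
        (\<Prod>j<length ds. cnj (w t j (digit ds j a)) * (if digit es j c = digit es j y then 1 else 0))"
      unfolding index_trect[OF that(3) j.jidx_less] length_joint_dims[OF j.len]
      using j.len digit_less[OF j.ve] digit_less[OF j.vd]
      by (intro prod.cong refl) (simp add: K_def j.digit_jidx act_pr pas_pr pr_less)
    then show ?thesis using prod_digit_delta[OF that(3,2), where 'a = complex] j.len
      by (simp only: prod.distrib \<omega>_def cnj_prod)
  qed
  let ?E = "\<lambda>t. trect ?J es (K t)"
  have \<sigma>c: "\<sigma> \<in> carrier_mat (dimp ?J) (dimp ?J)" using \<sigma> by (rule cone_carrier)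
  have "ctr s ds es M \<sigma> = mat (dimp es) (dimp es) (\<lambda>ab. \<Sum>t\<in>T. (?E t * \<sigma> * mat_adjoint (?E t)) $$ ab)"
  proof (rule eq_matI)
    fix c c' assume "c < dim_row (mat (dimp es) (dimp es) (\<lambda>ab. \<Sum>t\<in>T. (?E t * \<sigma> * mat_adjoint (?E t)) $$ ab))"
      "c' < dim_col (mat (dimp es) (dimp es) (\<lambda>ab. \<Sum>t\<in>T. (?E t * \<sigma> * mat_adjoint (?E t)) $$ ab))"
    then have c: "c < dimp es" "c' < dimp es" by auto
    have delta: "(\<Sum>y<dimp es. f y * (if z = y then 1 else 0)) = f z" if "z < dimp es" for z and f :: "nat \<Rightarrow> complex"
      using that by (simp add: if_distrib[of "\<lambda>x. _ * x"] cong: if_cong)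
    have "(?E t * \<sigma> * mat_adjoint (?E t)) $$ (c, c') =
        (\<Sum>a<dimp ds. \<Sum>b<dimp ds. \<omega> t b * cnj (\<omega> t a) * \<sigma> $$ (?x a c, ?x b c'))" for t
    proof -
      have "(?E t * \<sigma> * mat_adjoint (?E t)) $$ (c, c') =
          (\<Sum>u<dimp ?J. \<Sum>v<dimp ?J. ?E t $$ (c, u) * \<sigma> $$ (u, v) * cnj (?E t $$ (c', v)))"
        by (rule index_conj_sum[OF trect_carrier \<sigma>c c])
      also have "\<dots> = (\<Sum>a<dimp ds. \<Sum>y<dimp es. \<Sum>b<dimp ds. \<Sum>z<dimp es.
          (\<omega> t b * cnj (\<omega> t a) * \<sigma> $$ (?x a y, ?x b z) * (if c = y then 1 else 0)) * (if c' = z then 1 else 0))"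
        unfolding j.sum_jidx[of _ s] by (intro sum.cong refl) (simp add: E c)
      also have "\<dots> = (\<Sum>a<dimp ds. \<Sum>y<dimp es. (\<Sum>b<dimp ds. \<omega> t b * cnj (\<omega> t a) * \<sigma> $$ (?x a y, ?x b c')) * (if c = y then 1 else 0))"
        unfolding delta[OF c(2)] sum_distrib_right ..
      also have "\<dots> = (\<Sum>a<dimp ds. \<Sum>b<dimp ds. \<omega> t b * cnj (\<omega> t a) * \<sigma> $$ (?x a c, ?x b c'))"
        unfolding delta[OF c(1)] ..
      finally show ?thesis .
    qed
    then have "(\<Sum>t\<in>T. (?E t * \<sigma> * mat_adjoint (?E t)) $$ (c, c')) =
        (\<Sum>t\<in>T. \<Sum>a<dimp ds. \<Sum>b<dimp ds. \<omega> t b * cnj (\<omega> t a) * \<sigma> $$ (?x a c, ?x b c'))"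
      by (simp only:)
    also have "\<dots> = (\<Sum>a<dimp ds. \<Sum>b<dimp ds. \<Sum>t\<in>T. \<omega> t b * cnj (\<omega> t a) * \<sigma> $$ (?x a c, ?x b c'))"
      by (rule sum_swap3[symmetric])
    also have "\<dots> = ctr s ds es M \<sigma> $$ (c, c')"
      using c by (simp add: ctr_def w \<omega>_def sum_distrib_right)
    finally show "ctr s ds es M \<sigma> $$ (c, c') =
        mat (dimp es) (dimp es) (\<lambda>ab. \<Sum>t\<in>T. (?E t * \<sigma> * mat_adjoint (?E t)) $$ ab) $$ (c, c')"
      using c by simp
  qed (auto simp: ctr_def)
  also have "C es \<dots>" using T j.ve \<sigma> by (intro cone_sum cone_conj[OF lo]) auto
  finally show ?thesis .
qed

lemma red_Y_eq_ctr: "red_Y ds es \<rho> = ctr True ds es (1\<^sub>m (dimp ds)) \<rho>"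
  unfolding red_Y_def ctr_def joinidx_eq
  by (intro cong_mat refl) (simp add: if_distrib[of "\<lambda>x. x * _"] cong: if_cong)

lemma red_X_eq_ctr:
  assumes "length es = length ds"
  shows "red_X ds es \<rho> = ctr False es ds (1\<^sub>m (dimp es)) \<rho>"
proof -
  have "jidx False es ds c a = jidx True ds es a c" for a c
    using jidx_not[of ds es True c a] assms by simp
  then show ?thesis unfolding red_X_def ctr_def joinidx_eq
    by (intro cong_mat refl) (simp add: if_distrib[of "\<lambda>x. x * _"] cong: if_cong)
qed

text \<open>Both sides are the trace of \<rho> against \<open>M\<close> tensor 1. The flag is
  flipped so that the second system is the one contracted, with the identity, which leaves
  \<open>red_X\<close>.\<close>

lemma ctrace_ctr_one:
  assumes js: "joint_system ds es" and M: "M \<in> carrier_mat (dimp ds) (dimp ds)"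
    and \<rho>: "\<rho> \<in> carrier_mat (dimp (joint_dims ds es)) (dimp (joint_dims ds es))"
  shows "ctrace (ctr True ds es M \<rho>) = ctrace (M * red_X ds es \<rho>)"
proof -
  interpret joint_system ds es by fact
  have js': "joint_system es ds" using vd ve len by unfold_locales auto
  have "ctrace (ctr True ds es M \<rho>) = ctrace (1\<^sub>m (dimp es) * ctr True ds es M \<rho>)"
    by (simp add: left_mult_one_mat[OF ctr_carrier])
  also have "\<dots> = ctrace (jt True ds ds es es M (1\<^sub>m (dimp es)) * \<rho>)"
    using \<rho> by (intro ctrace_ctr[OF js]) auto
  also have "jt True ds ds es es M (1\<^sub>m (dimp es)) = jt False es es ds ds (1\<^sub>m (dimp es)) M"
    using jt_not[OF len[symmetric] len[symmetric], of True "1\<^sub>m (dimp es)" M] by simp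
  also have "ctrace (\<dots> * \<rho>) = ctrace (M * red_X ds es \<rho>)"
    unfolding red_X_eq_ctr[OF len] using \<rho> M
    by (intro ctrace_ctr[OF js', symmetric]) (simp_all only: joint_dims_commute[of es ds])
  finally show ?thesis .
qed

lemma ctr_lsum:
  "mat (dimp es) (dimp es) (\<lambda>ab. \<Sum>i<length Ms. ctr s ds es (Ms ! i) \<rho> $$ ab) = ctr s ds es (lsum (dimp ds) Ms) \<rho>"
proof (rule eq_matI)
  fix c c' assume "c < dim_row (ctr s ds es (lsum (dimp ds) Ms) \<rho>)" "c' < dim_col (ctr s ds es (lsum (dimp ds) Ms) \<rho>)"
  then have c: "c < dimp es" "c' < dimp es" by (auto simp: ctr_def)
  have "(\<Sum>i<length Ms. ctr s ds es (Ms ! i) \<rho> $$ (c, c')) =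
      (\<Sum>i<length Ms. \<Sum>a<dimp ds. \<Sum>b<dimp ds. (Ms ! i) $$ (b, a) * \<rho> $$ (jidx s ds es a c, jidx s ds es b c'))"
    using c by (simp add: ctr_def)
  also have "\<dots> = (\<Sum>a<dimp ds. \<Sum>b<dimp ds. \<Sum>i<length Ms. (Ms ! i) $$ (b, a) * \<rho> $$ (jidx s ds es a c, jidx s ds es b c'))"
    by (rule sum_swap3[symmetric])
  also have "\<dots> = ctr s ds es (lsum (dimp ds) Ms) \<rho> $$ (c, c')"
    using c by (simp add: ctr_def index_lsum sum_list_sum_nth atLeast0LessThan sum_distrib_right)
  finally show "mat (dimp es) (dimp es) (\<lambda>ab. \<Sum>i<length Ms. ctr s ds es (Ms ! i) \<rho> $$ ab) $$ (c, c') =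
      ctr s ds es (lsum (dimp ds) Ms) \<rho> $$ (c, c')" using c by simp
qed (auto simp: ctr_def)

subsection \<open>Classical relative entropy\<close>

text \<open>One summand of the relative entropy with values in \<open>ereal\<close>: a sum of such
  terms becomes infinite by itself where \<open>rel_ent\<close> tests for it globally.\<close>

definition ent :: "real \<Rightarrow> real \<Rightarrow> ereal" where
  "ent p q = (if p = 0 then 0 else if q = 0 then \<infinity> else ereal (p * ln (p / q)))"

lemma ent_not_MInfty [simp]: "ent p q \<noteq> -\<infinity>"
  by (simp add: ent_def)

text \<open>The Legendre transform of \<open>p \<mapsto> p ln (p / q)\<close>.\<close>

lemma ent_tangent:
  assumes "0 \<le> p" "0 \<le> q"
  shows "ereal (p * (1 + t) - q * exp t) \<le> ent p q"
proof (cases "p = 0 \<or> q = 0")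
  case False
  then have pq: "0 < p" "0 < q" using assms by auto
  have "ln (q * exp t / p) \<le> q * exp t / p - 1" using pq by (intro ln_le_minus_one) simp
  moreover have "ln (q * exp t / p) = t - ln (p / q)" using pq by (simp add: ln_div ln_mult)
  ultimately have "p * (t - ln (p / q)) \<le> p * (q * exp t / p - 1)" using pq by (intro mult_left_mono) auto
  then show ?thesis using pq by (simp add: ent_def algebra_simps)
qed (use assms in \<open>auto simp: ent_def\<close>)

text \<open>The inequality ln x \<le> x - 1 at the square root of q / p. Summed over a POVM the
  terms \<open>p - q\<close> cancel, and what remains bounds every squared difference of root
  probabilities by the relative entropy.\<close>

lemma ent_hellinger:
  assumes "0 \<le> p" "0 \<le> q"
  shows "ereal (p - q + (sqrt p - sqrt q)\<^sup>2) \<le> ent p q"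
proof (cases "p = 0 \<or> q = 0")
  case False
  then have pq: "0 < p" "0 < q" using assms by auto
  have "ln (sqrt q / sqrt p) \<le> sqrt q / sqrt p - 1" using pq by (intro ln_le_minus_one) simp
  moreover have "ln (sqrt q / sqrt p) = - ln (p / q) / 2" using pq by (simp add: ln_div ln_sqrt field_simps)
  ultimately have "2 * p * (- ln (p / q) / 2) \<le> 2 * p * (sqrt q / sqrt p - 1)"
    using pq by (intro mult_left_mono) auto
  moreover have "2 * p * (sqrt q / sqrt p - 1) = 2 * (sqrt p * sqrt q) - 2 * p"
    using pq real_sqrt_mult_self[of p] by (simp add: field_simps)
  ultimately have "2 * p - 2 * (sqrt p * sqrt q) \<le> p * ln (p / q)" by simp
  then show ?thesis using pq by (simp add: ent_def power2_diff)
qed (use assms in \<open>auto simp: ent_def\<close>)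

text \<open>At \<open>t = ln (?R / ?S)\<close> the tangent inequality is an equality for the totals.
  It is linear in the pair, so summing it over the terms with this one slope gives the
  claim.\<close>

lemma ent_log_sum:
  assumes "finite I" "\<And>i. i \<in> I \<Longrightarrow> 0 \<le> r i" "\<And>i. i \<in> I \<Longrightarrow> 0 \<le> s i"
  shows "ent (\<Sum>i\<in>I. r i) (\<Sum>i\<in>I. s i) \<le> (\<Sum>i\<in>I. ent (r i) (s i))"
proof -
  let ?R = "\<Sum>i\<in>I. r i" and ?S = "\<Sum>i\<in>I. s i"
  consider "?R = 0" | "?R \<noteq> 0" "?S = 0" | "?R \<noteq> 0" "?S \<noteq> 0" by blast
  then show ?thesis
  proof cases
    case 1
    then have "\<And>i. i \<in> I \<Longrightarrow> r i = 0" using assms by (simp add: sum_nonneg_eq_0_iff)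
    then show ?thesis by (simp add: ent_def)
  next
    case 2
    then obtain i where i: "i \<in> I" "r i \<noteq> 0" by (meson sum.neutral)
    moreover have "s i = 0" using 2 assms i by (simp add: sum_nonneg_eq_0_iff)
    ultimately have "(\<Sum>i\<in>I. ent (r i) (s i)) = \<infinity>"
      using assms(1) by (auto simp: sum_Pinfty ent_def intro!: bexI[of _ i])
    then show ?thesis by simp
  next
    case 3
    then have RS: "0 < ?R" "0 < ?S" using assms by (auto simp: less_le sum_nonneg)
    let ?t = "ln (?R / ?S)"
    have "ent ?R ?S = ereal (?R * (1 + ?t) - ?S * exp ?t)" using RS 3 by (simp add: ent_def algebra_simps)
    also have "\<dots> = (\<Sum>i\<in>I. ereal (r i * (1 + ?t) - s i * exp ?t))"
      by (simp add: sum_subtractf sum_distrib_right)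
    also have "\<dots> \<le> (\<Sum>i\<in>I. ent (r i) (s i))" using assms by (intro sum_mono ent_tangent) auto
    finally show ?thesis .
  qed
qed

lemma ent_log_sum_list:
  assumes "\<And>x. x \<in> set xs \<Longrightarrow> 0 \<le> r x" "\<And>x. x \<in> set xs \<Longrightarrow> 0 \<le> s x"
  shows "ent (\<Sum>x\<leftarrow>xs. r x) (\<Sum>x\<leftarrow>xs. s x) \<le> (\<Sum>x\<leftarrow>xs. ent (r x) (s x))"
  using ent_log_sum[of "{..<length xs}" "\<lambda>i. r (xs ! i)" "\<lambda>i. s (xs ! i)"] assms
  by (simp add: sum_list_sum_nth atLeast0LessThan)

lemma ent_scale: "0 \<le> c \<Longrightarrow> ent (c * p) (c * q) = ereal c * ent p q"
  by (cases "c = 0") (auto simp: ent_def)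

lemma ent_scale2:
  assumes "0 < c" "0 < d" "0 \<le> p" "0 \<le> q"
  shows "ent (c * p) (d * q) = ereal c * ent p q + ereal (c * ln (c / d) * p)"
proof (cases "p = 0 \<or> q = 0")
  case False
  then have "0 < p" "0 < q" using assms by auto
  then show ?thesis using assms by (simp add: ent_def ln_div ln_mult algebra_simps)
qed (use assms in \<open>auto simp: ent_def\<close>)

text \<open>The source of the chain rule: rescaling two distributions by \<open>c\<close> and
  \<open>d\<close> splits off c ln (c / d) times the total of \<open>r\<close>, the contribution of
  the outcome probabilities themselves.\<close>

lemma sum_list_ent_scale2:
  assumes "0 < c" "0 < d" "\<And>x. x \<in> set xs \<Longrightarrow> 0 \<le> r x" "\<And>x. x \<in> set xs \<Longrightarrow> 0 \<le> s x"
  shows "(\<Sum>x\<leftarrow>xs. ent (c * r x) (d * s x)) = ereal c * (\<Sum>x\<leftarrow>xs. ent (r x) (s x)) + ereal (c * ln (c / d) * (\<Sum>x\<leftarrow>xs. r x))"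
  using assms(3,4)
proof (induction xs)
  case (Cons x xs)
  have "(\<Sum>x\<leftarrow>x # xs. ent (c * r x) (d * s x)) = (ereal c * ent (r x) (s x) + ereal (c * ln (c / d) * r x)) +
      (ereal c * (\<Sum>x\<leftarrow>xs. ent (r x) (s x)) + ereal (c * ln (c / d) * (\<Sum>x\<leftarrow>xs. r x)))"
    using Cons assms(1,2) by (simp add: ent_scale2)
  also have "\<dots> = (ereal c * ent (r x) (s x) + ereal c * (\<Sum>x\<leftarrow>xs. ent (r x) (s x))) +
      (ereal (c * ln (c / d) * r x) + ereal (c * ln (c / d) * (\<Sum>x\<leftarrow>xs. r x)))"
    by (simp only: add_ac)
  also have "ereal c * ent (r x) (s x) + ereal c * (\<Sum>x\<leftarrow>xs. ent (r x) (s x)) = ereal c * (\<Sum>x\<leftarrow>x # xs. ent (r x) (s x))"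
    using distrib_left_ereal_nn[of c] assms(1) by (simp add: mult.commute)
  finally show ?case by (simp add: algebra_simps)
qed simp

text \<open>The choices for different \<open>i\<close> are independent, so the suprema can be taken
  one after the other with the remaining choices held fixed. The accumulator \<open>c\<close>
  carries the terms already chosen.\<close>

lemma sum_SUP_le:
  fixes f :: "'i \<Rightarrow> 'a \<Rightarrow> ereal"
  assumes "finite I" "\<And>i. i \<in> I \<Longrightarrow> A i \<noteq> {}" "\<And>i. i \<in> I \<Longrightarrow> 0 \<le> p i" "\<And>i x. i \<in> I \<Longrightarrow> x \<in> A i \<Longrightarrow> 0 \<le> f i x"
    and "c \<noteq> -\<infinity>"
    and "\<And>g. (\<forall>i\<in>I. g i \<in> A i) \<Longrightarrow> c + (\<Sum>i\<in>I. ereal (p i) * f i (g i)) \<le> B"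
  shows "c + (\<Sum>i\<in>I. ereal (p i) * (SUP x\<in>A i. f i x)) \<le> B"
  using assms
proof (induction I arbitrary: c rule: finite_induct)
  case (insert j I)
  let ?S = "\<Sum>i\<in>I. ereal (p i) * (SUP x\<in>A i. f i x)"
  have SUP0: "0 \<le> (SUP x\<in>A i. f i x)" if i: "i \<in> insert j I" for i
  proof -
    obtain x where x: "x \<in> A i" using insert.prems(1)[OF i] by blast
    show ?thesis using SUP_upper2[OF x] insert.prems(3)[OF i x] by blast
  qed
  have S0: "0 \<le> ?S" using SUP0 insert.prems(2) by (intro sum_nonneg) auto
  have "(c + ?S) + ereal (p j) * f j x \<le> B" if x: "x \<in> A j" for x
  proof -
    have "(c + ereal (p j) * f j x) + ?S \<le> B"
    proof (rule insert.IH)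
      show "c + ereal (p j) * f j x \<noteq> -\<infinity>"
      proof -
        have "0 \<le> ereal (p j) * f j x" using insert.prems(2,3) x by simp
        then show ?thesis using insert.prems(4) by (cases c; cases "ereal (p j) * f j x") auto
      qed
      fix g assume g: "\<forall>i\<in>I. g i \<in> A i"
      have "c + (\<Sum>i\<in>insert j I. ereal (p i) * f i ((g(j := x)) i)) \<le> B"
        using g x insert.hyps by (intro insert.prems(5)) auto
      also have "(\<Sum>i\<in>insert j I. ereal (p i) * f i ((g(j := x)) i)) = ereal (p j) * f j x + (\<Sum>i\<in>I. ereal (p i) * f i (g i))"
        using insert.hyps by (subst sum.insert) (auto intro!: arg_cong2[where f = "(+)"] sum.cong)
      finally show "c + ereal (p j) * f j x + (\<Sum>i\<in>I. ereal (p i) * f i (g i)) \<le> B" by (simp add: add.assoc)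
    qed (use insert.prems in auto)
    then show ?thesis by (simp add: add_ac)
  qed
  then have "(SUP x\<in>A j. (c + ?S) + ereal (p j) * f j x) \<le> B" by (rule SUP_least)
  also have "(SUP x\<in>A j. (c + ?S) + ereal (p j) * f j x) = (c + ?S) + (SUP x\<in>A j. ereal (p j) * f j x)"
    using insert.prems(1,4) S0 by (intro SUP_ereal_add_right) auto
  also have "(SUP x\<in>A j. ereal (p j) * f j x) = ereal (p j) * (SUP x\<in>A j. f j x)"
    using insert.prems(1,2,3) by (intro SUP_ereal_mult_left) auto
  finally show ?case using insert.hyps by (simp add: add_ac)
qed simp

text \<open>Dual of the preceding statement. Strictly positive weights allow a factor to be moved
  through the infimum by multiplying with its inverse.\<close>

lemma le_sum_INF:
  fixes f :: "'i \<Rightarrow> 'a \<Rightarrow> ereal"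
  assumes "finite I" "\<And>i. i \<in> I \<Longrightarrow> A i \<noteq> {}" "\<And>i. i \<in> I \<Longrightarrow> 0 < p i" "\<And>i x. i \<in> I \<Longrightarrow> x \<in> A i \<Longrightarrow> 0 \<le> f i x"
    and "0 \<le> c"
    and "\<And>g. (\<forall>i\<in>I. g i \<in> A i) \<Longrightarrow> B \<le> c + (\<Sum>i\<in>I. ereal (p i) * f i (g i))"
  shows "B \<le> c + (\<Sum>i\<in>I. ereal (p i) * (INF x\<in>A i. f i x))"
  using assms
proof (induction I arbitrary: c rule: finite_induct)
  case (insert j I)
  let ?S = "\<Sum>i\<in>I. ereal (p i) * (INF x\<in>A i. f i x)"
  have INF0: "0 \<le> (INF x\<in>A i. f i x)" if "i \<in> insert j I" for i
    using insert.prems(3)[OF that] by (rule INF_greatest)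
  have S0: "0 \<le> ?S" using INF0 insert.prems(2) by (intro sum_nonneg) (auto simp: less_imp_le)
  have "B \<le> (c + ?S) + ereal (p j) * f j x" if x: "x \<in> A j" for x
  proof -
    have "B \<le> (c + ereal (p j) * f j x) + ?S"
    proof (rule insert.IH)
      show "0 \<le> c + ereal (p j) * f j x"
        using insert.prems(2,3,4) x by (simp add: less_imp_le)
      fix g assume g: "\<forall>i\<in>I. g i \<in> A i"
      have "B \<le> c + (\<Sum>i\<in>insert j I. ereal (p i) * f i ((g(j := x)) i))"
        using g x insert.hyps by (intro insert.prems(5)) auto
      also have "(\<Sum>i\<in>insert j I. ereal (p i) * f i ((g(j := x)) i)) = ereal (p j) * f j x + (\<Sum>i\<in>I. ereal (p i) * f i (g i))"
        using insert.hyps by (subst sum.insert) (auto intro!: arg_cong2[where f = "(+)"] sum.cong)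
      finally show "B \<le> c + ereal (p j) * f j x + (\<Sum>i\<in>I. ereal (p i) * f i (g i))" by (simp add: add.assoc)
    qed (use insert.prems in auto)
    then show ?thesis by (simp add: add_ac)
  qed
  then have "B \<le> (INF x\<in>A j. (c + ?S) + ereal (p j) * f j x)" by (rule INF_greatest)
  also have "(INF x\<in>A j. (c + ?S) + ereal (p j) * f j x) = (c + ?S) + (INF x\<in>A j. ereal (p j) * f j x)"
    using insert.prems S0 by (intro INF_ereal_add_right) (auto simp: less_imp_le)
  also have "(INF x\<in>A j. ereal (p j) * f j x) = ereal (p j) * (INF x\<in>A j. f j x)"
  proof (rule antisym)
    show "ereal (p j) * (INF x\<in>A j. f j x) \<le> (INF x\<in>A j. ereal (p j) * f j x)"
      using insert.prems(2)[of j] by (intro INF_greatest ereal_mult_left_mono INF_lower) auto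
    have "inverse (ereal (p j)) * (INF x\<in>A j. ereal (p j) * f j x) \<le> (INF x\<in>A j. f j x)"
    proof (rule INF_greatest)
      fix x assume x: "x \<in> A j"
      have "inverse (ereal (p j)) * (INF x\<in>A j. ereal (p j) * f j x) \<le> inverse (ereal (p j)) * (ereal (p j) * f j x)"
        using insert.prems(2)[of j] x by (intro ereal_mult_left_mono INF_lower) auto
      also have "\<dots> = f j x" using insert.prems(2)[of j] by (simp add: mult.assoc[symmetric] one_ereal_def[symmetric])
      finally show "inverse (ereal (p j)) * (INF x\<in>A j. ereal (p j) * f j x) \<le> f j x" .
    qed
    then have "ereal (p j) * (inverse (ereal (p j)) * (INF x\<in>A j. ereal (p j) * f j x)) \<le> ereal (p j) * (INF x\<in>A j. f j x)"
      using insert.prems(2)[of j] by (intro ereal_mult_left_mono) auto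
    then show "(INF x\<in>A j. ereal (p j) * f j x) \<le> ereal (p j) * (INF x\<in>A j. f j x)"
      using insert.prems(2)[of j] by (simp add: mult.assoc[symmetric] one_ereal_def[symmetric])
  qed
  finally show ?case using insert.hyps by (simp add: add_ac)
qed simp

subsection \<open>Outcome probabilities\<close>

definition tau :: "complex mat \<Rightarrow> complex mat \<Rightarrow> real" where
  "tau M \<rho> = Re (ctrace (M * \<rho>))"

definition ment :: "complex mat list \<Rightarrow> complex mat \<Rightarrow> complex mat \<Rightarrow> ereal" where
  "ment Ms \<rho> \<sigma> = (\<Sum>M\<leftarrow>Ms. ent (tau M \<rho>) (tau M \<sigma>))"

lemma rel_ent_meas:
  assumes "\<forall>M\<in>set Ms. 0 \<le> tau M \<rho>"
  shows "rel_ent (meas Ms \<rho>) (meas Ms \<sigma>) = ment Ms \<rho> \<sigma>"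
proof -
  have nth: "meas Ms \<rho> ! i = tau (Ms ! i) \<rho>" "meas Ms \<sigma> ! i = tau (Ms ! i) \<sigma>" if "i < length Ms" for i
    using that by (auto simp: meas_def tau_def)
  have nn: "0 \<le> tau (Ms ! i) \<rho>" if "i < length Ms" for i using assms that by simp
  have len: "length (meas Ms \<rho>) = length Ms" by (simp add: meas_def)
  have m: "ment Ms \<rho> \<sigma> = (\<Sum>i<length Ms. ent (tau (Ms ! i) \<rho>) (tau (Ms ! i) \<sigma>))"
    by (simp add: ment_def sum_list_sum_nth atLeast0LessThan)
  show ?thesis
  proof (cases "\<exists>i<length Ms. 0 < tau (Ms ! i) \<rho> \<and> tau (Ms ! i) \<sigma> = 0")
    case True
    then obtain i where i: "i < length Ms" "0 < tau (Ms ! i) \<rho>" "tau (Ms ! i) \<sigma> = 0" by blast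
    then have "ment Ms \<rho> \<sigma> = \<infinity>" unfolding m by (auto simp: sum_Pinfty ent_def intro!: bexI[of _ i])
    moreover have "\<exists>i<length (meas Ms \<rho>). 0 < meas Ms \<rho> ! i \<and> meas Ms \<sigma> ! i = 0"
      using i nth[OF i(1)] len by auto
    ultimately show ?thesis by (simp add: rel_ent_def)
  next
    case False
    have "ment Ms \<rho> \<sigma> = (\<Sum>i<length Ms. ereal (if tau (Ms ! i) \<rho> = 0 then 0
        else tau (Ms ! i) \<rho> * ln (tau (Ms ! i) \<rho> / tau (Ms ! i) \<sigma>)))"
      unfolding m
    proof (intro sum.cong refl)
      fix i assume "i \<in> {..<length Ms}"
      then show "ent (tau (Ms ! i) \<rho>) (tau (Ms ! i) \<sigma>) = ereal (if tau (Ms ! i) \<rho> = 0 then 0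
          else tau (Ms ! i) \<rho> * ln (tau (Ms ! i) \<rho> / tau (Ms ! i) \<sigma>))"
        using False nn[of i] by (cases "tau (Ms ! i) \<rho> = 0") (auto simp: ent_def less_le)
    qed
    also have "\<dots> = rel_ent (meas Ms \<rho>) (meas Ms \<sigma>)"
      using False nth unfolding rel_ent_def len by (auto simp: intro!: sum.cong)
    finally show ?thesis by simp
  qed
qed

subsection \<open>Closedness of the sets of free states\<close>

lemma psd_limit:
  assumes "\<And>n. psd N (A n)" "B \<in> carrier_mat N N"
    "\<And>a b. a < N \<Longrightarrow> b < N \<Longrightarrow> (\<lambda>n. A n $$ (a, b)) \<longlonglongrightarrow> B $$ (a, b)"
  shows "psd N B"
proof -
  have lim: "(\<lambda>n. qform N (A n) v) \<longlonglongrightarrow> qform N B v" for v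
    unfolding qform_def using assms(3) by (intro tendsto_intros) auto
  have "Im (qform N B v) = 0" for v
    using LIMSEQ_unique[OF tendsto_Im[OF lim[of v]]] assms(1) by (simp add: psd_qform)
  moreover have "0 \<le> Re (qform N B v)" for v
    using tendsto_Re[OF lim[of v]] assms(1) by (intro LIMSEQ_le_const) (auto simp: psd_qform)
  ultimately show ?thesis using assms(2) by (simp add: psd_qform)
qed

lemma ctrace_limit:
  assumes "\<And>n. A n \<in> carrier_mat N N" "B \<in> carrier_mat N N"
    "\<And>a b. a < N \<Longrightarrow> b < N \<Longrightarrow> (\<lambda>n. A n $$ (a, b)) \<longlonglongrightarrow> B $$ (a, b)"
  shows "(\<lambda>n. ctrace (A n)) \<longlonglongrightarrow> ctrace B"
proof -
  have "(\<lambda>n. \<Sum>a<N. A n $$ (a, a)) \<longlonglongrightarrow> (\<Sum>a<N. B $$ (a, a))" using assms(3) by (intro tendsto_intros) auto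
  moreover have "dim_row (A n) = N" for n using assms(1)[of n] by simp
  ultimately show ?thesis using assms(2) by (simp add: ctrace_def)
qed

lemma is_state_limit:
  assumes "\<And>n. is_state N (A n)" "B \<in> carrier_mat N N"
    "\<And>a b. a < N \<Longrightarrow> b < N \<Longrightarrow> (\<lambda>n. A n $$ (a, b)) \<longlonglongrightarrow> B $$ (a, b)"
  shows "is_state N B"
proof -
  have "psd N B" by (rule psd_limit[of N A]) (use assms in \<open>auto simp: is_state_def\<close>)
  moreover have "(\<lambda>n. ctrace (A n)) \<longlonglongrightarrow> ctrace B"
    using assms by (intro ctrace_limit[of _ N]) (auto simp: is_state_def psd_carrier)
  then have "ctrace B = 1" using assms(1) by (simp add: is_state_def LIMSEQ_const_iff)
  ultimately show ?thesis by (simp add: is_state_def)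
qed

lemma ppt_state_closed:
  assumes v: "valid_dims ds" and "\<And>n. ppt_state ds (\<sigma> n)" "\<rho> \<in> carrier_mat (dimp ds) (dimp ds)"
    and lim: "\<And>a b. a < dimp ds \<Longrightarrow> b < dimp ds \<Longrightarrow> (\<lambda>n. \<sigma> n $$ (a, b)) \<longlonglongrightarrow> \<rho> $$ (a, b)"
  shows "ppt_state ds \<rho>"
  unfolding ppt_state_def
proof (intro conjI allI impI)
  show "is_state (dimp ds) \<rho>" by (rule is_state_limit[of _ \<sigma>]) (use assms in \<open>auto simp: ppt_state_def\<close>)
  fix S assume "S \<subseteq> {..<length ds}"
  then have "psd (dimp ds) (ptrans ds S (\<sigma> n))" for n using assms(2) by (auto simp: ppt_state_def)
  moreover have "(\<lambda>n. ptrans ds S (\<sigma> n) $$ (a, b)) \<longlonglongrightarrow> ptrans ds S \<rho> $$ (a, b)"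
    if "a < dimp ds" "b < dimp ds" for a b
    using that by (simp add: ptrans_def lim mixidx_less[OF v])
  moreover have "ptrans ds S \<rho> \<in> carrier_mat (dimp ds) (dimp ds)" by (simp add: ptrans_def)
  ultimately show "psd (dimp ds) (ptrans ds S \<rho>)"
    using psd_limit[of "dimp ds" "\<lambda>n. ptrans ds S (\<sigma> n)" "ptrans ds S \<rho>"] by blast
qed

section \<open>Normalised decompositions of separable states\<close>

lemma ctrace_trect:
  assumes "local_ops ds ds F"
  shows "ctrace (trect ds ds F) = (\<Prod>j<length ds. ctrace (F j))"
proof -
  have v: "valid_dims ds" and F: "\<And>j. j < length ds \<Longrightarrow> dim_row (F j) = ds ! j" using assms by (auto simp: local_ops_def)
  have "ctrace (trect ds ds F) = (\<Sum>a<dimp ds. \<Prod>j<length ds. F j $$ (digit ds j a, digit ds j a))"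
    by (simp add: ctrace_def index_trect carrier_matD[OF trect_carrier])
  also have "\<dots> = (\<Prod>j<length ds. \<Sum>x<ds ! j. F j $$ (x, x))" by (rule sum_prod_digits[OF v])
  finally show ?thesis using F by (simp add: ctrace_def)
qed

lemma ctrace_smult: "ctrace (c \<cdot>\<^sub>m A) = c * ctrace A" if "A \<in> carrier_mat N N" for A
  using that by (auto simp: ctrace_def sum_distrib_left)

lemma is_state_normalize:
  assumes "psd N A" "0 < Re (ctrace A)"
  shows "is_state N (complex_of_real (1 / Re (ctrace A)) \<cdot>\<^sub>m A)"
proof -
  have "ctrace A = complex_of_real (Re (ctrace A))" using ctrace_psd[OF assms(1)] by (simp add: complex_eq_iff)
  then have "complex_of_real (1 / Re (ctrace A)) * ctrace A = complex_of_real (1 / Re (ctrace A) * Re (ctrace A))"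
    by (metis of_real_mult)
  also have "\<dots> = 1" using assms(2) by simp
  finally have "ctrace (complex_of_real (1 / Re (ctrace A)) \<cdot>\<^sub>m A) = 1"
    by (simp only: ctrace_smult[OF psd_carrier[OF assms(1)]])
  moreover have "psd N (complex_of_real (1 / Re (ctrace A)) \<cdot>\<^sub>m A)"
    using assms by (intro psd_smult) auto
  ultimately show ?thesis by (simp only: is_state_def)
qed

lemma ex_is_state:
  assumes "0 < N" shows "\<exists>A. is_state N A"
proof -
  have "ctrace (1\<^sub>m N :: complex mat) = of_nat N" by (simp add: ctrace_def)
  then show ?thesis using is_state_normalize[OF psd_one, of N] assms by auto
qed

lemma mixture_trace:
  fixes m :: nat
  assumes v: "valid_dims ds"
    and \<rho>: "\<rho> = mat (dimp ds) (dimp ds) (\<lambda>ab. \<Sum>k<m. complex_of_real (p k) * trect ds ds (\<sigma> k) $$ ab)"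
    and \<sigma>: "\<And>k j. k < m \<Longrightarrow> j < length ds \<Longrightarrow> is_state (ds ! j) (\<sigma> k j)"
  shows "ctrace \<rho> = complex_of_real (\<Sum>k<m. p k)"
proof -
  have tr: "(\<Sum>a<dimp ds. trect ds ds (\<sigma> k) $$ (a, a)) = 1" if "k < m" for k
  proof -
    have "local_ops ds ds (\<sigma> k)" using v \<sigma>[OF that] by (auto simp: local_ops_def is_state_def psd_carrier)
    then have "ctrace (trect ds ds (\<sigma> k)) = (\<Prod>j<length ds. ctrace (\<sigma> k j))" by (rule ctrace_trect)
    also have "\<dots> = 1" using \<sigma>[OF that] by (intro prod.neutral) (auto simp: is_state_def)
    finally show ?thesis by (simp add: ctrace_def carrier_matD[OF trect_carrier])
  qed
  have "ctrace \<rho> = (\<Sum>k<m. \<Sum>a<dimp ds. complex_of_real (p k) * trect ds ds (\<sigma> k) $$ (a, a))"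
    unfolding \<rho> ctrace_def by (subst sum.swap) simp
  then show ?thesis by (simp add: sum_distrib_left[symmetric] tr)
qed

text \<open>The weight of each product term is its trace, so normalising the factors turns
  a state in the separable cone into a convex combination of product states.\<close>

lemma sep_state_iff:
  assumes v: "valid_dims ds"
  shows "sep_state ds \<rho> \<longleftrightarrow> is_state (dimp ds) \<rho> \<and> gsep {0..} ds \<rho>"
proof
  assume "sep_state ds \<rho>"
  then obtain m :: nat and p \<sigma> where *: "is_state (dimp ds) \<rho>" "\<forall>i<m. 0 \<le> p i"
    "\<forall>i<m. \<forall>j<length ds. is_state (ds ! j) (\<sigma> i j)"
    "\<rho> = mat (dimp ds) (dimp ds) (\<lambda>ab. \<Sum>i<m. complex_of_real (p i) * trect ds ds (\<sigma> i) $$ ab)"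
    unfolding sep_state_def tensor_list_eq_trect by blast
  then show "is_state (dimp ds) \<rho> \<and> gsep {0..} ds \<rho>" using v unfolding gsep_def
    by (intro conjI exI[of _ m] exI[of _ p] exI[of _ \<sigma>]) (auto simp: is_state_def)
next
  assume "is_state (dimp ds) \<rho> \<and> gsep {0..} ds \<rho>"
  then obtain m :: nat and c F where st: "is_state (dimp ds) \<rho>"
    and F: "\<forall>k<m. c k \<in> {0::real..} \<and> (\<forall>j<length ds. psd (ds ! j) (F k j))"
    and \<rho>: "\<rho> = mat (dimp ds) (dimp ds) (\<lambda>ab. \<Sum>k<m. complex_of_real (c k) * trect ds ds (F k) $$ ab)"
    unfolding gsep_def by blast
  define t where "t k j = Re (ctrace (F k j))" for k j
  have t0: "0 \<le> t k j" if "k < m" "j < length ds" for k j using ctrace_psd(2)[of "ds ! j" "F k j"] F that by (auto simp: t_def)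
  \<comment> \<open>An arbitrary state fills in for a factor of trace zero; the weight of its
    product term is zero because that trace enters \<open>p\<close> as a factor.\<close>
  define e where "e j = (SOME A. is_state (ds ! j) A)" for j
  have e: "is_state (ds ! j) (e j)" if "j < length ds" for j
    unfolding e_def by (rule someI_ex, rule ex_is_state) (use v that in \<open>simp add: valid_dims_def\<close>)
  define \<sigma> where "\<sigma> k j = (if t k j = 0 then e j else complex_of_real (1 / t k j) \<cdot>\<^sub>m F k j)" for k j
  define p where "p k = c k * (\<Prod>j<length ds. t k j)" for k
  have p0: "0 \<le> p k" if "k < m" for k using F t0 that by (auto simp: p_def intro!: mult_nonneg_nonneg prod_nonneg)
  have \<sigma>: "is_state (ds ! j) (\<sigma> k j)" if "k < m" "j < length ds" for k j
    using e[OF that(2)] F t0[OF that] that is_state_normalize[of "ds ! j" "F k j"]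
    by (auto simp: \<sigma>_def t_def less_le)
  have eq: "complex_of_real (c k) * trect ds ds (F k) $$ (a, b) = complex_of_real (p k) * trect ds ds (\<sigma> k) $$ (a, b)"
    if k: "k < m" and ab: "a < dimp ds" "b < dimp ds" for k a b
  proof -
    have "F k j $$ (digit ds j a, digit ds j b) = complex_of_real (t k j) * \<sigma> k j $$ (digit ds j a, digit ds j b)"
      if j: "j < length ds" for j
    proof -
      have c: "F k j \<in> carrier_mat (ds ! j) (ds ! j)" using F k j by (auto simp: psd_carrier)
      show ?thesis
      proof (cases "t k j = 0")
        case True
        then have "F k j = 0\<^sub>m (ds ! j) (ds ! j)" using F k j by (intro psd_trace_zero) (auto simp: t_def)
        then show ?thesis using True digit_less[OF v j] by simp
      qed (use c digit_less[OF v j] in \<open>simp add: \<sigma>_def\<close>)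
    qed
    then have "trect ds ds (F k) $$ (a, b) = (\<Prod>j<length ds. complex_of_real (t k j)) * trect ds ds (\<sigma> k) $$ (a, b)"
      unfolding index_trect[OF ab] prod.distrib[symmetric] by (intro prod.cong) auto
    then show ?thesis by (simp add: p_def)
  qed
  have \<rho>': "\<rho> = mat (dimp ds) (dimp ds) (\<lambda>ab. \<Sum>k<m. complex_of_real (p k) * trect ds ds (\<sigma> k) $$ ab)"
    unfolding \<rho> by (intro cong_mat refl) (auto simp: eq)
  have "complex_of_real (\<Sum>k<m. p k) = ctrace \<rho>"
    by (rule mixture_trace[symmetric, OF v \<rho>' \<sigma>])
  then have "(\<Sum>k<m. p k) = 1" using st by (simp add: is_state_def del: of_real_sum)
  then show "sep_state ds \<rho>" unfolding sep_state_def tensor_list_eq_trect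
    using st p0 \<sigma> \<rho>' by blast
qed

text \<open>Gaussian elimination on the coordinate \<open>k0\<close>: a vector \<open>i0\<close>
  with a nonzero entry there clears this coordinate in all others, which leaves one coordinate and
  one vector less.\<close>

lemma linear_dependence:
  fixes T :: "'i \<Rightarrow> 'k \<Rightarrow> real"
  assumes "finite K" "finite S" "card K < card S"
  shows "\<exists>c. (\<exists>i\<in>S. c i \<noteq> 0) \<and> (\<forall>k\<in>K. (\<Sum>i\<in>S. c i * T i k) = 0)"
  using assms
proof (induction K arbitrary: S T rule: finite_induct)
  case empty
  then show ?case by (intro exI[of _ "\<lambda>_. 1"]) (auto simp: card_gt_0_iff)
next
  case (insert k0 K)
  show ?case
  proof (cases "\<forall>i\<in>S. T i k0 = 0")
    case True
    obtain c where "\<exists>i\<in>S. c i \<noteq> 0" "\<forall>k\<in>K. (\<Sum>i\<in>S. c i * T i k) = 0"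
      using insert.IH[OF insert.prems(1), of T] insert.hyps insert.prems(2) by force
    then show ?thesis using True by (intro exI[of _ c]) auto
  next
    case False
    then obtain i0 where i0: "i0 \<in> S" "T i0 k0 \<noteq> 0" by auto
    define S' where "S' = S - {i0}"
    have S': "finite S'" "card K < card S'" "i0 \<notin> S'" "S = insert i0 S'"
      using insert i0 by (auto simp: S'_def card_Diff_singleton)
    obtain c where c: "\<exists>i\<in>S'. c i \<noteq> 0" "\<forall>k\<in>K. (\<Sum>i\<in>S'. c i * (T i k - T i k0 / T i0 k0 * T i0 k)) = 0"
      using insert.IH[OF S'(1,2), of "\<lambda>i k. T i k - T i k0 / T i0 k0 * T i0 k"] by auto
    \<comment> \<open>The coefficient of \<open>i0\<close> gathers the multiples of its vector that
      the elimination subtracted from the others.\<close>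
    define c' where "c' = c(i0 := - (\<Sum>i\<in>S'. c i * (T i k0 / T i0 k0)))"
    have sum: "(\<Sum>i\<in>S. c' i * T i k) = (\<Sum>i\<in>S'. c i * (T i k - T i k0 / T i0 k0 * T i0 k))" for k
    proof -
      have "(\<Sum>i\<in>S'. c' i * T i k) = (\<Sum>i\<in>S'. c i * T i k)" using S'(3) by (intro sum.cong) (auto simp: c'_def)
      then have "(\<Sum>i\<in>S. c' i * T i k) = (\<Sum>i\<in>S'. c i * T i k) - (\<Sum>i\<in>S'. c i * (T i k0 / T i0 k0)) * T i0 k"
        unfolding S'(4) using S'(1,3) by (simp add: c'_def)
      then show ?thesis by (simp add: sum_distrib_right sum_subtractf right_diff_distrib mult.assoc)
    qed
    have "(\<Sum>i\<in>S. c' i * T i k0) = 0" using i0 by (simp add: sum)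
    moreover have "\<exists>i\<in>S. c' i \<noteq> 0" using c(1) S' by (auto simp: c'_def)
    ultimately show ?thesis using c(2) sum by (intro exI[of _ c']) auto
  qed
qed

text \<open>With more terms than coordinates there is a linear dependence. Shifting the weights
  along it leaves all sums unchanged; the shift stops when the first weight reaches zero, and that
  term is dropped.\<close>

lemma caratheodory_cone:
  fixes T :: "'i \<Rightarrow> 'k \<Rightarrow> real"
  assumes "finite K" "finite S" "\<forall>i\<in>S. 0 \<le> p i"
  shows "\<exists>S' p'. S' \<subseteq> S \<and> card S' \<le> card K \<and> (\<forall>i\<in>S'. 0 \<le> p' i) \<and>
    (\<forall>k\<in>K. (\<Sum>i\<in>S'. p' i * T i k) = (\<Sum>i\<in>S. p i * T i k))"
  using assms(2,3)
proof (induction "card S" arbitrary: S p rule: less_induct)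
  case less
  show ?case
  proof (cases "card S \<le> card K")
    case True
    then show ?thesis using less.prems by (intro exI[of _ S] exI[of _ p]) auto
  next
    case False
    then obtain c0 where c0: "\<exists>i\<in>S. c0 i \<noteq> 0" "\<forall>k\<in>K. (\<Sum>i\<in>S. c0 i * T i k) = 0"
      using linear_dependence[OF assms(1) less.prems(1), of T] by auto
    \<comment> \<open>Up to its sign the dependence has a positive coefficient, so that subtracting
      it makes some weight decrease.\<close>
    obtain c where c: "\<exists>i\<in>S. 0 < c i" "\<forall>k\<in>K. (\<Sum>i\<in>S. c i * T i k) = 0"
    proof (cases "\<exists>i\<in>S. 0 < c0 i")
      case False
      then have "\<exists>i\<in>S. 0 < - c0 i" using c0(1) by force
      then show ?thesis using that[of "\<lambda>i. - c0 i"] c0(2) by (simp add: sum_negf)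
    qed (use that c0 in blast)
    define Q where "Q = {i\<in>S. 0 < c i}"
    have Q: "finite Q" "Q \<noteq> {}" using c(1) less.prems(1) by (auto simp: Q_def)
    \<comment> \<open>The smallest quotient is the largest shift that keeps all weights
      nonnegative.\<close>
    obtain i0 where i0: "i0 \<in> Q" "\<And>i. i \<in> Q \<Longrightarrow> p i0 / c i0 \<le> p i / c i"
      using arg_min_if_finite[OF Q, of "\<lambda>i. p i / c i"] arg_min_least[OF Q, of _ "\<lambda>i. p i / c i"] by blast
    define t where "t = p i0 / c i0"
    have t: "0 \<le> t" using i0(1) less.prems(2) by (auto simp: t_def Q_def)
    define p' where "p' i = p i - t * c i" for i
    have p'0: "p' i0 = 0" using i0(1) by (auto simp: p'_def t_def Q_def)
    have nn: "0 \<le> p' i" if "i \<in> S" for i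
    proof (cases "0 < c i")
      case True
      then have "t \<le> p i / c i" using i0(2)[of i] that by (auto simp: t_def Q_def)
      then show ?thesis using True by (simp add: p'_def field_simps)
    next
      case False
      then show ?thesis using t less.prems(2) that mult_nonneg_nonpos[of t "c i"] by (force simp: p'_def)
    qed
    have i0S: "i0 \<in> S" using i0(1) by (auto simp: Q_def)
    have "card (S - {i0}) < card S" using i0S less.prems(1) by (metis card_Diff1_less)
    from less.hyps[OF this, of p'] obtain S' q where S': "S' \<subseteq> S - {i0}" "card S' \<le> card K" "\<forall>i\<in>S'. 0 \<le> q i"
      "\<forall>k\<in>K. (\<Sum>i\<in>S'. q i * T i k) = (\<Sum>i\<in>S - {i0}. p' i * T i k)"
      using less.prems(1) nn by auto
    have "(\<Sum>i\<in>S - {i0}. p' i * T i k) = (\<Sum>i\<in>S. p i * T i k)" if "k \<in> K" for k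
    proof -
      have "(\<Sum>i\<in>S. p' i * T i k) = p' i0 * T i0 k + (\<Sum>i\<in>S - {i0}. p' i * T i k)"
        using less.prems(1) i0S by (rule sum.remove)
      moreover have "(\<Sum>i\<in>S. p' i * T i k) = (\<Sum>i\<in>S. p i * T i k) - t * (\<Sum>i\<in>S. c i * T i k)"
        by (simp add: p'_def left_diff_distrib sum_subtractf sum_distrib_left mult.assoc)
      ultimately show ?thesis using c(2) that by (simp add: p'0)
    qed
    then show ?thesis using S' by (intro exI[of _ S'] exI[of _ q]) auto
  qed
qed

text \<open>The number of terms is the number of real coordinates, two for each of the
  \<open>dimp ds * dimp ds\<close> entries. It is the same for all states, so decompositions along a
  sequence can be compared term by term.\<close>

lemma sep_state_bounded_terms:
  assumes v: "valid_dims ds" and \<rho>: "sep_state ds \<rho>"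
  shows "\<exists>p \<sigma>. (\<forall>i<2 * (dimp ds * dimp ds). 0 \<le> p i) \<and>
    (\<forall>i<2 * (dimp ds * dimp ds). \<forall>j<length ds. is_state (ds ! j) (\<sigma> i j)) \<and>
    \<rho> = mat (dimp ds) (dimp ds) (\<lambda>ab. \<Sum>i<2 * (dimp ds * dimp ds). complex_of_real (p i) * trect ds ds (\<sigma> i) $$ ab)"
proof -
  let ?N = "dimp ds" and ?D = "2 * (dimp ds * dimp ds)"
  obtain m :: nat and p \<sigma> where *: "\<forall>i<m. 0 \<le> p i"
    "\<forall>i<m. \<forall>j<length ds. is_state (ds ! j) (\<sigma> i j)"
    "\<rho> = mat ?N ?N (\<lambda>ab. \<Sum>i<m. complex_of_real (p i) * trect ds ds (\<sigma> i) $$ ab)"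
    using \<rho> unfolding sep_state_def tensor_list_eq_trect by blast
  define K where "K = (UNIV :: bool set) \<times> {..<?N} \<times> {..<?N}"
  define T where "T i = (\<lambda>(r, ab). if r then Re (trect ds ds (\<sigma> i) $$ ab) else Im (trect ds ds (\<sigma> i) $$ ab))" for i
  have cK: "card K = ?D" "finite K" by (auto simp: K_def card_cartesian_product)
  obtain S p' where S: "S \<subseteq> {..<m}" "card S \<le> ?D" "\<forall>i\<in>S. 0 \<le> p' i"
    "\<forall>k\<in>K. (\<Sum>i\<in>S. p' i * T i k) = (\<Sum>i<m. p i * T i k)"
    using caratheodory_cone[OF cK(2), of "{..<m}" p T] *(1) cK by auto
  have finS: "finite S" using S(1) finite_subset by blast
  obtain f where f: "bij_betw f {..<card S} S"
    using ex_bij_betw_nat_finite[OF finS] by (auto simp: atLeast0LessThan)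
  define e where "e j = (SOME A. is_state (ds ! j) A)" for j
  have e: "is_state (ds ! j) (e j)" if "j < length ds" for j
    unfolding e_def by (rule someI_ex, rule ex_is_state) (use v that in \<open>simp add: valid_dims_def\<close>)
  \<comment> \<open>Missing terms are padded with weight zero and the arbitrary states
    \<open>e\<close>.\<close>
  define q where "q i = (if i < card S then p' (f i) else 0)" for i
  define \<tau> where "\<tau> i = (if i < card S then \<sigma> (f i) else e)" for i
  have fS: "f i \<in> S" if "i < card S" for i using f that by (auto simp: bij_betw_def)
  have "\<rho> $$ (a, b) = (\<Sum>i<?D. complex_of_real (q i) * trect ds ds (\<tau> i) $$ (a, b))" if ab: "a < ?N" "b < ?N" for a b
  proof -
    have Re: "(\<Sum>i\<in>S. p' i * Re (trect ds ds (\<sigma> i) $$ (a, b))) = (\<Sum>i<m. p i * Re (trect ds ds (\<sigma> i) $$ (a, b)))"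
      using S(4)[rule_format, of "(True, a, b)"] ab by (simp add: K_def T_def)
    have Im: "(\<Sum>i\<in>S. p' i * Im (trect ds ds (\<sigma> i) $$ (a, b))) = (\<Sum>i<m. p i * Im (trect ds ds (\<sigma> i) $$ (a, b)))"
      using S(4)[rule_format, of "(False, a, b)"] ab by (simp add: K_def T_def)
    have "\<rho> $$ (a, b) = (\<Sum>i<m. complex_of_real (p i) * trect ds ds (\<sigma> i) $$ (a, b))" using ab by (simp add: *(3))
    also have "\<dots> = (\<Sum>i\<in>S. complex_of_real (p' i) * trect ds ds (\<sigma> i) $$ (a, b))"
      using Re Im by (simp add: complex_eq_iff)
    also have "\<dots> = (\<Sum>i<card S. complex_of_real (p' (f i)) * trect ds ds (\<sigma> (f i)) $$ (a, b))"
      by (rule sum.reindex_bij_betw[OF f, symmetric])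
    also have "\<dots> = (\<Sum>i<card S. complex_of_real (q i) * trect ds ds (\<tau> i) $$ (a, b))"
      by (intro sum.cong) (auto simp: q_def \<tau>_def)
    also have "\<dots> = (\<Sum>i<?D. complex_of_real (q i) * trect ds ds (\<tau> i) $$ (a, b))"
      using S(2) by (intro sum.mono_neutral_left) (auto simp: q_def)
    finally show ?thesis .
  qed
  then have "\<rho> = mat ?N ?N (\<lambda>ab. \<Sum>i<?D. complex_of_real (q i) * trect ds ds (\<tau> i) $$ ab)"
    using *(3) by (intro eq_matI) auto
  moreover have "\<forall>i<?D. 0 \<le> q i" using S(3) fS by (auto simp: q_def)
  moreover have "\<forall>i<?D. \<forall>j<length ds. is_state (ds ! j) (\<tau> i j)"
  proof (intro allI impI)
    fix i j assume "j < length ds"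
    then show "is_state (ds ! j) (\<tau> i j)" using fS[of i] S(1) *(2) e by (auto simp: \<tau>_def)
  qed
  ultimately show ?thesis by blast
qed

lemma finite_family_convergent_subsequence:
  fixes f :: "'i \<Rightarrow> nat \<Rightarrow> 'b :: heine_borel"
  assumes "finite I" "\<And>i. i \<in> I \<Longrightarrow> bounded (range (f i))"
  shows "\<exists>r. strict_mono (r :: nat \<Rightarrow> nat) \<and> (\<forall>i\<in>I. \<exists>l. (\<lambda>n. f i (r n)) \<longlonglongrightarrow> l)"
  using assms
proof (induction I rule: finite_induct)
  case empty
  then show ?case by (auto intro!: exI[of _ id] simp: strict_mono_id)
next
  case (insert i I)
  then obtain r where r: "strict_mono (r :: nat \<Rightarrow> nat)" "\<forall>i\<in>I. \<exists>l. (\<lambda>n. f i (r n)) \<longlonglongrightarrow> l" by auto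
  have "bounded (range (f i \<circ> r))" using insert.prems[of i] by (auto intro: bounded_subset)
  then obtain l s where s: "strict_mono (s :: nat \<Rightarrow> nat)" "((f i \<circ> r) \<circ> s) \<longlonglongrightarrow> l"
    using bounded_imp_convergent_subsequence by blast
  have "\<exists>l. (\<lambda>n. f k ((r \<circ> s) n)) \<longlonglongrightarrow> l" if k: "k \<in> insert i I" for k
  proof (cases "k = i")
    case True
    then show ?thesis using s(2) by (auto simp: comp_def)
  next
    case False
    then obtain l where "(\<lambda>n. f k (r n)) \<longlonglongrightarrow> l" using r(2) k by blast
    from LIMSEQ_subseq_LIMSEQ[OF this s(1)] show ?thesis by (auto simp: comp_def)
  qed
  then show ?case using strict_mono_o[OF r(1) s(1)] by blast
qed

lemma sep_state_closed:
  assumes v: "valid_dims ds" and sep: "\<And>n. sep_state ds (\<sigma> n)" and \<rho>c: "\<rho> \<in> carrier_mat (dimp ds) (dimp ds)"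
    and lim: "\<And>a b. a < dimp ds \<Longrightarrow> b < dimp ds \<Longrightarrow> (\<lambda>n. \<sigma> n $$ (a, b)) \<longlonglongrightarrow> \<rho> $$ (a, b)"
  shows "sep_state ds \<rho>"
proof -
  let ?N = "dimp ds" and ?D = "2 * (dimp ds * dimp ds)"
  obtain p \<tau> where p: "\<And>n i. i < ?D \<Longrightarrow> 0 \<le> p n i"
    and \<tau>: "\<And>n i j. i < ?D \<Longrightarrow> j < length ds \<Longrightarrow> is_state (ds ! j) (\<tau> n i j)"
    and \<sigma>: "\<And>n. \<sigma> n = mat ?N ?N (\<lambda>ab. \<Sum>i<?D. complex_of_real (p n i) * trect ds ds (\<tau> n i) $$ ab)"
  proof -
    obtain q where q: "\<And>n. (\<forall>i<?D. 0 \<le> fst (q n) i) \<and> (\<forall>i<?D. \<forall>j<length ds. is_state (ds ! j) (snd (q n) i j)) \<and>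
      \<sigma> n = mat ?N ?N (\<lambda>ab. \<Sum>i<?D. complex_of_real (fst (q n) i) * trect ds ds (snd (q n) i) $$ ab)"
    proof -
      have "\<forall>n. \<exists>q. (\<forall>i<?D. 0 \<le> fst q i) \<and> (\<forall>i<?D. \<forall>j<length ds. is_state (ds ! j) (snd q i j)) \<and>
        \<sigma> n = mat ?N ?N (\<lambda>ab. \<Sum>i<?D. complex_of_real (fst q i) * trect ds ds (snd q i) $$ ab)"
        using sep_state_bounded_terms[OF v sep] by (simp add: split_paired_Ex)
      from choice[OF this] show thesis using that by blast
    qed
    then show thesis by (intro that[of "\<lambda>n. fst (q n)" "\<lambda>n. snd (q n)"]) blast+
  qed
  \<comment> \<open>The reduction to few terms takes place in the cone, without control of the total
    weight; taking traces shows that it is one.\<close>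
  have sum1: "(\<Sum>i<?D. p n i) = 1" for n
  proof -
    have "complex_of_real (\<Sum>i<?D. p n i) = ctrace (\<sigma> n)"
      by (rule mixture_trace[symmetric, OF v \<sigma> \<tau>])
    then show ?thesis using sep[of n] by (simp add: sep_state_def is_state_def del: of_real_sum)
  qed
  have "bounded (range (\<lambda>n. p n i))" if "i < ?D" for i
  proof -
    have "p n i \<le> 1" for n using p that member_le_sum[of i "{..<?D}" "p n"] sum1 by auto
    then have "\<bar>p n i\<bar> \<le> 1" for n using p[OF that, of n] by simp
    then show ?thesis by (auto intro!: boundedI[where B = 1])
  qed
  then obtain r where r: "strict_mono (r :: nat \<Rightarrow> nat)" "\<forall>i\<in>{..<?D}. \<exists>l. (\<lambda>n. p (r n) i) \<longlonglongrightarrow> l"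
    using finite_family_convergent_subsequence[of "{..<?D}" "\<lambda>i n. p n i"] by auto
  \<comment> \<open>The entries of all local factors form one finite bounded family, so a single
    further subsequence serves them simultaneously.\<close>
  define J where "J = {..<?D} \<times> (SIGMA j:{..<length ds}. {..<ds ! j} \<times> {..<ds ! j})"
  define g where "g = (\<lambda>(i, j, ab) n. \<tau> (r n) i j $$ ab)"
  have "finite J" unfolding J_def by (intro finite_cartesian_product finite_SigmaI) auto
  moreover have "bounded (range (g x))" if "x \<in> J" for x
  proof -
    obtain i j a b where x: "x = (i, j, a, b)" "i < ?D" "j < length ds" "a < ds ! j" "b < ds ! j"
      using \<open>x \<in> J\<close> unfolding J_def by (cases x) auto
    have "norm (g x n) \<le> 1" for n
      using psd_entry_bound[of "ds ! j" "\<tau> (r n) i j" a b] \<tau>[OF x(2,3), of "r n"] x by (simp add: g_def is_state_def)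
    then show ?thesis by (auto intro!: boundedI)
  qed
  ultimately obtain s where s: "strict_mono (s :: nat \<Rightarrow> nat)" "\<forall>x\<in>J. \<exists>l. (\<lambda>n. g x (s n)) \<longlonglongrightarrow> l"
    using finite_family_convergent_subsequence[of J g] by auto
  obtain P where P: "\<And>i. i < ?D \<Longrightarrow> (\<lambda>n. p (r n) i) \<longlonglongrightarrow> P i" using r(2) by (metis lessThan_iff)
  obtain G where G: "\<And>x. x \<in> J \<Longrightarrow> (\<lambda>n. g x (s n)) \<longlonglongrightarrow> G x" using s(2) by metis
  define F where "F i j = mat (ds ! j) (ds ! j) (\<lambda>ab. G (i, j, ab))" for i j
  have Flim: "(\<lambda>n. \<tau> (r (s n)) i j $$ (a, b)) \<longlonglongrightarrow> F i j $$ (a, b)"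
    if "i < ?D" "j < length ds" "a < ds ! j" "b < ds ! j" for i j a b
    using G[of "(i, j, a, b)"] that by (simp add: g_def J_def F_def)
  have Fst: "is_state (ds ! j) (F i j)" if "i < ?D" "j < length ds" for i j
    by (rule is_state_limit[of _ "\<lambda>n. \<tau> (r (s n)) i j"]) (use \<tau>[OF that] Flim[OF that] in \<open>auto simp: F_def\<close>)
  have Plim: "(\<lambda>n. p (r (s n)) i) \<longlonglongrightarrow> P i" if "i < ?D" for i
    using LIMSEQ_subseq_LIMSEQ[OF P[OF that] s(1)] by (simp add: comp_def)
  have P0: "0 \<le> P i" if "i < ?D" for i using LIMSEQ_le_const[OF P[OF that]] p[OF that] by auto
  have "(\<lambda>n. \<Sum>i<?D. p (r (s n)) i) \<longlonglongrightarrow> (\<Sum>i<?D. P i)" using Plim by (intro tendsto_sum) auto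
  then have P1: "(\<Sum>i<?D. P i) = 1" by (simp add: sum1 LIMSEQ_const_iff)
  have "\<rho> $$ (a, b) = (\<Sum>i<?D. complex_of_real (P i) * trect ds ds (F i) $$ (a, b))" if ab: "a < ?N" "b < ?N" for a b
  proof (rule LIMSEQ_unique)
    show "(\<lambda>n. \<sigma> (r (s n)) $$ (a, b)) \<longlonglongrightarrow> \<rho> $$ (a, b)"
      using LIMSEQ_subseq_LIMSEQ[OF lim[OF ab] strict_mono_o[OF r(1) s(1)]] by (simp add: comp_def)
    have "(\<lambda>n. \<Sum>i<?D. complex_of_real (p (r (s n)) i) * (\<Prod>j<length ds. \<tau> (r (s n)) i j $$ (digit ds j a, digit ds j b)))
      \<longlonglongrightarrow> (\<Sum>i<?D. complex_of_real (P i) * (\<Prod>j<length ds. F i j $$ (digit ds j a, digit ds j b)))"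
      using digit_less[OF v] by (intro tendsto_intros Plim Flim) auto
    then show "(\<lambda>n. \<sigma> (r (s n)) $$ (a, b)) \<longlonglongrightarrow> (\<Sum>i<?D. complex_of_real (P i) * trect ds ds (F i) $$ (a, b))"
      using ab by (simp add: \<sigma> index_trect)
  qed
  then have \<rho>: "\<rho> = mat ?N ?N (\<lambda>ab. \<Sum>i<?D. complex_of_real (P i) * trect ds ds (F i) $$ ab)"
    using \<rho>c by (intro eq_matI) auto
  have "is_state ?N \<rho>" by (rule is_state_limit[of _ \<sigma>]) (use sep \<rho>c lim in \<open>auto simp: sep_state_def\<close>)
  then show ?thesis unfolding sep_state_def tensor_list_eq_trect using P0 P1 Fst \<rho> by blast
qed

subsection \<open>Local effects separate matrices\<close>

text \<open>Every Gram vector becomes a Kraus operator with that vector, conjugated, as its row 0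
  and zeros elsewhere; \<open>0 < d\<close> provides the row.\<close>

lemma psd_kraus:
  assumes A: "psd d A" and d: "0 < d"
  obtains Ks where "\<forall>K\<in>set Ks. K \<in> carrier_mat d d" "lsum d (map (\<lambda>K. mat_adjoint K * K) Ks) = A"
proof -
  obtain w where w: "\<And>a b. a < d \<Longrightarrow> b < d \<Longrightarrow> A $$ (a, b) = (\<Sum>t<d. w t a * cnj (w t b))"
    using psd_gramE[OF A] by blast
  define K where "K t = mat d d (\<lambda>(a, b). if a = 0 then cnj (w t b) else 0)" for t
  have Kc: "K t \<in> carrier_mat d d" for t by (simp add: K_def)
  have "(mat_adjoint (K t) * K t) $$ (a, b) = w t a * cnj (w t b)" if ab: "a < d" "b < d" for t a b
  proof -
    have "(mat_adjoint (K t) * K t) $$ (a, b) = (\<Sum>l<d. mat_adjoint (K t) $$ (a, l) * K t $$ (l, b))"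
      using Kc ab by (intro index_mult_sum) auto
    also have "\<dots> = (\<Sum>l<d. if l = 0 then w t a * cnj (w t b) else 0)"
      using ab Kc by (intro sum.cong refl) (simp add: index_mat_adjoint K_def)
    finally show ?thesis using d by simp
  qed
  then have "lsum d (map (\<lambda>K. mat_adjoint K * K) (map K [0..<d])) = A"
    using psd_carrier[OF A] by (intro eq_matI)
      (auto simp: index_lsum w sum_list_sum_nth atLeast0LessThan simp del: index_mult_mat)
  then show thesis using that[of "map K [0..<d]"] Kc by auto
qed

lemma effect_instrument:
  assumes F: "psd d F" and G: "psd d (1\<^sub>m d - F)" and d: "0 < d"
  obtains Ks Ls where "local_instrument d [(d, Ks), (d, Ls)]" "lsum d (map (\<lambda>K. mat_adjoint K * K) Ks) = F"
proof -
  obtain Ks where Ks: "\<forall>K\<in>set Ks. K \<in> carrier_mat d d" "lsum d (map (\<lambda>K. mat_adjoint K * K) Ks) = F"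
    using psd_kraus[OF F d] by blast
  obtain Ls where Ls: "\<forall>K\<in>set Ls. K \<in> carrier_mat d d" "lsum d (map (\<lambda>K. mat_adjoint K * K) Ls) = 1\<^sub>m d - F"
    using psd_kraus[OF G d] by blast
  have "mat d d (\<lambda>ab. \<Sum>x\<leftarrow>[(d, Ks), (d, Ls)]. \<Sum>K\<leftarrow>snd x. (mat_adjoint K * K) $$ ab) =
      lsum d (map (\<lambda>K. mat_adjoint K * K) Ks) + lsum d (map (\<lambda>K. mat_adjoint K * K) Ls)"
    by (intro eq_matI) (auto simp: lsum_def comp_def)
  also have "\<dots> = 1\<^sub>m d" unfolding Ks(2) Ls(2) using psd_carrier[OF F] by (intro eq_matI) auto
  finally show thesis using that[of Ks Ls] Ks Ls d by (simp add: local_instrument_def)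
qed

lemma pull_embed_trect:
  assumes v: "valid_dims ds" and k: "k < length ds" and K: "\<forall>K\<in>set Ks. K \<in> carrier_mat (ds ! k) (ds ! k)"
    and G: "\<forall>j<length ds. G j \<in> carrier_mat (ds ! j) (ds ! j)" "G k = 1\<^sub>m (ds ! k)"
  shows "pull (dimp ds) (map (embed ds ds k) Ks) (trect ds ds G) =
    trect ds ds (\<lambda>j. if j = k then lsum (ds ! k) (map (\<lambda>K. mat_adjoint K * K) Ks) else G j)"
proof (rule eq_matI)
  let ?F = "lsum (ds ! k) (map (\<lambda>K. mat_adjoint K * K) Ks)"
  have dk: "0 < ds ! k" using v k by (simp add: valid_dims_def)
  fix a b assume "a < dim_row (trect ds ds (\<lambda>j. if j = k then ?F else G j))"
    "b < dim_col (trect ds ds (\<lambda>j. if j = k then ?F else G j))"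
  then have ab: "a < dimp ds" "b < dimp ds" by (auto simp: trect_def)
  have split: "trect ds ds (\<lambda>j. if j = k then X else G j) $$ (a, b) = X $$ (digit ds k a, digit ds k b) *
      (\<Prod>j\<in>{..<length ds} - {k}. G j $$ (digit ds j a, digit ds j b))" for X
    unfolding index_trect[OF ab] using k by (subst prod.remove[of _ k]) auto
  have "mat_adjoint (embed ds ds k K) * trect ds ds G * embed ds ds k K =
      trect ds ds (\<lambda>j. if j = k then mat_adjoint K * K else G j)" if "K \<in> set Ks" for K
  proof -
    have Kc: "K \<in> carrier_mat (ds ! k) (ds ! k)" using K that by auto
    let ?K = "\<lambda>j. if j = k then K else 1\<^sub>m (ds ! j)"
    have lo: "local_ops ds ds ?K" using local_ops_embed[OF v k dk Kc] by simp
    have e: "embed ds ds k K = trect ds ds ?K" using embed_eq_trect[OF v k dk Kc] by simp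
    have "mat_adjoint (embed ds ds k K) * trect ds ds G * mat_adjoint (mat_adjoint (embed ds ds k K)) =
        trect ds ds (\<lambda>j. mat_adjoint (?K j) * G j * mat_adjoint (mat_adjoint (?K j)))"
      unfolding e trect_adjoint[OF lo] using trect_conj[OF local_ops_adjoint[OF lo] G(1)] .
    also have "\<dots> = trect ds ds (\<lambda>j. if j = k then mat_adjoint K * K else G j)"
    proof (rule trect_cong)
      fix j assume j: "j < length ds"
      have "mat_adjoint K * 1\<^sub>m (ds ! k) = mat_adjoint K" using Kc by (intro right_mult_one_mat) auto
      then show "mat_adjoint (?K j) * G j * mat_adjoint (mat_adjoint (?K j)) = (if j = k then mat_adjoint K * K else G j)"
        using G j by auto
    qed
    finally show ?thesis by simp
  qed
  then have "pull (dimp ds) (map (embed ds ds k) Ks) (trect ds ds G) $$ (a, b) =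
      (\<Sum>K\<leftarrow>Ks. trect ds ds (\<lambda>j. if j = k then mat_adjoint K * K else G j) $$ (a, b))"
    using ab by (simp add: pull_def index_lsum comp_def cong: map_cong)
  also have "\<dots> = trect ds ds (\<lambda>j. if j = k then ?F else G j) $$ (a, b)"
    unfolding split using digit_less[OF v k] by (simp add: index_lsum comp_def sum_list_mult_const del: index_mult_mat)
  finally show "pull (dimp ds) (map (embed ds ds k) Ks) (trect ds ds G) $$ (a, b) =
      trect ds ds (\<lambda>j. if j = k then ?F else G j) $$ (a, b)" .
qed (auto simp: trect_def pull_def)

text \<open>The parties measure one after the other; the protocol stops at the first negative
  answer.\<close>

lemma locc_povm_product_effect:
  assumes v: "valid_dims ds"
    and F: "\<forall>j<length ds. psd (ds ! j) (F j) \<and> psd (ds ! j) (1\<^sub>m (ds ! j) - F j)"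
  shows "\<exists>Ms. locc_povm ds Ms \<and> trect ds ds F \<in> set Ms"
proof -
  \<comment> \<open>\<open>m\<close> counts the parties, from the last one backwards, whose factor
    is already \<open>F j\<close>; the others still have the identity. Since \<open>LD_step\<close>
    puts a new round in front, the protocol is built from its end.\<close>
  have "\<exists>D. LD ds D \<and> trect ds ds (\<lambda>j. if j < length ds - m then 1\<^sub>m (ds ! j) else F j) \<in> set (map snd D)"
    if "m \<le> length ds" for m using that
  proof (induction m)
    case 0
    have "trect ds ds (\<lambda>j. if j < length ds - 0 then 1\<^sub>m (ds ! j) else F j) = 1\<^sub>m (dimp ds)"
      unfolding trect_one[OF v, symmetric] by (rule trect_cong) auto
    then show ?case using LD_id[OF v] by (intro exI[of _ "[(ds, 1\<^sub>m (dimp ds))]"]) auto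
  next
    case (Suc m)
    define k where "k = length ds - Suc m"
    have k: "k < length ds" "length ds - m = Suc k" using Suc.prems by (auto simp: k_def)
    let ?G = "\<lambda>j. if j < length ds - m then 1\<^sub>m (ds ! j) else F j"
    obtain D where D: "LD ds D" "trect ds ds ?G \<in> set (map snd D)" using Suc by auto
    have dk: "0 < ds ! k" using v k by (simp add: valid_dims_def)
    obtain Ks Ls where I: "local_instrument (ds ! k) [(ds ! k, Ks), (ds ! k, Ls)]"
      and Ks: "lsum (ds ! k) (map (\<lambda>K. mat_adjoint K * K) Ks) = F k"
      using effect_instrument[of "ds ! k" "F k"] F k dk by blast
    let ?I = "[(ds ! k, Ks), (ds ! k, Ls)]"
    let ?D = "\<lambda>x. if x = (0::nat) then D else [(ds, 1\<^sub>m (dimp ds))]"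
    have "\<forall>x<length ?I. LD (ds[k := fst (?I ! x)]) (?D x)"
      using D(1) LD_id[OF v] by (auto simp: less_Suc_eq)
    from LD_step[OF v k(1) I this]
    have "LD ds (map (\<lambda>z. (fst z, pull (dimp ds) (map (embed ds ds k) Ks) (snd z))) D @
        [(ds, pull (dimp ds) (map (embed ds ds k) Ls) (1\<^sub>m (dimp ds)))])" by simp
    moreover have "pull (dimp ds) (map (embed ds ds k) Ks) (trect ds ds ?G) =
        trect ds ds (\<lambda>j. if j < length ds - Suc m then 1\<^sub>m (ds ! j) else F j)"
    proof -
      have "pull (dimp ds) (map (embed ds ds k) Ks) (trect ds ds ?G) =
          trect ds ds (\<lambda>j. if j = k then lsum (ds ! k) (map (\<lambda>K. mat_adjoint K * K) Ks) else ?G j)"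
        using local_instrumentD[OF I, of "(ds ! k, Ks)"] F k(2)
        by (intro pull_embed_trect[OF v k(1)]) (auto simp: psd_carrier)
      also have "\<dots> = trect ds ds (\<lambda>j. if j < length ds - Suc m then 1\<^sub>m (ds ! j) else F j)"
        unfolding Ks by (rule trect_cong) (use k in \<open>auto simp: k_def[symmetric]\<close>)
      finally show ?thesis .
    qed
    moreover have "pull (dimp ds) (map (embed ds ds k) Ks) (trect ds ds ?G) \<in>
        set (map snd (map (\<lambda>z. (fst z, pull (dimp ds) (map (embed ds ds k) Ks) (snd z))) D))"
      using D(2) by force
    ultimately show ?case
      by (intro exI[of _ "map (\<lambda>z. (fst z, pull (dimp ds) (map (embed ds ds k) Ks) (snd z))) D @
        [(ds, pull (dimp ds) (map (embed ds ds k) Ls) (1\<^sub>m (dimp ds)))]"]) simp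
  qed
  from this[of "length ds"] obtain D where "LD ds D" "trect ds ds F \<in> set (map snd D)" by auto
  then show ?thesis unfolding locc_povm_iff by (intro exI[of _ "map snd D"]) blast
qed

section \<open>Polarisation: matrix units from local effects\<close>

definition dyad :: "nat \<Rightarrow> (nat \<Rightarrow> complex) \<Rightarrow> complex mat" where
  "dyad d w = mat d d (\<lambda>(x, y). w x * cnj (w y))"

text \<open>Half the vector e_a + \<i>^t e_b of the polarisation identity, where \<i>^t runs through
  the fourth roots of unity. The factor 1/2 keeps its norm at most one, also for
  \<open>a = b\<close>, so that its dyad is an effect.\<close>

definition polvec :: "nat \<Rightarrow> nat \<Rightarrow> nat \<Rightarrow> nat \<Rightarrow> complex" where
  "polvec a b t x = ((if x = a then 1 else 0) + \<i> ^ t * (if x = b then 1 else 0)) / 2"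

lemma psd_dyad: "psd d (dyad d w)"
  by (rule psd_gramI[where T = "{()}" and w = "\<lambda>_. w"]) (auto simp: dyad_def)

text \<open>Only two coordinates of a test vector meet \<open>polvec\<close>, so the overlap is at
  most the mean of their moduli and hence at most the norm of the test vector.\<close>

lemma psd_one_minus_dyad:
  assumes ab: "a < d" "b < d"
  shows "psd d (1\<^sub>m d - dyad d (polvec a b t))"
proof -
  let ?w = "polvec a b t"
  have "qform d (1\<^sub>m d - dyad d ?w) u =
      complex_of_real ((\<Sum>x<d. (cmod (u x))\<^sup>2) - (cmod (\<Sum>x<d. cnj (u x) * ?w x))\<^sup>2)" for u
  proof -
    have 1: "qform d (1\<^sub>m d) u = complex_of_real (\<Sum>x<d. (cmod (u x))\<^sup>2)"
      unfolding qform_def of_real_sum complex_norm_square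
      by (intro sum.cong refl) (simp add: if_distrib[of "\<lambda>x. _ * x"] if_distrib[of "\<lambda>x. x * _"] mult.commute cong: if_cong)
    have 2: "qform d (dyad d ?w) u = complex_of_real ((cmod (\<Sum>x<d. cnj (u x) * ?w x))\<^sup>2)"
      using qform_gram[of d "dyad d ?w" "\<lambda>_. ?w" "{()}" u] by (simp add: dyad_def)
    have "qform d (1\<^sub>m d - dyad d ?w) u = qform d (1\<^sub>m d) u - qform d (dyad d ?w) u"
      unfolding qform_def sum_subtractf[symmetric] by (intro sum.cong refl) (simp add: dyad_def algebra_simps)
    then show ?thesis by (simp only: 1 2 of_real_diff)
  qed
  moreover have "(cmod (\<Sum>x<d. cnj (u x) * ?w x))\<^sup>2 \<le> (\<Sum>x<d. (cmod (u x))\<^sup>2)" for u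
  proof -
    let ?S = "\<Sum>x<d. (cmod (u x))\<^sup>2"
    have bound: "cmod (u x) \<le> sqrt ?S" if "x < d" for x
      using that by (intro real_le_rsqrt member_le_sum) auto
    have "(\<Sum>x<d. cnj (u x) * ?w x) = (\<Sum>x<d. (if x = a then cnj (u x) / 2 else 0) + (if x = b then \<i> ^ t * cnj (u x) / 2 else 0))"
      by (intro sum.cong refl) (auto simp: polvec_def algebra_simps)
    also have "\<dots> = cnj (u a) / 2 + \<i> ^ t * cnj (u b) / 2" using ab by (simp add: sum.distrib)
    finally have "cmod (\<Sum>x<d. cnj (u x) * ?w x) \<le> cmod (u a) / 2 + cmod (u b) / 2"
      using norm_triangle_ineq[of "cnj (u a) / 2" "\<i> ^ t * cnj (u b) / 2"] by (simp add: norm_mult norm_power norm_divide)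
    also have "\<dots> \<le> sqrt ?S" using bound[OF ab(1)] bound[OF ab(2)] by simp
    finally have "(cmod (\<Sum>x<d. cnj (u x) * ?w x))\<^sup>2 \<le> (sqrt ?S)\<^sup>2" by (intro power_mono) auto
    then show ?thesis by (simp add: sum_nonneg)
  qed
  ultimately show ?thesis unfolding psd_qform by (auto simp: dyad_def simp del: of_real_diff of_real_sum)
qed

text \<open>Of the four products in the dyad exactly one carries the phase inverse to \<i>^t; the
  others cancel in the sum over the fourth roots of unity.\<close>

lemma polarization:
  assumes "x < d" "y < d"
  shows "(\<Sum>t<4. \<i> ^ t * dyad d (polvec a b t) $$ (x, y)) = (if x = a then 1 else 0) * (if y = b then 1 else 0)"
proof -
  have "{..<4::nat} = {0, 1, 2, 3}" by auto
  then show ?thesis using assms by (auto simp: dyad_def polvec_def field_simps power3_eq_cube)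
qed

text \<open>The entry (b, a) is the trace of \<rho> against the matrix unit at (a, b), a tensor
  product of local matrix units. Expanding each of them by polarisation gives a sum over the choices
  \<open>f\<close> of one out of four local effects per party.\<close>

lemma entry_product_effects:
  assumes v: "valid_dims ds" and \<rho>: "\<rho> \<in> carrier_mat (dimp ds) (dimp ds)" and ab: "a < dimp ds" "b < dimp ds"
  shows "\<rho> $$ (b, a) = (\<Sum>f\<in>PiE {..<length ds} (\<lambda>_. {..<4}). (\<Prod>j<length ds. \<i> ^ f j) *
    ctrace (trect ds ds (\<lambda>j. dyad (ds ! j) (polvec (digit ds j a) (digit ds j b) (f j))) * \<rho>))"
proof -
  let ?P = "PiE {..<length ds} (\<lambda>_. {..<4::nat})"
  define V where "V j t x y = dyad (ds ! j) (polvec (digit ds j a) (digit ds j b) t) $$ (x, y)" for j t x y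
  have "(\<Sum>f\<in>?P. (\<Prod>j<length ds. \<i> ^ f j) *
      ctrace (trect ds ds (\<lambda>j. dyad (ds ! j) (polvec (digit ds j a) (digit ds j b) (f j))) * \<rho>)) =
     (\<Sum>f\<in>?P. \<Sum>x<dimp ds. \<Sum>y<dimp ds. (\<Prod>j<length ds. \<i> ^ f j * V j (f j) (digit ds j x) (digit ds j y)) * \<rho> $$ (y, x))"
    unfolding ctrace_mult[OF trect_carrier \<rho>] sum_distrib_left
    by (intro sum.cong refl) (simp add: index_trect V_def prod.distrib mult_ac)
  also have "\<dots> = (\<Sum>x<dimp ds. \<Sum>y<dimp ds. \<Sum>f\<in>?P. (\<Prod>j<length ds. \<i> ^ f j * V j (f j) (digit ds j x) (digit ds j y)) * \<rho> $$ (y, x))"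
    by (rule sum_swap3[symmetric])
  also have "\<dots> = (\<Sum>x<dimp ds. \<Sum>y<dimp ds. (if x = a then 1 else 0) * (if y = b then 1 else 0) * \<rho> $$ (y, x))"
  proof (intro sum.cong refl)
    fix x y assume xy: "x \<in> {..<dimp ds}" "y \<in> {..<dimp ds}"
    have "(\<Sum>f\<in>?P. \<Prod>j<length ds. \<i> ^ f j * V j (f j) (digit ds j x) (digit ds j y)) =
        (\<Prod>j<length ds. \<Sum>t<4. \<i> ^ t * V j t (digit ds j x) (digit ds j y))"
      by (intro prod_sum_PiE[symmetric]) auto
    also have "\<dots> = (\<Prod>j<length ds. (if digit ds j x = digit ds j a then 1 else 0) * (if digit ds j y = digit ds j b then 1 else 0))"
      unfolding V_def by (intro prod.cong refl polarization digit_less[OF v]) auto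
    also have "\<dots> = (if x = a then 1 else 0) * (if y = b then 1 else 0)"
      using prod_digit_delta[of x ds a, where 'a = complex] prod_digit_delta[of y ds b, where 'a = complex] xy ab
      by (simp add: prod.distrib)
    finally show "(\<Sum>f\<in>?P. (\<Prod>j<length ds. \<i> ^ f j * V j (f j) (digit ds j x) (digit ds j y)) * \<rho> $$ (y, x)) =
        (if x = a then 1 else 0) * (if y = b then 1 else 0) * \<rho> $$ (y, x)"
      by (simp only: sum_distrib_right[symmetric])
  qed
  also have "\<dots> = (\<Sum>x<dimp ds. if x = a then (\<Sum>y<dimp ds. if y = b then \<rho> $$ (y, x) else 0) else 0)"
  proof (rule sum.cong[OF refl])
    fix x
    show "(\<Sum>y<dimp ds. (if x = a then 1 else 0) * (if y = b then 1 else 0) * \<rho> $$ (y, x)) =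
        (if x = a then (\<Sum>y<dimp ds. if y = b then \<rho> $$ (y, x) else 0) else 0)"
      by (cases "x = a") (simp_all add: if_distrib[of "\<lambda>z. z * _"] cong: if_cong)
  qed
  also have "\<dots> = \<rho> $$ (b, a)" using ab by simp
  finally show ?thesis by simp
qed

subsection \<open>Measured relative entropy of entanglement\<close>

lemma tau_nonneg: "psd N M \<Longrightarrow> psd N \<rho> \<Longrightarrow> 0 \<le> tau M \<rho>"
  by (simp add: tau_def ctrace_psd_mult)

lemma tau_lsum:
  assumes "\<forall>M\<in>set Ms. M \<in> carrier_mat N N" "\<rho> \<in> carrier_mat N N"
  shows "tau (lsum N Ms) \<rho> = (\<Sum>M\<leftarrow>Ms. tau M \<rho>)"
  using assms(1)
proof (induction Ms)
  case Nil
  then show ?case using assms(2) by (simp add: tau_def lsum_Nil ctrace_def)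
next
  case (Cons M Ms)
  have "lsum N (M # Ms) * \<rho> = M * \<rho> + lsum N Ms * \<rho>"
    using Cons.prems assms(2) by (simp add: lsum_Cons add_mult_distrib_mat[of _ N N _ _ N])
  moreover have "ctrace (M * \<rho> + lsum N Ms * \<rho>) = ctrace (M * \<rho>) + ctrace (lsum N Ms * \<rho>)"
    using Cons.prems assms(2) unfolding ctrace_def by (auto simp: sum.distrib simp del: index_mult_mat(1))
  ultimately show ?case using Cons by (simp add: tau_def)
qed

lemma tau_one: "\<rho> \<in> carrier_mat N N \<Longrightarrow> tau (1\<^sub>m N) \<rho> = Re (ctrace \<rho>)"
  by (simp add: tau_def)

lemma tau_smult: "M \<in> carrier_mat N N \<Longrightarrow> \<rho> \<in> carrier_mat N N \<Longrightarrow> tau M (complex_of_real c \<cdot>\<^sub>m \<rho>) = c * tau M \<rho>"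
  by (simp add: tau_def mult_smult_distrib[of _ N N _ N] ctrace_smult[of _ N])

lemma tau_mixture:
  assumes "M \<in> carrier_mat N N" "\<forall>i<m. \<rho>s i \<in> carrier_mat N N"
  shows "tau M (mixture N m p \<rho>s) = (\<Sum>i<m. p i * tau M (\<rho>s i))"
proof -
  have "ctrace (M * mixture N m p \<rho>s) = (\<Sum>a<N. \<Sum>b<N. \<Sum>i<m. complex_of_real (p i) * (M $$ (a, b) * \<rho>s i $$ (b, a)))"
    unfolding ctrace_mult[OF assms(1), of "mixture N m p \<rho>s", unfolded mixture_def, OF mat_carrier] mixture_def
    by (intro sum.cong refl) (simp add: sum_distrib_left mult_ac)
  also have "\<dots> = (\<Sum>i<m. \<Sum>a<N. \<Sum>b<N. complex_of_real (p i) * (M $$ (a, b) * \<rho>s i $$ (b, a)))" by (rule sum_swap3)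
  also have "\<dots> = (\<Sum>i<m. complex_of_real (p i) * ctrace (M * \<rho>s i))"
    using assms by (intro sum.cong refl) (simp add: ctrace_mult[of _ N N] sum_distrib_left)
  finally show ?thesis by (simp add: tau_def)
qed

lemma sum_list_ereal_mult: "0 \<le> c \<Longrightarrow> (\<Sum>x\<leftarrow>xs. ereal c * f x) = ereal c * (\<Sum>x\<leftarrow>xs. f x)"
  using distrib_left_ereal_nn[of c] by (induction xs) (auto simp: mult.commute)

lemma ent_same: "ent p p = 0"
  by (simp add: ent_def zero_ereal_def)

lemma tau_out_unnorm:
  assumes M: "M \<in> carrier_mat (dimp (fst (L ! i))) (dimp (fst (L ! i)))" and \<rho>: "\<rho> \<in> carrier_mat N N"
    and K: "\<forall>K\<in>set (snd (L ! i)). K \<in> carrier_mat (dimp (fst (L ! i))) N"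
  shows "tau M (out_unnorm L i \<rho>) = tau (pull N (snd (L ! i)) M) \<rho>"
proof -
  let ?n = "dimp (fst (L ! i))"
  have KMK: "mat_adjoint K * M * K \<in> carrier_mat N N" if "K \<in> set (snd (L ! i))" for K
    using K M that by (intro mult_carrier_mat[of _ _ ?n]) auto
  have KrK: "K * \<rho> * mat_adjoint K \<in> carrier_mat ?n ?n" if "K \<in> set (snd (L ! i))" for K
    using K \<rho> that by (intro mult_carrier_mat[of _ _ N]) auto
  have comm: "tau A B = tau B A" if "A \<in> carrier_mat k k" "B \<in> carrier_mat k k" for A B k
    using ctrace_comm[OF that] by (simp add: tau_def)
  have "out_unnorm L i \<rho> = lsum ?n (map (\<lambda>K. K * \<rho> * mat_adjoint K) (snd (L ! i)))"
    by (simp add: out_unnorm_def lsum_def comp_def)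
  then have "tau M (out_unnorm L i \<rho>) = tau (lsum ?n (map (\<lambda>K. K * \<rho> * mat_adjoint K) (snd (L ! i)))) M"
    using comm[OF M lsum_carrier] by simp
  also have "\<dots> = (\<Sum>K\<leftarrow>snd (L ! i). tau (K * \<rho> * mat_adjoint K) M)"
    using KrK M by (subst tau_lsum) (auto simp: comp_def)
  also have "\<dots> = (\<Sum>K\<leftarrow>snd (L ! i). tau (mat_adjoint K * M * K) \<rho>)"
  proof (intro arg_cong[where f = sum_list] map_cong refl)
    fix K assume "K \<in> set (snd (L ! i))"
    then have Kc: "K \<in> carrier_mat ?n N" and Ka: "mat_adjoint K \<in> carrier_mat N ?n" using K by auto
    have "K * \<rho> * mat_adjoint K * M = K * \<rho> * (mat_adjoint K * M)"
      using Kc Ka M \<rho> by (intro assoc_mult_mat[of _ ?n N _ ?n _ ?n]) auto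
    then have "tau (K * \<rho> * mat_adjoint K) M = Re (ctrace (K * \<rho> * (mat_adjoint K * M)))" by (simp add: tau_def)
    also have "ctrace (K * \<rho> * (mat_adjoint K * M)) = ctrace ((mat_adjoint K * M) * (K * \<rho>))"
      using Kc Ka M \<rho> by (intro ctrace_comm[of _ ?n N]) auto
    also have "(mat_adjoint K * M) * (K * \<rho>) = mat_adjoint K * M * K * \<rho>"
      using Kc Ka M \<rho> by (intro assoc_mult_mat[symmetric, of _ N ?n _ N _ N]) auto
    finally show "tau (K * \<rho> * mat_adjoint K) M = tau (mat_adjoint K * M * K) \<rho>" by (simp add: tau_def)
  qed
  also have "\<dots> = tau (pull N (snd (L ! i)) M) \<rho>"
    unfolding pull_def using KMK \<rho> by (subst tau_lsum) (auto simp: comp_def)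
  finally show ?thesis .
qed

text \<open>The properties shared by the four combinations of the theorem.\<close>

locale measured_entanglement = local_cone C
  for C :: "nat list \<Rightarrow> complex mat \<Rightarrow> bool" +
  fixes MM :: "nat list \<Rightarrow> complex mat list \<Rightarrow> bool" and P :: "nat list \<Rightarrow> complex mat \<Rightarrow> bool"
  assumes P_iff: "valid_dims ds \<Longrightarrow> P ds \<rho> \<longleftrightarrow> is_state (dimp ds) \<rho> \<and> C ds \<rho>"
    and cone_smult: "valid_dims ds \<Longrightarrow> C ds A \<Longrightarrow> 0 \<le> c \<Longrightarrow> C ds (complex_of_real c \<cdot>\<^sub>m A)"
    and cone_psd: "valid_dims ds \<Longrightarrow> C ds A \<Longrightarrow> psd (dimp ds) A"
    and P_ex: "valid_dims ds \<Longrightarrow> \<exists>\<sigma>. P ds \<sigma>"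
    and P_closed: "valid_dims ds \<Longrightarrow> (\<And>n. P ds (\<sigma> n)) \<Longrightarrow> \<rho> \<in> carrier_mat (dimp ds) (dimp ds) \<Longrightarrow>
      (\<And>a b. a < dimp ds \<Longrightarrow> b < dimp ds \<Longrightarrow> (\<lambda>n. \<sigma> n $$ (a, b)) \<longlonglongrightarrow> \<rho> $$ (a, b)) \<Longrightarrow> P ds \<rho>"
    and MM_sep: "valid_dims ds \<Longrightarrow> MM ds Ms \<Longrightarrow> sep_povm ds Ms"
    and MM_locc: "valid_dims ds \<Longrightarrow> locc_povm ds Ms \<Longrightarrow> MM ds Ms"
    and MM_seq: "locc_instr ds L \<Longrightarrow> (\<forall>i<length L. MM (fst (L ! i)) (Ns i)) \<Longrightarrow> MM ds (seq_povm ds L Ns)"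
    and MM_joint: "joint_system ds es \<Longrightarrow> MM ds Ms \<Longrightarrow> (\<forall>i<length Ms. MM es (Ns i)) \<Longrightarrow>
      MM (joint_dims ds es) (joint_povm ds es Ms Ns)"
begin

lemma MM_gsep: "valid_dims ds \<Longrightarrow> MM ds Ms \<Longrightarrow> M \<in> set Ms \<Longrightarrow> gsep {1} ds M"
  using MM_sep sep_povm_iff by blast

lemma MM_psd: "valid_dims ds \<Longrightarrow> MM ds Ms \<Longrightarrow> M \<in> set Ms \<Longrightarrow> psd (dimp ds) M"
  using MM_gsep gsep_psd[of "{1}"] by simp

lemma sum_tau_MM:
  assumes "valid_dims ds" "MM ds Ms" "\<rho> \<in> carrier_mat (dimp ds) (dimp ds)"
  shows "(\<Sum>M\<leftarrow>Ms. tau M \<rho>) = Re (ctrace \<rho>)"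
proof -
  have "lsum (dimp ds) Ms = 1\<^sub>m (dimp ds)" using MM_sep sep_povm_iff assms(1,2) by blast
  moreover have "tau (lsum (dimp ds) Ms) \<rho> = (\<Sum>M\<leftarrow>Ms. tau M \<rho>)"
    using assms MM_psd by (intro tau_lsum) (auto simp: psd_carrier)
  ultimately show ?thesis using tau_one[OF assms(3)] by simp
qed

lemma MM_trivial: "valid_dims ds \<Longrightarrow> MM ds [1\<^sub>m (dimp ds)]"
  using LD_id[of ds] by (intro MM_locc) (auto simp: locc_povm_iff intro!: exI[of _ "[(ds, 1\<^sub>m (dimp ds))]"])

definition D :: "nat list \<Rightarrow> complex mat \<Rightarrow> complex mat \<Rightarrow> ereal" where
  "D ds \<rho> \<sigma> = (SUP Ms\<in>{Ms. MM ds Ms}. ment Ms \<rho> \<sigma>)"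

lemma ME_eq:
  assumes "valid_dims ds" "is_state (dimp ds) \<rho>"
  shows "ME MM P ds \<rho> = (INF \<sigma>\<in>{\<sigma>. P ds \<sigma>}. D ds \<rho> \<sigma>)"
proof -
  have "rel_ent (meas Ms \<rho>) (meas Ms \<sigma>) = ment Ms \<rho> \<sigma>" if "MM ds Ms" for Ms \<sigma>
    using MM_psd[OF assms(1) that] assms(2) by (intro rel_ent_meas) (auto simp: is_state_def intro: tau_nonneg)
  then show ?thesis unfolding ME_def D_def by (intro INF_cong SUP_cong) auto
qed

lemma ME_le:
  assumes "valid_dims ds" "is_state (dimp ds) \<rho>" "P ds \<sigma>"
  shows "ME MM P ds \<rho> \<le> D ds \<rho> \<sigma>"
  unfolding ME_eq[OF assms(1,2)] using assms(3) by (intro INF_lower) simp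

text \<open>The log-sum inequality with both totals equal to one.\<close>

lemma ment_nonneg:
  assumes v: "valid_dims ds" and "MM ds Ms" "is_state (dimp ds) \<rho>" "is_state (dimp ds) \<sigma>"
  shows "0 \<le> ment Ms \<rho> \<sigma>"
proof -
  have c: "psd (dimp ds) \<rho>" "psd (dimp ds) \<sigma>" using assms by (auto simp: is_state_def)
  have "ent (\<Sum>M\<leftarrow>Ms. tau M \<rho>) (\<Sum>M\<leftarrow>Ms. tau M \<sigma>) \<le> ment Ms \<rho> \<sigma>"
    unfolding ment_def using c MM_psd[OF v assms(2)] by (intro ent_log_sum_list) (auto intro: tau_nonneg)
  moreover have "(\<Sum>M\<leftarrow>Ms. tau M \<rho>) = 1" "(\<Sum>M\<leftarrow>Ms. tau M \<sigma>) = 1"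
    using sum_tau_MM[OF v assms(2)] c assms(3,4) by (auto simp: psd_carrier is_state_def)
  ultimately show ?thesis by (simp add: ent_same)
qed

lemma D_nonneg:
  assumes "valid_dims ds" "is_state (dimp ds) \<rho>" "is_state (dimp ds) \<sigma>"
  shows "0 \<le> D ds \<rho> \<sigma>"
  unfolding D_def using MM_trivial[OF assms(1)] ment_nonneg[OF assms(1) _ assms(2,3)]
  by (intro SUP_upper2[of "[1\<^sub>m (dimp ds)]"]) auto

lemma ME_nonneg:
  assumes "valid_dims ds" "is_state (dimp ds) \<rho>"
  shows "0 \<le> ME MM P ds \<rho>"
  unfolding ME_eq[OF assms] using D_nonneg[OF assms] P_iff[OF assms(1)] by (intro INF_greatest) auto

lemma P_normalize:
  assumes "valid_dims ds" "C ds T" "0 < Re (ctrace T)"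
  shows "P ds (complex_of_real (1 / Re (ctrace T)) \<cdot>\<^sub>m T)"
  using P_iff[OF assms(1)] is_state_normalize[OF cone_psd[OF assms(1,2)] assms(3)]
    cone_smult[OF assms(1,2), of "1 / Re (ctrace T)"] assms(3) by simp

text \<open>If all statistics of \<open>\<sigma> n\<close> approach those of \<open>\<rho>\<close>, then \<open>\<sigma> n\<close> tends to \<open>\<rho>\<close>, because the
  entries of a matrix are linear combinations of its expectations in product effects.\<close>

lemma faithful:
  assumes v: "valid_dims ds" and \<rho>: "is_state (dimp ds) \<rho>"
  shows "ME MM P ds \<rho> = 0 \<longleftrightarrow> P ds \<rho>"
proof
  assume "P ds \<rho>"
  then have "ME MM P ds \<rho> \<le> D ds \<rho> \<rho>" by (rule ME_le[OF v \<rho>])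
  also have "\<dots> \<le> 0" unfolding D_def by (rule SUP_least) (simp add: ment_def ent_same)
  finally show "ME MM P ds \<rho> = 0" using ME_nonneg[OF v \<rho>] by simp
next
  assume ME0: "ME MM P ds \<rho> = 0"
  \<comment> \<open>A vanishing infimum provides only a minimising sequence of free states.\<close>
  have "\<exists>\<sigma>. P ds \<sigma> \<and> D ds \<rho> \<sigma> < ereal (1 / real (Suc n))" for n
  proof -
    have "(INF \<sigma>\<in>{\<sigma>. P ds \<sigma>}. D ds \<rho> \<sigma>) < ereal (1 / real (Suc n))"
      using ME0 ME_eq[OF v \<rho>] by simp
    then show ?thesis unfolding INF_less_iff by auto
  qed
  then obtain \<sigma> where \<sigma>: "\<And>n. P ds (\<sigma> n)" "\<And>n. D ds \<rho> (\<sigma> n) < ereal (1 / real (Suc n))" by metis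
  have psd: "psd (dimp ds) \<rho>" "psd (dimp ds) (\<sigma> n)" and tr: "ctrace \<rho> = 1" "ctrace (\<sigma> n) = 1" for n
    using \<rho> \<sigma>(1)[of n] P_iff[OF v] by (auto simp: is_state_def)
  have lim: "(\<lambda>n. tau M (\<sigma> n)) \<longlonglongrightarrow> tau M \<rho>" if Ms: "locc_povm ds Ms" and M: "M \<in> set Ms" for M Ms
  proof -
    note MMs = MM_locc[OF v Ms]
    note nn = tau_nonneg[OF MM_psd[OF v MMs]]
    have "(sqrt (tau M \<rho>) - sqrt (tau M (\<sigma> n)))\<^sup>2 \<le> 1 / real (Suc n)" for n
    proof -
      let ?h = "\<lambda>M. (sqrt (tau M \<rho>) - sqrt (tau M (\<sigma> n)))\<^sup>2"
      have "?h M \<le> (\<Sum>M\<leftarrow>Ms. ?h M)" using M by (intro member_le_sum_list) auto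
      \<comment> \<open>Both distributions sum to one, so the linear terms of the Hellinger bound
        can be inserted without changing the sum.\<close>
      also have "\<dots> = (\<Sum>M\<leftarrow>Ms. tau M \<rho> - tau M (\<sigma> n) + ?h M)"
        using sum_tau_MM[OF v MMs] psd_carrier[OF psd(1)] psd_carrier[OF psd(2), of n] tr
        by (simp add: sum_list_addf sum_list_subtractf)
      finally have "ereal (?h M) \<le> ereal (\<Sum>M\<leftarrow>Ms. tau M \<rho> - tau M (\<sigma> n) + ?h M)" by simp
      also have "\<dots> = (\<Sum>M\<leftarrow>Ms. ereal (tau M \<rho> - tau M (\<sigma> n) + ?h M))"
        by (induction Ms) (auto simp: zero_ereal_def)
      also have "\<dots> \<le> ment Ms \<rho> (\<sigma> n)"
        unfolding ment_def using nn psd by (intro sum_list_mono ent_hellinger) auto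
      also have "\<dots> \<le> D ds \<rho> (\<sigma> n)" unfolding D_def using MMs by (intro SUP_upper) simp
      also have "\<dots> \<le> ereal (1 / real (Suc n))" using \<sigma>(2)[of n] by (rule less_imp_le)
      finally show ?thesis by simp
    qed
    then have "\<bar>sqrt (tau M (\<sigma> n)) - sqrt (tau M \<rho>)\<bar> \<le> sqrt (1 / real (Suc n))" for n
      by (metis abs_minus_commute power2_abs real_le_rsqrt)
    moreover have "(\<lambda>n. sqrt (1 / real (Suc n))) \<longlonglongrightarrow> 0"
      using tendsto_real_sqrt[OF LIMSEQ_inverse_real_of_nat] by (simp add: inverse_eq_divide)
    ultimately have "(\<lambda>n. sqrt (tau M (\<sigma> n)) - sqrt (tau M \<rho>)) \<longlonglongrightarrow> 0"
      by (rule_tac Lim_null_comparison[OF always_eventually]) (simp_all only: real_norm_def simp_thms)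
    then have "(\<lambda>n. sqrt (tau M (\<sigma> n))) \<longlonglongrightarrow> sqrt (tau M \<rho>)" by (simp add: LIM_zero_iff)
    then have "(\<lambda>n. (sqrt (tau M (\<sigma> n)))\<^sup>2) \<longlonglongrightarrow> (sqrt (tau M \<rho>))\<^sup>2" by (intro tendsto_power)
    then show ?thesis using nn[OF M] psd by simp
  qed
  show "P ds \<rho>"
  proof (rule P_closed[OF v \<sigma>(1) psd_carrier[OF psd(1)]])
    fix b a assume ab: "b < dimp ds" "a < dimp ds"
    define E where "E f = trect ds ds (\<lambda>j. dyad (ds ! j) (polvec (digit ds j a) (digit ds j b) (f j)))" for f
    have elim: "(\<lambda>n. ctrace (E f * \<sigma> n)) \<longlonglongrightarrow> ctrace (E f * \<rho>)" for f
    proof -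
      obtain Ms where Ms: "locc_povm ds Ms" "E f \<in> set Ms"
        using locc_povm_product_effect[OF v, of "\<lambda>j. dyad (ds ! j) (polvec (digit ds j a) (digit ds j b) (f j))"]
          psd_dyad psd_one_minus_dyad digit_less[OF v] unfolding E_def by blast
      have psdE: "psd (dimp ds) (E f)" using MM_psd[OF v MM_locc[OF v Ms(1)] Ms(2)] .
      \<comment> \<open>\<open>tau\<close> keeps only the real part; for positive matrices the trace
        is real, so convergence of \<open>tau\<close> is convergence of the trace.\<close>
      have "ctrace (E f * X) = complex_of_real (tau (E f) X)" if "psd (dimp ds) X" for X
        using ctrace_psd_mult(1)[OF psdE that] by (simp add: tau_def complex_eq_iff)
      then show ?thesis using tendsto_of_real[OF lim[OF Ms]] psd by simp
    qed
    have ent: "X $$ (b, a) = (\<Sum>f\<in>PiE {..<length ds} (\<lambda>_. {..<4}). (\<Prod>j<length ds. \<i> ^ f j) * ctrace (E f * X))"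
      if "psd (dimp ds) X" for X
      unfolding E_def using entry_product_effects[OF v psd_carrier[OF that] ab(2,1)] .
    show "(\<lambda>n. \<sigma> n $$ (b, a)) \<longlonglongrightarrow> \<rho> $$ (b, a)"
      unfolding ent[OF psd(1)] ent[OF psd(2)] by (intro tendsto_intros elim)
  qed
qed

section \<open>Mixtures and convexity\<close>

lemma mixture_state:
  assumes "\<forall>i<m. 0 \<le> p i" "(\<Sum>i<m. p i) = 1" "\<forall>i<m. is_state N (\<rho>s i)"
  shows "is_state N (mixture N m p \<rho>s)"
proof -
  have q: "qform N (mixture N m p \<rho>s) v = (\<Sum>i<m. complex_of_real (p i) * qform N (\<rho>s i) v)" for v
  proof -
    have "qform N (mixture N m p \<rho>s) v =
        (\<Sum>a<N. \<Sum>b<N. \<Sum>i<m. complex_of_real (p i) * (cnj (v a) * \<rho>s i $$ (a, b) * v b))"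
      unfolding qform_def mixture_def
      by (intro sum.cong refl) (simp add: sum_distrib_left sum_distrib_right mult_ac)
    also have "\<dots> = (\<Sum>i<m. \<Sum>a<N. \<Sum>b<N. complex_of_real (p i) * (cnj (v a) * \<rho>s i $$ (a, b) * v b))" by (rule sum_swap3)
    finally show ?thesis by (simp add: qform_def sum_distrib_left)
  qed
  have "psd N (mixture N m p \<rho>s)"
    using assms unfolding psd_qform q by (auto simp: mixture_def is_state_def psd_qform intro!: sum_nonneg sum.neutral)
  moreover have "ctrace (mixture N m p \<rho>s) = 1"
  proof -
    have "ctrace (mixture N m p \<rho>s) = (\<Sum>i<m. complex_of_real (p i) * (\<Sum>a<N. \<rho>s i $$ (a, a)))"
      unfolding ctrace_def mixture_def sum_distrib_left by (subst sum.swap) simp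
    also have "\<dots> = (\<Sum>i<m. complex_of_real (p i))"
      using assms(3) by (intro sum.cong refl) (auto simp: is_state_def ctrace_def dest!: psd_carrier)
    finally show ?thesis using assms(2) by (simp flip: of_real_sum)
  qed
  ultimately show ?thesis by (simp add: is_state_def)
qed

lemma P_mixture:
  assumes v: "valid_dims ds" and p: "\<forall>i<m. 0 \<le> p i" "(\<Sum>i<m. p i) = 1" and \<sigma>: "\<forall>i<m. P ds (\<sigma> i)"
  shows "P ds (mixture (dimp ds) m p \<sigma>)"
proof -
  have C: "C ds (\<sigma> i)" "is_state (dimp ds) (\<sigma> i)" if "i < m" for i using \<sigma> P_iff[OF v] that by auto
  have "mixture (dimp ds) m p \<sigma> = mat (dimp ds) (dimp ds) (\<lambda>ab. \<Sum>i<m. (complex_of_real (p i) \<cdot>\<^sub>m \<sigma> i) $$ ab)"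
    unfolding mixture_def
  proof (intro cong_mat refl, intro sum.cong refl)
    fix a b i assume "a < dimp ds" "b < dimp ds" "i \<in> {..<m}"
    then show "complex_of_real (p i) * \<sigma> i $$ (a, b) = (complex_of_real (p i) \<cdot>\<^sub>m \<sigma> i) $$ (a, b)"
      using cone_carrier[OF C(1)[of i]] by simp
  qed
  also have "C ds \<dots>" using C p by (intro cone_sum[OF v] cone_smult[OF v]) auto
  finally show ?thesis using P_iff[OF v] mixture_state[OF p] C(2) by auto
qed

text \<open>Joint convexity for a fixed measurement: the log-sum inequality for each effect, with
  the weights pulled out by homogeneity of \<open>ent\<close>.\<close>

lemma ment_mixture:
  assumes v: "valid_dims ds" and Ms: "MM ds Ms" and p: "\<forall>i<m. 0 \<le> p i"
    and \<rho>: "\<forall>i<m. is_state (dimp ds) (\<rho>s i)" and \<sigma>: "\<forall>i<m. is_state (dimp ds) (\<sigma>s i)"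
  shows "ment Ms (mixture (dimp ds) m p \<rho>s) (mixture (dimp ds) m p \<sigma>s) \<le> (\<Sum>i<m. ereal (p i) * ment Ms (\<rho>s i) (\<sigma>s i))"
proof -
  have c: "\<forall>i<m. \<rho>s i \<in> carrier_mat (dimp ds) (dimp ds)" "\<forall>i<m. \<sigma>s i \<in> carrier_mat (dimp ds) (dimp ds)"
    using \<rho> \<sigma> by (auto simp: is_state_def psd_carrier)
  have "ment Ms (mixture (dimp ds) m p \<rho>s) (mixture (dimp ds) m p \<sigma>s) \<le>
      (\<Sum>M\<leftarrow>Ms. \<Sum>i<m. ereal (p i) * ent (tau M (\<rho>s i)) (tau M (\<sigma>s i)))"
    unfolding ment_def
  proof (rule sum_list_mono)
    fix M assume "M \<in> set Ms"
    then have M: "psd (dimp ds) M" by (rule MM_psd[OF v Ms])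
    have "ent (tau M (mixture (dimp ds) m p \<rho>s)) (tau M (mixture (dimp ds) m p \<sigma>s)) \<le>
        (\<Sum>i<m. ent (p i * tau M (\<rho>s i)) (p i * tau M (\<sigma>s i)))"
      unfolding tau_mixture[OF psd_carrier[OF M] c(1)] tau_mixture[OF psd_carrier[OF M] c(2)]
      using p \<rho> \<sigma> by (intro ent_log_sum) (auto simp: is_state_def intro!: mult_nonneg_nonneg tau_nonneg[OF M])
    also have "\<dots> = (\<Sum>i<m. ereal (p i) * ent (tau M (\<rho>s i)) (tau M (\<sigma>s i)))"
      using p by (intro sum.cong refl ent_scale) auto
    finally show "ent (tau M (mixture (dimp ds) m p \<rho>s)) (tau M (mixture (dimp ds) m p \<sigma>s)) \<le>
        (\<Sum>i<m. ereal (p i) * ent (tau M (\<rho>s i)) (tau M (\<sigma>s i)))" .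
  qed
  also have "\<dots> = (\<Sum>i<m. \<Sum>M\<leftarrow>Ms. ereal (p i) * ent (tau M (\<rho>s i)) (tau M (\<sigma>s i)))"
    by (induction Ms) (auto simp: sum.distrib)
  also have "\<dots> = (\<Sum>i<m. ereal (p i) * ment Ms (\<rho>s i) (\<sigma>s i))"
    unfolding ment_def using p by (intro sum.cong refl sum_list_ereal_mult) auto
  finally show ?thesis .
qed

text \<open>Free states chosen for the components mix to a free state for the mixture, and joint
  convexity bounds its value. As the choices are independent, the infima may be taken inside the
  sum.\<close>

lemma convex:
  assumes v: "valid_dims ds" and p: "\<forall>i<m. 0 \<le> p i" "(\<Sum>i<m. p i) = 1" and \<rho>: "\<forall>i<m. is_state (dimp ds) (\<rho>s i)"
  shows "ME MM P ds (mixture (dimp ds) m p \<rho>s) \<le> (\<Sum>i<m. ereal (p i) * ME MM P ds (\<rho>s i))"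
proof -
  \<comment> \<open>Components of weight zero are removed because \<open>le_sum_INF\<close> asks for
    positive weights; in \<open>ereal\<close> they contribute zero even next to an infinite
    value.\<close>
  define J where "J = {i. i < m \<and> 0 < p i}"
  have J: "finite J" "J \<subseteq> {..<m}" by (auto simp: J_def)
  have J0: "p i = 0" if "i \<in> {..<m} - J" for i using that p(1) by (auto simp: J_def less_le)
  have "J \<noteq> {}" using J0 p(2) by (metis Diff_empty sum.neutral zero_neq_one)
  then obtain i0 where i0: "i0 \<in> J" by blast
  have sumJ: "(\<Sum>i<m. ereal (p i) * f i) = (\<Sum>i\<in>J. ereal (p i) * f i)" for f
    using J J0 by (intro sum.mono_neutral_right) (auto simp: zero_ereal_def[symmetric])
  let ?\<rho> = "mixture (dimp ds) m p \<rho>s"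
  have "ME MM P ds ?\<rho> \<le> 0 + (\<Sum>i\<in>J. ereal (p i) * (INF \<sigma>\<in>{\<sigma>. P ds \<sigma>}. D ds (\<rho>s i) \<sigma>))"
  proof (rule le_sum_INF[OF J(1)])
    show "{\<sigma>. P ds \<sigma>} \<noteq> {}" for i :: nat using P_ex[OF v] by auto
    show "0 \<le> D ds (\<rho>s i) \<sigma>" if "i \<in> J" "\<sigma> \<in> {\<sigma>. P ds \<sigma>}" for i \<sigma>
      using that J \<rho> P_iff[OF v] by (intro D_nonneg[OF v]) auto
    fix g assume g: "\<forall>i\<in>J. g i \<in> {\<sigma>. P ds \<sigma>}"
    \<comment> \<open>Components outside \<open>J\<close> have weight zero and get some free state,
      here \<open>g i0\<close>.\<close>
    define \<sigma>s where "\<sigma>s i = (if i \<in> J then g i else g i0)" for i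
    have \<sigma>s: "P ds (\<sigma>s i)" for i using g i0 by (auto simp: \<sigma>s_def)
    have st: "is_state (dimp ds) (\<sigma>s i)" for i using \<sigma>s P_iff[OF v] by blast
    have "ME MM P ds ?\<rho> \<le> D ds ?\<rho> (mixture (dimp ds) m p \<sigma>s)"
      using \<sigma>s by (intro ME_le[OF v] mixture_state[OF p \<rho>] P_mixture[OF v p]) auto
    also have "\<dots> \<le> (\<Sum>i<m. ereal (p i) * D ds (\<rho>s i) (\<sigma>s i))"
      unfolding D_def
    proof (rule SUP_least)
      fix Ms assume Ms: "Ms \<in> {Ms. MM ds Ms}"
      have "ment Ms ?\<rho> (mixture (dimp ds) m p \<sigma>s) \<le> (\<Sum>i<m. ereal (p i) * ment Ms (\<rho>s i) (\<sigma>s i))"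
        using Ms st by (intro ment_mixture[OF v _ p(1) \<rho>]) auto
      also have "\<dots> \<le> (\<Sum>i<m. ereal (p i) * (SUP Ms\<in>{Ms. MM ds Ms}. ment Ms (\<rho>s i) (\<sigma>s i)))"
        using Ms p(1) by (intro sum_mono ereal_mult_left_mono SUP_upper) auto
      finally show "ment Ms ?\<rho> (mixture (dimp ds) m p \<sigma>s) \<le>
          (\<Sum>i<m. ereal (p i) * (SUP Ms\<in>{Ms. MM ds Ms}. ment Ms (\<rho>s i) (\<sigma>s i)))" .
    qed
    also have "\<dots> = (\<Sum>i\<in>J. ereal (p i) * D ds (\<rho>s i) (g i))"
      unfolding sumJ by (intro sum.cong) (auto simp: \<sigma>s_def)
    finally show "ME MM P ds ?\<rho> \<le> 0 + (\<Sum>i\<in>J. ereal (p i) * D ds (\<rho>s i) (g i))" by simp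
  qed (auto simp: J_def)
  also have "\<dots> = (\<Sum>i\<in>J. ereal (p i) * ME MM P ds (\<rho>s i))"
    using \<rho> J by (auto simp: ME_eq[OF v] intro!: sum.cong)
  finally show ?thesis unfolding sumJ .
qed

text \<open>The chain rule for the relative entropy: the outcome \<open>i\<close> of a first measurement leaves the
  unnormalised states \<open>R i\<close> and \<open>T i\<close>, to which a measurement depending on \<open>i\<close> is
  applied.\<close>

lemma chain:
  fixes m :: nat
  assumes v: "\<And>i. i < m \<Longrightarrow> valid_dims (ds i)" and R: "\<And>i. i < m \<Longrightarrow> psd (dimp (ds i)) (R i)"
    and T: "\<And>i. i < m \<Longrightarrow> C (ds i) (T i)"
    and B: "\<And>Ns. (\<forall>i<m. MM (ds i) (Ns i)) \<Longrightarrow> (\<Sum>i<m. ment (Ns i) (R i) (T i)) \<le> B"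
  defines "p \<equiv> \<lambda>i. Re (ctrace (R i))" and "q \<equiv> \<lambda>i. Re (ctrace (T i))"
  shows "(\<Sum>i<m. ent (p i) (q i)) +
    (\<Sum>i<m. if p i = 0 then 0 else ereal (p i) * ME MM P (ds i) (complex_of_real (1 / p i) \<cdot>\<^sub>m R i)) \<le> B"
proof -
  have Rc: "R i \<in> carrier_mat (dimp (ds i)) (dimp (ds i))" and Tc: "T i \<in> carrier_mat (dimp (ds i)) (dimp (ds i))"
    and Tp: "psd (dimp (ds i)) (T i)" if "i < m" for i
    using R T v cone_psd cone_carrier psd_carrier that by auto
  have p0: "0 \<le> p i" and q0: "0 \<le> q i" if "i < m" for i
    using ctrace_psd(2)[OF R[OF that]] ctrace_psd(2)[OF Tp[OF that]] by (auto simp: p_def q_def)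
  have triv: "ment [1\<^sub>m (dimp (ds i))] (R i) (T i) = ent (p i) (q i)" if "i < m" for i
    by (simp add: ment_def tau_one[OF Rc[OF that]] tau_one[OF Tc[OF that]] p_def q_def)
  show ?thesis
  proof (cases "\<exists>i<m. p i \<noteq> 0 \<and> q i = 0")
    case True
    \<comment> \<open>An outcome that is possible for \<open>R\<close> but not for \<open>T\<close>
      makes the first stage alone infinite; trivial second measurements then show that
      \<open>B\<close> is infinite.\<close>
    then have "(\<Sum>i<m. ent (p i) (q i)) = \<infinity>" by (auto simp: sum_Pinfty ent_def)
    moreover have "(\<Sum>i<m. ent (p i) (q i)) \<le> B"
    proof -
      have "(\<Sum>i<m. ent (p i) (q i)) = (\<Sum>i<m. ment [1\<^sub>m (dimp (ds i))] (R i) (T i))" by (simp add: triv)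
      then show ?thesis using B[of "\<lambda>i. [1\<^sub>m (dimp (ds i))]"] MM_trivial v by simp
    qed
    ultimately show ?thesis by simp
  next
    case False
    define J where "J = {i. i < m \<and> p i \<noteq> 0}"
    have J: "finite J" "J \<subseteq> {..<m}" by (auto simp: J_def)
    have pq: "0 < p i" "0 < q i" if "i \<in> J" for i
      using that False p0[of i] q0[of i] by (auto simp: J_def less_le)
    define \<rho> where "\<rho> i = complex_of_real (1 / p i) \<cdot>\<^sub>m R i" for i
    define \<sigma> where "\<sigma> i = complex_of_real (1 / q i) \<cdot>\<^sub>m T i" for i
    have st: "is_state (dimp (ds i)) (\<rho> i)" "P (ds i) (\<sigma> i)" if "i \<in> J" for i
      using is_state_normalize[OF R, of i] P_normalize[OF v T, of i] pq[OF that] that J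
      by (auto simp: \<rho>_def \<sigma>_def p_def q_def)
    \<comment> \<open>Normalising the two states by different constants costs p ln (p / q), the
      \<open>i\<close>-th term of the first stage, because the probabilities of the second
      measurement sum to one.\<close>
    have split: "ment Ms (R i) (T i) = ent (p i) (q i) + ereal (p i) * ment Ms (\<rho> i) (\<sigma> i)"
      if i: "i \<in> J" and Ms: "MM (ds i) Ms" for i Ms
    proof -
      have im: "i < m" using i J by auto
      have nn: "0 \<le> tau M (\<rho> i)" "0 \<le> tau M (\<sigma> i)" if "M \<in> set Ms" for M
        using tau_nonneg[OF MM_psd[OF v[OF im] Ms that]] st[OF i] P_iff[OF v[OF im]] by (auto simp: is_state_def)
      have "tau M (R i) = p i * tau M (\<rho> i)" "tau M (T i) = q i * tau M (\<sigma> i)" if "M \<in> set Ms" for M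
        using tau_smult[OF psd_carrier[OF MM_psd[OF v[OF im] Ms that]] Rc[OF im], of "1 / p i"]
          tau_smult[OF psd_carrier[OF MM_psd[OF v[OF im] Ms that]] Tc[OF im], of "1 / q i"] pq[OF i]
        by (simp_all add: \<rho>_def \<sigma>_def)
      then have "ment Ms (R i) (T i) = (\<Sum>M\<leftarrow>Ms. ent (p i * tau M (\<rho> i)) (q i * tau M (\<sigma> i)))"
        unfolding ment_def by (simp cong: map_cong)
      also have "\<dots> = ereal (p i) * ment Ms (\<rho> i) (\<sigma> i) + ereal (p i * ln (p i / q i) * (\<Sum>M\<leftarrow>Ms. tau M (\<rho> i)))"
        unfolding ment_def using pq[OF i] nn by (intro sum_list_ent_scale2) auto
      also have "(\<Sum>M\<leftarrow>Ms. tau M (\<rho> i)) = 1"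
        using st(1)[OF i] sum_tau_MM[OF v[OF im] Ms, of "\<rho> i"] by (simp add: is_state_def psd_carrier)
      finally show ?thesis using pq[OF i] by (simp add: ent_def add.commute)
    qed
    have sumJ: "(\<Sum>i<m. f i) = (\<Sum>i\<in>J. f i)" if "\<And>i. i < m \<Longrightarrow> p i = 0 \<Longrightarrow> f i = 0" for f :: "nat \<Rightarrow> ereal"
      using J that by (intro sum.mono_neutral_right) (auto simp: J_def)
    have "(\<Sum>i<m. ent (p i) (q i)) + (\<Sum>i\<in>J. ereal (p i) * (SUP Ms\<in>{Ms. MM (ds i) Ms}. ment Ms (\<rho> i) (\<sigma> i))) \<le> B"
    proof (rule sum_SUP_le[OF J(1)])
      show "{Ms. MM (ds i) Ms} \<noteq> {}" if "i \<in> J" for i using MM_trivial v J that by blast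
      show "0 \<le> ment Ms (\<rho> i) (\<sigma> i)" if "i \<in> J" "Ms \<in> {Ms. MM (ds i) Ms}" for i Ms
      proof -
        have vi: "valid_dims (ds i)" using that(1) J v by auto
        show ?thesis using ment_nonneg[OF vi, of Ms "\<rho> i" "\<sigma> i"] that st[OF that(1)] P_iff[OF vi] by auto
      qed
      show "(\<Sum>i<m. ent (p i) (q i)) \<noteq> -\<infinity>" by (induction m) auto
      fix g assume g: "\<forall>i\<in>J. g i \<in> {Ms. MM (ds i) Ms}"
      \<comment> \<open>Outcomes of probability zero under \<open>R\<close> receive the trivial
        measurement, whose contribution is \<open>ent 0 (q i) = 0\<close>.\<close>
      define Ns where "Ns i = (if i \<in> J then g i else [1\<^sub>m (dimp (ds i))])" for i
      have "(\<Sum>i<m. ment (Ns i) (R i) (T i)) \<le> B" using g MM_trivial v by (intro B) (auto simp: Ns_def)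
      also have "(\<Sum>i<m. ment (Ns i) (R i) (T i)) = (\<Sum>i\<in>J. ment (Ns i) (R i) (T i))"
        by (rule sumJ) (simp add: Ns_def J_def triv, simp add: ent_def)
      also have "\<dots> = (\<Sum>i\<in>J. ent (p i) (q i) + ereal (p i) * ment (g i) (\<rho> i) (\<sigma> i))"
        using g by (intro sum.cong refl) (auto simp: Ns_def split)
      also have "\<dots> = (\<Sum>i<m. ent (p i) (q i)) + (\<Sum>i\<in>J. ereal (p i) * ment (g i) (\<rho> i) (\<sigma> i))"
        unfolding sum.distrib by (subst sumJ) (auto simp: ent_def)
      finally show "(\<Sum>i<m. ent (p i) (q i)) + (\<Sum>i\<in>J. ereal (p i) * ment (g i) (\<rho> i) (\<sigma> i)) \<le> B" .
    qed (use pq in \<open>auto simp: less_imp_le\<close>)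
    moreover have "(\<Sum>i<m. if p i = 0 then 0 else ereal (p i) * ME MM P (ds i) (\<rho> i)) \<le>
        (\<Sum>i\<in>J. ereal (p i) * (SUP Ms\<in>{Ms. MM (ds i) Ms}. ment Ms (\<rho> i) (\<sigma> i)))"
    proof -
      have "(\<Sum>i<m. if p i = 0 then 0 else ereal (p i) * ME MM P (ds i) (\<rho> i)) = (\<Sum>i\<in>J. ereal (p i) * ME MM P (ds i) (\<rho> i))"
        by (subst sumJ) (auto simp: J_def intro!: sum.cong)
      also have "\<dots> \<le> (\<Sum>i\<in>J. ereal (p i) * D (ds i) (\<rho> i) (\<sigma> i))"
        using st v J pq by (intro sum_mono ereal_mult_left_mono ME_le) (auto simp: less_imp_le)
      finally show ?thesis by (simp add: D_def)
    qed
    ultimately show ?thesis unfolding \<rho>_def[symmetric] by (meson add_left_mono order_trans)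
  qed
qed

text \<open>The bound is proved for every free \<sigma> separately: its post-measurement states are
  free up to normalisation and hence admissible in the infima on the left. The relative entropy of
  the outcome probabilities in the chain rule is nonnegative and is dropped.\<close>

lemma strong_monotone:
  assumes v: "valid_dims ds" and L: "locc_instr ds L" and \<rho>: "is_state (dimp ds) \<rho>"
  shows "(\<Sum>i<length L. if out_prob L i \<rho> = 0 then 0
      else ereal (out_prob L i \<rho>) * ME MM P (fst (L ! i)) (out_state L i \<rho>)) \<le> ME MM P ds \<rho>"
  unfolding ME_eq[OF v \<rho>]
proof (rule INF_greatest)
  let ?d = "\<lambda>i. fst (L ! i)"
  fix \<sigma> assume "\<sigma> \<in> {\<sigma>. P ds \<sigma>}"
  then have \<sigma>: "is_state (dimp ds) \<sigma>" "C ds \<sigma>" using P_iff[OF v] by auto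
  have vi: "valid_dims (?d i)" and loc: "\<And>K. K \<in> set (snd (L ! i)) \<Longrightarrow> locop ds (?d i) K" if "i < length L" for i
    using locc_instr_kraus[OF L] that by auto
  have Kc: "\<forall>K\<in>set (snd (L ! i)). K \<in> carrier_mat (dimp (?d i)) (dimp ds)" if "i < length L" for i
    using loc[OF that] by (auto intro: locop_carrier)
  have out: "out_unnorm L i X = mat (dimp (?d i)) (dimp (?d i)) (\<lambda>ab. \<Sum>A\<leftarrow>map (\<lambda>K. K * X * mat_adjoint K) (snd (L ! i)). A $$ ab)" for i X
    by (simp add: out_unnorm_def comp_def)
  have psdR: "psd (dimp (?d i)) (out_unnorm L i \<rho>)" if "i < length L" for i
    unfolding out using loc[OF that] \<rho>
    by (intro psd_cone.cone_sum_list[OF vi[OF that]]) (auto simp: is_state_def intro!: psd_cone.cone_locop)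
  have CT: "C (?d i) (out_unnorm L i \<sigma>)" if "i < length L" for i
    unfolding out using loc[OF that] \<sigma>(2)
    by (intro cone_sum_list[OF vi[OF that]]) (auto intro!: cone_locop)
  have c: "\<rho> \<in> carrier_mat (dimp ds) (dimp ds)" "\<sigma> \<in> carrier_mat (dimp ds) (dimp ds)"
    using \<rho> \<sigma> by (auto simp: is_state_def psd_carrier)
  define p where "p i = Re (ctrace (out_unnorm L i \<rho>))" for i
  define q where "q i = Re (ctrace (out_unnorm L i \<sigma>))" for i
  have "(\<Sum>i<length L. ent (p i) (q i)) + (\<Sum>i<length L. if p i = 0 then 0
      else ereal (p i) * ME MM P (?d i) (complex_of_real (1 / p i) \<cdot>\<^sub>m out_unnorm L i \<rho>)) \<le> D ds \<rho> \<sigma>"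
    unfolding p_def q_def
  proof (rule chain[OF vi psdR CT])
    fix Ns assume Ns: "\<forall>i<length L. MM (?d i) (Ns i)"
    have "ment (seq_povm ds L Ns) \<rho> \<sigma> = (\<Sum>i<length L. ment (map (pull (dimp ds) (snd (L ! i))) (Ns i)) \<rho> \<sigma>)"
      by (simp add: ment_def seq_povm_def sum_list_map_concat comp_def interv_sum_list_conv_sum_set_nat atLeast0LessThan)
    also have "\<dots> = (\<Sum>i<length L. ment (Ns i) (out_unnorm L i \<rho>) (out_unnorm L i \<sigma>))"
    proof (intro sum.cong refl)
      fix i assume "i \<in> {..<length L}"
      then have i: "i < length L" by simp
      have "tau M (out_unnorm L i X) = tau (pull (dimp ds) (snd (L ! i)) M) X"
        if "M \<in> set (Ns i)" "X \<in> carrier_mat (dimp ds) (dimp ds)" for M X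
        using MM_psd[OF vi[OF i] _ that(1)] Ns i that(2) Kc[OF i] by (intro tau_out_unnorm) (auto simp: psd_carrier)
      then show "ment (map (pull (dimp ds) (snd (L ! i))) (Ns i)) \<rho> \<sigma> = ment (Ns i) (out_unnorm L i \<rho>) (out_unnorm L i \<sigma>)"
        unfolding ment_def using c by (simp add: comp_def cong: map_cong)
    qed
    finally have eq: "ment (seq_povm ds L Ns) \<rho> \<sigma> =
        (\<Sum>i<length L. ment (Ns i) (out_unnorm L i \<rho>) (out_unnorm L i \<sigma>))" .
    show "(\<Sum>i<length L. ment (Ns i) (out_unnorm L i \<rho>) (out_unnorm L i \<sigma>)) \<le> D ds \<rho> \<sigma>"
      unfolding eq[symmetric] D_def using MM_seq[OF L Ns] by (intro SUP_upper) simp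
  qed auto
  moreover have "0 \<le> (\<Sum>i<length L. ent (p i) (q i))"
  proof -
    have sum1: "(\<Sum>i<length L. Re (ctrace (out_unnorm L i X))) = 1" if X: "X \<in> carrier_mat (dimp ds) (dimp ds)" "ctrace X = 1" for X
    proof -
      have "Re (ctrace (out_unnorm L i X)) = tau (pull (dimp ds) (snd (L ! i)) (1\<^sub>m (dimp (?d i)))) X" if "i < length L" for i
        using tau_out_unnorm[OF one_carrier_mat X(1) Kc[OF that]] tau_one[of "out_unnorm L i X" "dimp (?d i)"]
        by (simp add: out_unnorm_def)
      then have "(\<Sum>i<length L. Re (ctrace (out_unnorm L i X))) =
          (\<Sum>M\<leftarrow>map (\<lambda>i. pull (dimp ds) (snd (L ! i)) (1\<^sub>m (dimp (?d i)))) [0..<length L]. tau M X)"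
        by (simp add: comp_def interv_sum_list_conv_sum_set_nat atLeast0LessThan)
      also have "\<dots> = tau (lsum (dimp ds) (map (\<lambda>i. pull (dimp ds) (snd (L ! i)) (1\<^sub>m (dimp (?d i)))) [0..<length L])) X"
        using X by (intro tau_lsum[symmetric]) auto
      finally show ?thesis unfolding locc_instr_complete[OF L] using X by (simp add: tau_one)
    qed
    have "ent (\<Sum>i<length L. p i) (\<Sum>i<length L. q i) \<le> (\<Sum>i<length L. ent (p i) (q i))"
      using ctrace_psd(2)[OF psdR] ctrace_psd(2)[OF cone_psd[OF vi CT]] by (intro ent_log_sum) (auto simp: p_def q_def)
    moreover have "(\<Sum>i<length L. p i) = 1" "(\<Sum>i<length L. q i) = 1"
      using sum1 c \<rho> \<sigma> by (auto simp: p_def q_def is_state_def)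
    ultimately show ?thesis by (simp add: ent_same)
  qed
  ultimately have "(\<Sum>i<length L. if p i = 0 then 0
      else ereal (p i) * ME MM P (?d i) (complex_of_real (1 / p i) \<cdot>\<^sub>m out_unnorm L i \<rho>)) \<le> D ds \<rho> \<sigma>"
    using order_trans[OF add_increasing[OF _ order_refl]] by blast
  then show "(\<Sum>i<length L. if out_prob L i \<rho> = 0 then 0
      else ereal (out_prob L i \<rho>) * ME MM P (?d i) (out_state L i \<rho>)) \<le> D ds \<rho> \<sigma>"
    by (simp only: out_state_def out_prob_def p_def)
qed

text \<open>Here the first-stage term of the chain rule is kept: it is the value of
  \<open>Ms\<close> on the reduced states of the first system. The second-stage sum averages over
  conditional states of the second system that mix to \<open>red_Y\<close>; convexity bounds it
  below by a number independent of \<open>Ms\<close>, so the supremum over \<open>Ms\<close> acts on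
  the first term only.\<close>

lemma strong_superadditive:
  assumes vd: "valid_dims ds" and ve: "valid_dims es" and len: "length ds = length es"
    and \<rho>: "is_state (dimp (joint_dims ds es)) \<rho>"
  shows "ME MM P ds (red_X ds es \<rho>) + ME MM P es (red_Y ds es \<rho>) \<le> ME MM P (joint_dims ds es) \<rho>"
proof -
  interpret j: joint_system ds es using assms by unfold_locales auto
  note js = j.joint_system_axioms
  have js': "joint_system es ds" using assms by unfold_locales auto
  let ?J = "joint_dims ds es"
  have vJ: "valid_dims ?J" by (rule j.vj)
  \<comment> \<open>Stated for an arbitrary local cone, since it is applied to positivity as well as
    to \<open>C\<close>.\<close>
  have redX: "C' ds (red_X ds es X)" if "local_cone C'" "C' ?J X" for C' X
    unfolding red_X_eq_ctr[OF j.len] using that js'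
    by (intro local_cone.cone_ctr[of C'] gsep_one[OF ve]) (auto simp: joint_dims_commute[of es])
  have redY: "C' es (red_Y ds es X)" if "local_cone C'" "C' ?J X" for C' X
    unfolding red_Y_eq_ctr using that js by (intro local_cone.cone_ctr[of C'] gsep_one[OF vd]) auto
  have trX: "ctrace (red_X ds es X) = ctrace X" and trY: "ctrace (red_Y ds es X) = ctrace X"
    if "X \<in> carrier_mat (dimp ?J) (dimp ?J)" for X
  proof -
    have jo: "jt s ds ds es es (1\<^sub>m (dimp ds)) (1\<^sub>m (dimp es)) = 1\<^sub>m (dimp ?J)" for s by (rule jt_one[OF js])
    have "ctrace (1\<^sub>m (dimp es) * ctr True ds es (1\<^sub>m (dimp ds)) X) = ctrace (1\<^sub>m (dimp ?J) * X)"
      using ctrace_ctr[OF js one_carrier_mat that] jo by simp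
    then show "ctrace (red_Y ds es X) = ctrace X"
      using that by (simp add: red_Y_eq_ctr left_mult_one_mat[OF ctr_carrier])
    then show "ctrace (red_X ds es X) = ctrace X"
      using ctrace_ctr_one[OF js one_carrier_mat that] by (simp add: red_Y_eq_ctr red_X_def)
  qed
  have stX: "is_state (dimp ds) (red_X ds es X)" and stY: "is_state (dimp es) (red_Y ds es X)"
    if "is_state (dimp ?J) X" for X
    using redX[of "\<lambda>ds. psd (dimp ds)" X] redY[of "\<lambda>ds. psd (dimp ds)" X] psd_cone.local_cone_axioms that trX trY
    by (auto simp: is_state_def psd_carrier)
  have \<rho>c: "\<rho> \<in> carrier_mat (dimp ?J) (dimp ?J)" and \<rho>p: "psd (dimp ?J) \<rho>" using \<rho> by (auto simp: is_state_def psd_carrier)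
  let ?Y = "ME MM P es (red_Y ds es \<rho>)"
  show ?thesis unfolding ME_eq[OF vJ \<rho>]
  proof (rule INF_greatest)
    fix \<sigma> assume "\<sigma> \<in> {\<sigma>. P ?J \<sigma>}"
    then have \<sigma>: "is_state (dimp ?J) \<sigma>" "C ?J \<sigma>" using P_iff[OF vJ] by auto
    have \<sigma>c: "\<sigma> \<in> carrier_mat (dimp ?J) (dimp ?J)" using \<sigma>(2) by (rule cone_carrier)
    have P\<sigma>X: "P ds (red_X ds es \<sigma>)" using P_iff[OF vd] stX[OF \<sigma>(1)] redX[OF local_cone_axioms \<sigma>(2)] by blast
    have "ment Ms (red_X ds es \<rho>) (red_X ds es \<sigma>) + ?Y \<le> D ?J \<rho> \<sigma>" if Ms: "MM ds Ms" for Ms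
    proof -
      define R where "R i = ctr True ds es (Ms ! i) \<rho>" for i
      define T where "T i = ctr True ds es (Ms ! i) \<sigma>" for i
      define p where "p i = Re (ctrace (R i))" for i
      define q where "q i = Re (ctrace (T i))" for i
      have gM: "gsep {1} ds (Ms ! i)" if "i < length Ms" for i using MM_gsep[OF vd Ms] that by simp
      have pR: "psd (dimp es) (R i)" if "i < length Ms" for i
        unfolding R_def using psd_cone.cone_ctr[OF js gM[OF that] \<rho>p] .
      have CT: "C es (T i)" if "i < length Ms" for i
        unfolding T_def using cone_ctr[OF js gM[OF that] \<sigma>(2)] .
      have "(\<Sum>i<length Ms. ent (p i) (q i)) + (\<Sum>i<length Ms. if p i = 0 then 0
          else ereal (p i) * ME MM P es (complex_of_real (1 / p i) \<cdot>\<^sub>m R i)) \<le> D ?J \<rho> \<sigma>"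
        unfolding p_def q_def
      proof (rule chain[OF ve pR CT])
        fix Ns assume Ns: "\<forall>i<length Ms. MM es (Ns i)"
        have "ment (joint_povm ds es Ms Ns) \<rho> \<sigma> = (\<Sum>i<length Ms. ment (map (jt True ds ds es es (Ms ! i)) (Ns i)) \<rho> \<sigma>)"
          by (simp add: ment_def joint_povm_def sum_list_map_concat comp_def interv_sum_list_conv_sum_set_nat atLeast0LessThan)
        also have "\<dots> = (\<Sum>i<length Ms. ment (Ns i) (R i) (T i))"
        proof (intro sum.cong refl)
          fix i assume "i \<in> {..<length Ms}"
          then have "N \<in> carrier_mat (dimp es) (dimp es)" if "N \<in> set (Ns i)" for N
            using MM_psd[OF ve _ that] Ns by (auto simp: psd_carrier)
          then show "ment (map (jt True ds ds es es (Ms ! i)) (Ns i)) \<rho> \<sigma> = ment (Ns i) (R i) (T i)"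
            unfolding ment_def R_def T_def
            by (simp add: comp_def tau_def ctrace_ctr[OF js _ \<rho>c] ctrace_ctr[OF js _ \<sigma>c] cong: map_cong)
        qed
        finally have eq: "ment (joint_povm ds es Ms Ns) \<rho> \<sigma> = (\<Sum>i<length Ms. ment (Ns i) (R i) (T i))" .
        show "(\<Sum>i<length Ms. ment (Ns i) (R i) (T i)) \<le> D ?J \<rho> \<sigma>"
          unfolding eq[symmetric] D_def using MM_joint[OF js Ms Ns] by (intro SUP_upper) simp
      qed auto
      moreover have "(\<Sum>i<length Ms. ent (p i) (q i)) = ment Ms (red_X ds es \<rho>) (red_X ds es \<sigma>)"
        unfolding ment_def sum_list_sum_nth atLeast0LessThan p_def q_def R_def T_def tau_def
        by (auto simp: ctrace_ctr_one[OF js gsep_carrier[OF gM] \<rho>c] ctrace_ctr_one[OF js gsep_carrier[OF gM] \<sigma>c] intro!: sum.cong)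
      moreover have "?Y \<le> (\<Sum>i<length Ms. if p i = 0 then 0 else ereal (p i) * ME MM P es (complex_of_real (1 / p i) \<cdot>\<^sub>m R i))"
      proof -
        \<comment> \<open>Where the outcome has probability zero, \<open>red_Y\<close> is only a
          filler that makes every component a state.\<close>
        define \<rho>s where "\<rho>s i = (if p i = 0 then red_Y ds es \<rho> else complex_of_real (1 / p i) \<cdot>\<^sub>m R i)" for i
        have p0: "\<forall>i<length Ms. 0 \<le> p i" using ctrace_psd(2)[OF pR] by (auto simp: p_def)
        have lM: "lsum (dimp ds) Ms = 1\<^sub>m (dimp ds)" using MM_sep[OF vd Ms] sep_povm_iff[OF vd] by blast
        have "(\<Sum>i<length Ms. p i) = (\<Sum>M\<leftarrow>Ms. tau M (red_X ds es \<rho>))"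
          unfolding sum_list_sum_nth atLeast0LessThan p_def R_def tau_def
          by (auto simp: ctrace_ctr_one[OF js gsep_carrier[OF gM] \<rho>c] intro!: sum.cong)
        then have p1: "(\<Sum>i<length Ms. p i) = 1"
          using sum_tau_MM[OF vd Ms, of "red_X ds es \<rho>"] stX[OF \<rho>] by (simp add: is_state_def psd_carrier)
        have st: "\<forall>i<length Ms. is_state (dimp es) (\<rho>s i)"
          using stY[OF \<rho>] is_state_normalize[OF pR] p0 by (auto simp: \<rho>s_def p_def less_le)
        have "complex_of_real (p i) * \<rho>s i $$ (a, b) = R i $$ (a, b)" if "i < length Ms" "a < dimp es" "b < dimp es" for i a b
        proof (cases "p i = 0")
          case True
          then have "R i = 0\<^sub>m (dimp es) (dimp es)" using psd_trace_zero[OF pR[OF that(1)]] by (simp add: p_def)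
          then show ?thesis using True that by simp
        qed (use that in \<open>simp add: \<rho>s_def R_def ctr_def\<close>)
        then have "mixture (dimp es) (length Ms) p \<rho>s = mat (dimp es) (dimp es) (\<lambda>ab. \<Sum>i<length Ms. R i $$ ab)"
          unfolding mixture_def by (intro cong_mat refl) (auto intro!: sum.cong)
        also have "\<dots> = red_Y ds es \<rho>"
          unfolding R_def ctr_lsum lM red_Y_eq_ctr ..
        finally have "?Y \<le> (\<Sum>i<length Ms. ereal (p i) * ME MM P es (\<rho>s i))"
          using convex[OF ve p0 p1 st] by simp
        also have "\<dots> = (\<Sum>i<length Ms. if p i = 0 then 0 else ereal (p i) * ME MM P es (complex_of_real (1 / p i) \<cdot>\<^sub>m R i))"
          by (intro sum.cong refl) (auto simp: \<rho>s_def zero_ereal_def[symmetric])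
        finally show ?thesis .
      qed
      ultimately show ?thesis using order_trans[OF add_left_mono] by simp
    qed
    then have "(SUP Ms\<in>{Ms. MM ds Ms}. ment Ms (red_X ds es \<rho>) (red_X ds es \<sigma>) + ?Y) \<le> D ?J \<rho> \<sigma>"
      by (intro SUP_least) auto
    also have "(SUP Ms\<in>{Ms. MM ds Ms}. ment Ms (red_X ds es \<rho>) (red_X ds es \<sigma>) + ?Y) =
        D ds (red_X ds es \<rho>) (red_X ds es \<sigma>) + ?Y"
      unfolding D_def using MM_trivial[OF vd] ME_nonneg[OF ve stY[OF \<rho>]] by (intro SUP_ereal_add_left) auto
    finally show "ME MM P ds (red_X ds es \<rho>) + ?Y \<le> D ?J \<rho> \<sigma>"
      using ME_le[OF vd stX[OF \<rho>] P\<sigma>X] by (meson add_right_mono order_trans)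
  qed
qed

end

section \<open>The axioms for the four combinations of measurements and free states\<close>

lemma pptcone_one:
  assumes v: "valid_dims ds"
  shows "pptcone ds (1\<^sub>m (dimp ds))"
proof -
  have "ptrans ds S (1\<^sub>m (dimp ds)) = 1\<^sub>m (dimp ds)" for S
  proof (rule eq_matI)
    fix a b assume "a < dim_row (1\<^sub>m (dimp ds))" "b < dim_col (1\<^sub>m (dimp ds))"
    then have ab: "a < dimp ds" "b < dimp ds" by auto
    \<comment> \<open>If the two exchanged indices coincide, exchanging the digits back shows that
      \<open>a\<close> and \<open>b\<close> coincide.\<close>
    have "mixidx ds S a b = mixidx ds S b a \<longleftrightarrow> a = b"
      using mixidx_mixidx[OF v ab(1), of S b] mixidx_mixidx[OF v ab(2), of S a] by metis
    then show "ptrans ds S (1\<^sub>m (dimp ds)) $$ (a, b) = 1\<^sub>m (dimp ds) $$ (a, b)"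
      using ab by (simp add: ptrans_def mixidx_less[OF v])
  qed (auto simp: ptrans_def)
  then show ?thesis by (simp add: pptcone_def psd_one)
qed

lemma pptcone_psd:
  assumes "valid_dims ds" "pptcone ds A"
  shows "psd (dimp ds) A"
proof -
  have "mixidx ds {} a b = a" if "a < dimp ds" for a b
    using that by (simp add: mixidx_def compose_digit)
  then have "ptrans ds {} A = A" using assms(2) by (intro eq_matI) (auto simp: ptrans_def pptcone_def)
  then show ?thesis using assms(2) unfolding pptcone_def by (metis empty_subsetI)
qed

lemma is_state_maximally_mixed:
  "0 < N \<Longrightarrow> is_state N (complex_of_real (1 / real N) \<cdot>\<^sub>m 1\<^sub>m N)"
  using is_state_normalize[OF psd_one, of N] by (simp add: ctrace_def)

lemma measured_entanglementI:
  assumes "MM \<in> {locc_povm, sep_povm}" "P \<in> {sep_state, ppt_state}"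
  shows "\<exists>C. measured_entanglement C MM P"
proof -
  \<comment> \<open>The cone depends on the class of free states only; the class of measurements
    enters through the closure axioms.\<close>
  define C where "C = (if P = sep_state then gsep {0..} else pptcone)"
  have C: "local_cone C" unfolding C_def using gsep_cone.local_cone_axioms pptcone.local_cone_axioms by auto
  have iff: "P ds \<rho> \<longleftrightarrow> is_state (dimp ds) \<rho> \<and> C ds \<rho>" if "valid_dims ds" for ds \<rho>
    using assms(2) sep_state_iff[OF that] ppt_state_iff by (auto simp: C_def)
  have smult: "C ds (complex_of_real c \<cdot>\<^sub>m A)" if "valid_dims ds" "C ds A" "0 \<le> c" for ds c A
    using that pptcone_smult gsep_smult[of "{0..}" c] by (auto simp: C_def split: if_splits)
  have one: "C ds (1\<^sub>m (dimp ds))" if "valid_dims ds" for ds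
    using pptcone_one[OF that] gsep_one[OF that] by (simp add: C_def)
  have "measured_entanglement C MM P"
  proof (intro measured_entanglement.intro[OF C] measured_entanglement_axioms.intro)
    fix ds :: "nat list" and A assume v: "valid_dims ds"
    show "psd (dimp ds) A" if "C ds A"
      using that pptcone_psd[OF v] gsep_psd[of "{0..}"] by (auto simp: C_def split: if_splits)
    show "\<exists>\<sigma>. P ds \<sigma>"
      using is_state_maximally_mixed[OF dimp_pos[OF v]] smult[OF v one[OF v], of "1 / real (dimp ds)"] iff[OF v] by auto
  next
    fix ds \<sigma> \<rho> assume "valid_dims ds" "\<And>n. P ds (\<sigma> n)" "\<rho> \<in> carrier_mat (dimp ds) (dimp ds)"
      "\<And>a b. a < dimp ds \<Longrightarrow> b < dimp ds \<Longrightarrow> (\<lambda>n. \<sigma> n $$ (a, b)) \<longlonglongrightarrow> \<rho> $$ (a, b)"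
    then show "P ds \<rho>"
      using assms(2) sep_state_closed[of ds \<sigma> \<rho>] ppt_state_closed[of ds \<sigma> \<rho>] by auto
  next
    fix ds L Ns assume "locc_instr ds L" "\<forall>i<length L. MM (fst (L ! i)) (Ns i)"
    then show "MM ds (seq_povm ds L Ns)" using assms(1) locc_povm_seq sep_povm_seq by auto
  next
    fix ds es Ms Ns assume "joint_system ds es" "MM ds Ms" "\<forall>i<length Ms. MM es (Ns i)"
    then show "MM (joint_dims ds es) (joint_povm ds es Ms Ns)"
      using assms(1) locc_povm_joint sep_povm_joint by auto
  qed (use assms(1) locc_povm_sep_povm iff smult in auto)
  then show ?thesis by blast
qed

theorem theorem2:
  fixes MM :: "nat list \<Rightarrow> complex mat list \<Rightarrow> bool"
    and P :: "nat list \<Rightarrow> complex mat \<Rightarrow> bool"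
  assumes "MM \<in> {locc_povm, sep_povm}"
    and "P \<in> {sep_state, ppt_state}"
  shows
    "(\<forall>ds \<rho>. valid_dims ds \<longrightarrow> is_state (dimp ds) \<rho> \<longrightarrow>
        (ME MM P ds \<rho> = 0 \<longleftrightarrow> P ds \<rho>))
     \<and> (\<forall>ds m (p :: nat \<Rightarrow> real) \<rho>s. valid_dims ds \<longrightarrow> (\<forall>i<m. 0 \<le> p i) \<longrightarrow>
        (\<Sum>i<m. p i) = 1 \<longrightarrow> (\<forall>i<m. is_state (dimp ds) (\<rho>s i)) \<longrightarrow>
        ME MM P ds (mixture (dimp ds) m p \<rho>s) \<le> (\<Sum>i<m. ereal (p i) * ME MM P ds (\<rho>s i)))
     \<and> (\<forall>ds L \<rho>. valid_dims ds \<longrightarrow> locc_instr ds L \<longrightarrow> is_state (dimp ds) \<rho> \<longrightarrow>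
        (\<Sum>i<length L. if out_prob L i \<rho> = 0 then 0
            else ereal (out_prob L i \<rho>) * ME MM P (fst (L ! i)) (out_state L i \<rho>))
          \<le> ME MM P ds \<rho>)
     \<and> (\<forall>ds ds' \<rho>. valid_dims ds \<longrightarrow> valid_dims ds' \<longrightarrow> length ds = length ds' \<longrightarrow>
        is_state (dimp (joint_dims ds ds')) \<rho> \<longrightarrow>
        ME MM P ds (red_X ds ds' \<rho>) + ME MM P ds' (red_Y ds ds' \<rho>)
          \<le> ME MM P (joint_dims ds ds') \<rho>)"
proof -
  obtain C where "measured_entanglement C MM P" using measured_entanglementI[OF assms] by blast
  then interpret measured_entanglement C MM P .
  show ?thesis
    using faithful convex strong_monotone strong_superadditive by blast
qed

end
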